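(* Let $f(z,w)=(p(z),q(z,w))$ be a polynomial skew product in normal form, where $\delta=\deg p\ge 2$, $d=\deg_w q\ge 2$, $b_d(z)$ is the coefficient of $w^d$ in $q$, and $l=\deg b_d\ge 0$. Then $\Gamma_f$ is infinite if and only if one of the following holds: (i) $f(z,w)=(z^{\delta}, z^l w^d)$; (ii) $f(z,w)=(z^{\delta}, q(w))$, i.e. $p(z)=z^\delta$ and $q$ does not depend on $z$, with $q(w)\neq w^d$; (iii) $f(z,w)=(p(z), b_d(z) w^d)$, with $p(z)\neq z^{\delta}$ or $b_d(z)\neq z^l$; (iv) $f(z,w)=(z^{\delta}, q(z,w))$ with $q(z,w)\neq b_d(z)w^d$, and $f$ is semiconjugate to $(z^{\delta}, q(1,w))$ by $\pi(z,w)=(z^r,z^sw)$ for some nonzero coprime integers $r$ and $s$; here, if $l=0$, then $\delta=d$ and $s/r>0$, and if $l\neq 0$, then $\delta\neq d$ and $s/r=l/(\delta-d)$. Each condition is equivalent to the one with the same numeral in the following list: (i)$'$ $J_f=S^1\times S^1$; (ii)$'$ $J_f=S^1\times J$ for a one-dimensional Julia set $J$ which is not $S^1$; (iii)$'$ $J_f=\bigcup_{z\in J_p}\{z\}\times C_z$, where each $C_z$ is a circle about the origin which can be empty, and where $J_p$ is not $S^1$ or $C_z$ is not all the same over $J_p$; (iv)$'$ $J_f=\bigcup_{z\in S^1}\{z\}\times z^{s/r}J$ for a one-dimensional Julia set $J$ which is not $S^1$ (with $r,s$ nonzero coprime integers, the same as in (iv)). More precisely, $J$ in (ii)$'$ is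 $J_q$; the circle $C_z$ in (iii)$'$ is $\{w:\log|w|=-\Phi(z)\}$; and $J$ in (iv)$'$ is $J_{q(1,w)}$. The set $J_f$ in (i)$'$, (ii)$'$ or (iv)$'$ is compact. Equivalently again, numeral by numeral: (i)$''$ $\Gamma_f=S^1\times S^1$; (ii)$''$ $\Gamma_f=S^1\times\Sigma$ for a finite group $\Sigma$ in $S^1$; (iii)$''$ $\Gamma_f=\Sigma\times S^1$ for a finite group $\Sigma$ in $S^1$; (iv)$''$ $\Gamma_f=\{(\mu,\nu)\in S^1\times S^1:\mu^{as}=\nu^{ar}\}$ for an integer $a\neq 0$ (with $r,s$ the same as in (iv)). In particular, if $\Gamma_f$ is infinite then $\Gamma_f$ is compact. More precisely, $\Sigma$ in (ii)$''$ is $\Sigma_q$, and $\Sigma$ in (iii)$''$ is a subgroup of $\Sigma_p$ which includes $\Sigma_p\cap\{\sigma(z)=\mu z: b_d(\mu z)=\mu^l b_d(z)\}$.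
   Context: A polynomial skew product on $\mathbb{C}^2$ is a map $f(z,w)=(p(z),q(z,w))$ with $p(z)=a_\delta z^\delta+a_{\delta-1}z^{\delta-1}+\cdots+a_0$ and $q(z,w)=b_d(z)w^d+b_{d-1}(z)w^{d-1}+\cdots+b_0(z)$, where $a_\delta\ne0$, the $b_j$ are polynomials, $b_d\not\equiv 0$ has degree $l\ge0$, $\delta\ge2$, $d\ge2$. It is in normal form if $p$ and $b_d$ are monic, $a_{\delta-1}=0$ and $b_{d-1}\equiv0$. Write $q_z(w)=q(z,w)$ and $f^n(z,w)=(p^n(z),Q_z^n(w))$, where $Q_z^n=q_{p^{n-1}(z)}\circ\cdots\circ q_{p(z)}\circ q_z$. For a one-variable polynomial $P$ of degree at least $2$, $K_P=\{z:\{P^n(z)\}_{n\ge1}\text{ bounded}\}$ and $J_P=\partial K_P$ is its Julia set. A "one-dimensional Julia set" is the Julia set of such a polynomial. $S^1$ is the unit circle. $\Sigma_P$ is the group of maps $\sigma(z)=c_1z+c_2$ with $|c_1|=1$ and $\sigma(J_P)=J_P$. If $P$ is monic with vanishing coefficient of degree $\deg P-1$, every element of $\Sigma_P$ has the form $z\mapsto\mu z$ with $\mu \in S^1$, and $\Sigma_P$ is identified with the group of such $\mu$ in $S^1$. For $z\in K_p$ let $G_z(w)=\lim_{n\to\infty}d^{-n}\log^+|Q_z^n(w)|$ (the limit exists) and $K_z=\{w:G_z(w)=0\}$. Let $\Phi(z)=\sum_{n=0}^\infty d^{-(n+1)}\log|b_d(p^n(z))|\in[-\infty,\infty)$. The Julia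 set of $f$ is $J_f=\bigcup_{z\in J_p}\{z\}\times\partial K_z$, where $\partial K_z=\emptyset$ if $K_z=\mathbb{C}$. Let $S$ be the set of maps $\gamma(z,w)=(c_1z+c_2,\,c_3w+c_4(z))$ with $|c_1|=|c_3|=1$, $c_2\in\mathbb{C}$, and $c_4$ a polynomial. Set $\Gamma_f=\{\gamma\in S:\gamma(J_f)=J_f\}$. When $f$ is in normal form, every $\gamma\in\Gamma_f$ has the form $\gamma(z,w)=(\mu z,\nu w)$ with $\mu,\nu\in S^1$, and $\Gamma_f$ is identified with the subgroup of such pairs $(\mu,\nu)$ in $S^1\times S^1$. $f$ is semiconjugate to $f_0$ by $\pi$ means $\pi\circ f_0=f\circ\pi$ (as rational maps; if $r$ or $s$ is negative the identity is understood where $z\neq0$). For $z\in S^1$, $z^{s/r}J$ denotes $\{t^s w: t^r=z,\ w\in J\}$. *)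

theory Defs
  imports
    "HOL-Analysis.Analysis"
    "HOL-Computational_Algebra.Polynomial"
    "HOL-Algebra.Group"
begin

section \<open>Julia sets of polynomials in one variable\<close>

definition filled_julia :: "complex poly \<Rightarrow> complex set" where
  "filled_julia P = {z. bounded {(poly P ^^ n) z |n. n \<ge> 1}}"

definition julia :: "complex poly \<Rightarrow> complex set" where
  "julia P = frontier (filled_julia P)"

definition is_julia_set :: "complex set \<Rightarrow> bool" where
  "is_julia_set J \<longleftrightarrow> (\<exists>P. degree P \<ge> 2 \<and> J = julia P)"

definition julia_sym :: "complex poly \<Rightarrow> (complex \<Rightarrow> complex) set" where
  "julia_sym P = {\<sigma>. \<exists>c1 c2. norm c1 = 1 \<and> \<sigma> = (\<lambda>z. c1 * z + c2) \<and> \<sigma> ` julia P = julia P}"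


section \<open>Polynomial skew products\<close>

text \<open>
  The map \<open>f(z,w) = (p(z), q(z,w))\<close> is given by polynomials \<open>p\<close> in \<open>z\<close> and \<open>q\<close> in \<open>w\<close>, where the
  coefficients of \<open>q\<close> are polynomials in \<open>z\<close>. Thus \<open>\<delta> = degree p\<close>, \<open>d = degree q\<close>,
  \<open>b\<^sub>j = coeff q j\<close>, \<open>b\<^sub>d = lead_coeff q\<close> and \<open>l = degree (lead_coeff q)\<close>.
\<close>

definition fiber :: "complex poly poly \<Rightarrow> complex \<Rightarrow> complex poly" where
  "fiber q z = map_poly (\<lambda>b. poly b z) q"

definition skew :: "complex poly \<Rightarrow> complex poly poly \<Rightarrow> complex \<times> complex \<Rightarrow> complex \<times> complex" where
  "skew p q = (\<lambda>(z, w). (poly p z, poly (fiber q z) w))"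

definition normal_form :: "complex poly \<Rightarrow> complex poly poly \<Rightarrow> bool" where
  "normal_form p q \<longleftrightarrow>
     lead_coeff p = 1 \<and> lead_coeff (lead_coeff q) = 1 \<and>
     coeff p (degree p - 1) = 0 \<and> coeff q (degree q - 1) = 0"

definition fiber_iter :: "complex poly \<Rightarrow> complex poly poly \<Rightarrow> nat \<Rightarrow> complex \<Rightarrow> complex \<Rightarrow> complex" where
  "fiber_iter p q n z w = snd ((skew p q ^^ n) (z, w))"

text \<open>\<open>log\<^sup>+ x\<close> is written as \<open>ln (max 1 x)\<close>.\<close>

definition green :: "complex poly \<Rightarrow> complex poly poly \<Rightarrow> complex \<Rightarrow> complex \<Rightarrow> real" where
  "green p q z w = lim (\<lambda>n. ln (max 1 (norm (fiber_iter p q n z w))) / real (degree q) ^ n)"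

definition fiber_filled_julia :: "complex poly \<Rightarrow> complex poly poly \<Rightarrow> complex \<Rightarrow> complex set" where
  "fiber_filled_julia p q z = {w. green p q z w = 0}"

definition skew_julia :: "complex poly \<Rightarrow> complex poly poly \<Rightarrow> (complex \<times> complex) set" where
  "skew_julia p q = (SIGMA z:julia p. frontier (fiber_filled_julia p q z))"

definition elog :: "real \<Rightarrow> ereal" where
  "elog x = (if x = 0 then -\<infinity> else ereal (ln x))"

text \<open>
  For \<open>z\<close> in the filled Julia set of \<open>p\<close> the terms are bounded above by a summable real sequence, so
  the series converges in the topology of \<^typ>\<open>ereal\<close>, with sum less than \<open>\<infinity>\<close>.
\<close>

definition Phi :: "complex poly \<Rightarrow> complex poly poly \<Rightarrow> complex \<Rightarrow> ereal" where
  "Phi p q z =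
     (\<Sum>n. ereal (1 / real (degree q) ^ (n + 1)) * elog (norm (poly (lead_coeff q) ((poly p ^^ n) z))))"


section \<open>Symmetries of the Julia set\<close>

definition transforms :: "(complex \<times> complex \<Rightarrow> complex \<times> complex) set" where
  "transforms = {\<gamma>. \<exists>c1 c2 c3 c4. norm c1 = 1 \<and> norm c3 = 1 \<and>
     \<gamma> = (\<lambda>(z, w). (c1 * z + c2, c3 * w + poly c4 z))}"

definition skew_sym :: "complex poly \<Rightarrow> complex poly poly \<Rightarrow> (complex \<times> complex \<Rightarrow> complex \<times> complex) set" where
  "skew_sym p q = {\<gamma> \<in> transforms. \<gamma> ` skew_julia p q = skew_julia p q}"

abbreviation S1 :: "complex set" where
  "S1 \<equiv> sphere 0 1"

definition circle_group :: "complex monoid" where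
  "circle_group = \<lparr>carrier = S1, mult = (*), one = 1\<rparr>"

text \<open>
  The symmetry groups are sets of maps. Their identification with subgroups of \<open>S\<^sup>1\<close> and of
  \<open>S\<^sup>1 \<times> S\<^sup>1\<close> is made explicit by the following two injections.
\<close>

definition rot :: "complex \<Rightarrow> complex \<Rightarrow> complex" where
  "rot \<mu> = (\<lambda>z. \<mu> * z)"

definition rot2 :: "complex \<times> complex \<Rightarrow> complex \<times> complex \<Rightarrow> complex \<times> complex" where
  "rot2 = (\<lambda>(\<mu>, \<nu>) (z, w). (\<mu> * z, \<nu> * w))"


section \<open>The maps\<close>

text \<open>
  The identity \<open>\<pi> \<circ> f0 = f \<circ> \<pi>\<close> is one of rational maps, hence it is required only where
  \<open>z \<noteq> 0\<close>; if \<open>r\<close> and \<open>s\<close> are positive, it extends to \<open>z = 0\<close> by continuity.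
\<close>

definition semiconj_by :: "int \<Rightarrow> int \<Rightarrow> (complex \<times> complex \<Rightarrow> complex \<times> complex) \<Rightarrow>
    (complex \<times> complex \<Rightarrow> complex \<times> complex) \<Rightarrow> bool" where
  "semiconj_by r s f f0 \<longleftrightarrow>
     (let \<pi> = (\<lambda>(z, w). (z powi r, z powi s * w))
      in \<forall>z w. z \<noteq> 0 \<longrightarrow> \<pi> (f0 (z, w)) = f (\<pi> (z, w)))"

definition map_i :: "complex poly \<Rightarrow> complex poly poly \<Rightarrow> bool" where
  "map_i p q \<longleftrightarrow>
     p = monom 1 (degree p) \<and> q = monom (monom 1 (degree (lead_coeff q))) (degree q)"

definition map_ii :: "complex poly \<Rightarrow> complex poly poly \<Rightarrow> complex poly \<Rightarrow> bool" where
  "map_ii p q Q \<longleftrightarrow>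
     p = monom 1 (degree p) \<and> q = map_poly (\<lambda>c. [:c:]) Q \<and> Q \<noteq> monom 1 (degree q)"

definition map_iii :: "complex poly \<Rightarrow> complex poly poly \<Rightarrow> bool" where
  "map_iii p q \<longleftrightarrow>
     q = monom (lead_coeff q) (degree q) \<and>
     (p \<noteq> monom 1 (degree p) \<or> lead_coeff q \<noteq> monom 1 (degree (lead_coeff q)))"

definition map_iv :: "complex poly \<Rightarrow> complex poly poly \<Rightarrow> int \<Rightarrow> int \<Rightarrow> bool" where
  "map_iv p q r s \<longleftrightarrow>
     p = monom 1 (degree p) \<and> q \<noteq> monom (lead_coeff q) (degree q) \<and>
     r \<noteq> 0 \<and> s \<noteq> 0 \<and> coprime r s \<and>
     semiconj_by r s (skew p q) (\<lambda>(z, w). (z ^ degree p, poly (fiber q 1) w))"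


section \<open>Their Julia sets\<close>

definition julia_i :: "complex poly \<Rightarrow> complex poly poly \<Rightarrow> bool" where
  "julia_i p q \<longleftrightarrow> skew_julia p q = S1 \<times> S1"

definition julia_ii :: "complex poly \<Rightarrow> complex poly poly \<Rightarrow> bool" where
  "julia_ii p q \<longleftrightarrow> (\<exists>J. is_julia_set J \<and> J \<noteq> S1 \<and> skew_julia p q = S1 \<times> J)"

definition julia_iii :: "complex poly \<Rightarrow> complex poly poly \<Rightarrow> bool" where
  "julia_iii p q \<longleftrightarrow>
     (\<exists>C. (\<forall>z\<in>julia p. C z = {} \<or> (\<exists>\<rho>>0. C z = sphere 0 \<rho>)) \<and>
          skew_julia p q = (SIGMA z:julia p. C z) \<and>
          (julia p \<noteq> S1 \<or> \<not> (\<exists>A. \<forall>z\<in>julia p. C z = A)))"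

text \<open>The set \<open>z\<^bsup>s/r\<^esup>J\<close>, for all \<open>r\<close>-th roots \<open>t\<close> of \<open>z\<close> at once.\<close>

definition frac_pow_mult :: "int \<Rightarrow> int \<Rightarrow> complex \<Rightarrow> complex set \<Rightarrow> complex set" where
  "frac_pow_mult r s z J = {t powi s * w |t w. t powi r = z \<and> w \<in> J}"

definition julia_iv :: "complex poly \<Rightarrow> complex poly poly \<Rightarrow> int \<Rightarrow> int \<Rightarrow> bool" where
  "julia_iv p q r s \<longleftrightarrow>
     r \<noteq> 0 \<and> s \<noteq> 0 \<and> coprime r s \<and>
     (\<exists>J. is_julia_set J \<and> J \<noteq> S1 \<and> skew_julia p q = (SIGMA z:S1. frac_pow_mult r s z J))"


section \<open>Their symmetry groups\<close>

definition group_i :: "complex poly \<Rightarrow> complex poly poly \<Rightarrow> bool" where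
  "group_i p q \<longleftrightarrow> skew_sym p q = rot2 ` (S1 \<times> S1)"

definition group_ii :: "complex poly \<Rightarrow> complex poly poly \<Rightarrow> complex set \<Rightarrow> bool" where
  "group_ii p q \<Sigma> \<longleftrightarrow>
     subgroup \<Sigma> circle_group \<and> finite \<Sigma> \<and> skew_sym p q = rot2 ` (S1 \<times> \<Sigma>)"

definition group_iii :: "complex poly \<Rightarrow> complex poly poly \<Rightarrow> complex set \<Rightarrow> bool" where
  "group_iii p q \<Sigma> \<longleftrightarrow>
     subgroup \<Sigma> circle_group \<and> finite \<Sigma> \<and> skew_sym p q = rot2 ` (\<Sigma> \<times> S1)"

definition group_iv :: "complex poly \<Rightarrow> complex poly poly \<Rightarrow> int \<Rightarrow> int \<Rightarrow> bool" where
  "group_iv p q r s \<longleftrightarrow>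
     r \<noteq> 0 \<and> s \<noteq> 0 \<and> coprime r s \<and>
     (\<exists>a::int. a \<noteq> 0 \<and>
        skew_sym p q = rot2 ` {(\<mu>, \<nu>) \<in> S1 \<times> S1. \<mu> powi (a * s) = \<nu> powi (a * r)})"

end

theory Submission
  imports Defs
    "HOL-Computational_Algebra.Fundamental_Theorem_Algebra"
    "HOL-Complex_Analysis.Complex_Analysis"
begin

text \<open>
  Let \<open>E\<^sub>z\<close> be the boundary of \<open>K\<^sub>z\<close>, so that \<open>J\<^sub>f\<close> consists of the sets \<open>{z} \<times> E\<^sub>z\<close> over \<open>J\<^sub>p\<close>,
  and \<open>E\<^sub>z\<close> is the preimage of \<open>E\<close> over \<open>p(z)\<close> under \<open>q\<^sub>z\<close>. A symmetry of \<open>J\<^sub>f\<close> moves the sets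
  \<open>E\<^sub>z\<close> by affine maps, and the whole proof extracts functional equations for \<open>p\<close> and \<open>q\<close> from this.

  The tool is a rigidity theorem for preimages (\<open>preimage_rigidity\<close>): if two monic polynomials of
  the same degree have a common preimage of two compact sets, they differ by a constant. The reason is
  that the mean of one polynomial over a fibre of the other over \<open>w\<close> is \<open>w\<close> plus a constant, so that the
  two sets have the same farthest points up to a translation, and over a farthest point a mean is attained
  only if all values agree. For polynomials without a term of subleading degree, an affine map between the
  preimages has to be linear (\<open>centred_preimage_rigidity\<close>). This replaces the equilibrium measures and
  their barycentres of the classical argument.

  Applied to \<open>p\<close> it shows that a symmetry is \<open>(z, w) \<mapsto> (\<mu>z, \<nu>w)\<close> with
  \<open>p(\<mu>z) = \<mu>\<^sup>\<delta> p(z)\<close>. Applied to the fibres over \<open>z\<close> and \<open>\<mu>z\<close> it yields, for each coefficient,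
  \<open>b\<^sub>d(z) b\<^sub>j(\<mu>z) \<nu>\<^sup>j = \<nu>\<^sup>d b\<^sub>d(\<mu>z) b\<^sub>j(z)\<close> (\<open>rotations_coeff\<close>). Applied once more over \<open>p(z)\<close> and \<open>p(\<mu>z)\<close>,
  and compared with the symmetry \<open>(\<mu>\<^sup>\<delta>, \<nu>\<^sup>\<delta>)\<close>, it determines \<open>b\<^sub>d(\<mu>z)/b\<^sub>d(z)\<close> up to roots of
  unity as soon as some lower coefficient does not vanish (\<open>rotations_lead_coeff\<close>). If infinitely many \<open>\<mu>\<close>
  occur, a nonzero root of \<open>p\<close>, of \<open>b\<^sub>d\<close> or of a \<open>b\<^sub>j\<close> would have infinitely many rotated copies; hence all of
  them are monomials, and their exponents satisfy one weight relation
  (\<open>infinite_base_symmetries\<close>). Weight zero is case (ii), the other weights are case (iv). If all lower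
  coefficients vanish, every \<open>E\<^sub>z\<close> is empty or a circle about the origin; these are the cases (i) and (iii).

  All of this needs fibres for which \<open>E\<^sub>z\<close> is bounded and infinite. They exist over the points with
  \<open>\<Phi>(z) > -\<infinity>\<close>, called tame below, and \<open>J\<^sub>p\<close> has infinitely many of those: the mean of \<open>log |b\<^sub>d|\<close> over the
  preimages of an escaping point under \<open>p\<^sup>n\<close> is bounded below by a resultant, and preimages
  whose orbits do at least as well as the mean accumulate at a tame point (\<open>exists_tame_point\<close>).

  Conversely, for the maps in (i)--(iv) the Julia set and its symmetries are computed directly, and the
  Julia sets and the groups are told apart by the rotations \<open>(1, \<nu>)\<close> and \<open>(t\<^sup>r, t\<^sup>s)\<close> that they contain:
  the former force the lower coefficients to vanish (\<open>power_map_iff\<close>), the latter determine the weight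
  (\<open>weighted_of_rotations\<close>).
\<close>

section \<open>Fibres of a polynomial\<close>

lemma poly_surj:
  fixes P :: "complex poly"
  assumes "degree P \<ge> 1"
  shows "\<exists>x. poly P x = w"
proof -
  have "degree (P - [:w:]) \<ge> 1"
    using assms unfolding diff_conv_add_uminus by (subst degree_add_eq_left) auto
  hence "degree (P - [:w:]) > 0" by simp
  from alg_closed_imp_poly_has_root[OF this] show ?thesis by auto
qed

lemma poly_image_vimage:
  fixes P :: "complex poly"
  assumes "degree P \<ge> 1"
  shows "poly P ` (poly P -` E) = E"
  using poly_surj[OF assms] by (auto simp: image_iff) metis

lemma fibre_degree:
  fixes P :: "complex poly"
  assumes "degree P \<ge> 1"
  shows "degree (P - [:w:]) = degree P" "P - [:w:] \<noteq> 0"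
    "lead_coeff (P - [:w:]) = lead_coeff P"
proof -
  show 1: "degree (P - [:w:]) = degree P"
    using assms unfolding diff_conv_add_uminus by (subst degree_add_eq_left) auto
  show "P - [:w:] \<noteq> 0"
    using assms 1 by force
  show "lead_coeff (P - [:w:]) = lead_coeff P"
    using assms 1 by (simp add: coeff_pCons split: nat.splits)
qed

text \<open>
  Multiple points of fibres are critical points, and these number at most \<open>degree P - 1\<close> with
  multiplicity, whereas two fibres together have \<open>2 * degree P\<close> points with multiplicity.
\<close>

lemma card_fibre_two_points:
  fixes P :: "complex poly"
  assumes "degree P \<ge> 1" "a \<noteq> b"
  shows "card (poly P -` {a, b}) > degree P"
proof -
  let ?R = "\<lambda>c. {x. poly (P - [:c:]) x = 0}"
  have fin: "finite (?R c)" for c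
    by (intro poly_roots_finite fibre_degree assms)
  have sz: "(\<Sum>x\<in>?R c. order x (P - [:c:])) = degree P" for c
  proof -
    have "degree P = size (proots (P - [:c:]))"
      using fibre_degree[OF assms(1)] by (simp add: size_proots_complex)
    also have "\<dots> = (\<Sum>x\<in>?R c. order x (P - [:c:]))"
      using fibre_degree(2)[OF assms(1), of c]
      by (simp add: size_multiset_overloaded_eq)
    finally show ?thesis by simp
  qed
  have ord: "order x (P - [:c:]) = Suc (order x (pderiv P))" if "x \<in> ?R c" for x c
    using order_pderiv[of "P - [:c:]" x] that fibre_degree(2)[OF assms(1), of c]
    by (simp add: pderiv_diff pderiv_pCons)
  have sc: "card (?R c) + (\<Sum>x\<in>?R c. order x (pderiv P)) = degree P" for c
  proof -
    have "(\<Sum>x\<in>?R c. order x (P - [:c:])) = (\<Sum>x\<in>?R c. Suc (order x (pderiv P)))"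
      by (intro sum.cong refl ord) 
    thus ?thesis using sz[of c] by (simp add: sum.distrib sum_Suc)
  qed
  have disj: "?R a \<inter> ?R b = {}" using assms(2) by auto
  have un: "poly P -` {a, b} = ?R a \<union> ?R b" by auto
  have d0: "pderiv P \<noteq> 0" using assms(1) by (simp add: pderiv_eq_0_iff)
  have "(\<Sum>x\<in>?R a \<union> ?R b. order x (pderiv P)) = (\<Sum>x\<in>(?R a \<union> ?R b) \<inter> {x. poly (pderiv P) x = 0}. order x (pderiv P))"
    by (intro sum.mono_neutral_right) (use fin in \<open>auto simp: order_root\<close>)
  also have "\<dots> \<le> (\<Sum>x | poly (pderiv P) x = 0. order x (pderiv P))"
    by (intro sum_mono2) (use d0 in \<open>auto intro: poly_roots_finite\<close>)
  also have "\<dots> \<le> degree (pderiv P)" by (rule sum_order_le_degree[OF d0])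
  also have "\<dots> = degree P - 1" by (rule degree_pderiv)
  finally have "(\<Sum>x\<in>?R a \<union> ?R b. order x (pderiv P)) \<le> degree P - 1" .
  moreover have "(\<Sum>x\<in>?R a \<union> ?R b. order x (pderiv P)) =
     (\<Sum>x\<in>?R a. order x (pderiv P)) + (\<Sum>x\<in>?R b. order x (pderiv P))"
    by (rule sum.union_disjoint[OF fin fin disj])
  moreover have "card (?R a \<union> ?R b) = card (?R a) + card (?R b)"
    by (rule card_Un_disjoint[OF fin fin disj])
  ultimately show ?thesis using sc[of a] sc[of b] assms(1) unfolding un by linarith
qed

text \<open>
  The sum of \<open>R\<close> over the roots of \<open>F\<close> is the coefficient of degree \<open>size A - 1\<close> of the remainder of
  \<open>R F'\<close> modulo \<open>F\<close>: the derivative \<open>F'\<close> is the sum of the products of all linear factors but one,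
  and modulo \<open>F\<close> the factor \<open>R\<close> acts on such a product as its value at the root that is left out.
  Thus the sum over the roots depends only on a division with remainder.
\<close>

lemma trace_residue:
  fixes R :: "complex poly"
  shows "\<exists>Q S. R * pderiv (\<Prod>x\<in>#A. [:-x, 1:]) = Q * (\<Prod>x\<in>#A. [:-x, 1:]) + S
     \<and> (\<forall>i\<ge>size A. coeff S i = 0) \<and> coeff S (size A - 1) = (\<Sum>x\<in>#A. poly R x)"
proof (induction A)
  case empty
  show ?case by (intro exI[of _ 0]) simp
next
  case (add a A)
  let ?F = "\<Prod>x\<in>#A. [:-x, 1:] :: complex poly"
  from add obtain Q S where
    1: "R * pderiv ?F = Q * ?F + S" and 2: "\<And>i. i \<ge> size A \<Longrightarrow> coeff S i = 0"
    and 3: "coeff S (size A - 1) = (\<Sum>x\<in>#A. poly R x)" by blast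
  have degF: "degree ?F = size A" "lead_coeff ?F = 1"
  proof -
    show "degree ?F = size A"
      by (induction A) (simp_all add: degree_mult_eq prod_mset_zero_iff image_iff del: mult_pCons_left)
    show "lead_coeff ?F = 1" by (induction A) (simp_all add: lead_coeff_mult del: mult_pCons_left)
  qed
  obtain T where T: "R = [:poly R a:] + [:-a, 1:] * T"
    using synthetic_div_correct'[of a R] by (metis add.commute)
  let ?S = "smult (poly R a) ?F + [:-a, 1:] * S"
  have "R * pderiv ([:-a, 1:] * ?F) = R * ?F + [:-a, 1:] * (R * pderiv ?F)"
    by (simp add: pderiv_mult pderiv_pCons algebra_simps del: mult_pCons_left mult_pCons_right)
       
  also have "\<dots> = (Q + T) * ([:-a, 1:] * ?F) + ?S"
  proof -
    have "R * ?F = [:poly R a:] * ?F + T * ([:-a, 1:] * ?F)"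
      by (subst T) (simp only: ring_distribs ac_simps)
    also have "[:poly R a:] * ?F = smult (poly R a) ?F" by simp
    finally show ?thesis unfolding 1 by (simp only: ring_distribs ac_simps)
  qed
  finally have e: "R * pderiv ([:-a, 1:] * ?F) = (Q + T) * ([:-a, 1:] * ?F) + ?S" .
  have z: "coeff ?S i = 0" if "i \<ge> Suc (size A)" for i
  proof -
    have "coeff ?F i = 0" using degF that by (simp add: coeff_eq_0)
    thus ?thesis using that 2 by (cases i) auto
  qed
  have c: "coeff ?S (size A) = poly R a + (\<Sum>x\<in>#A. poly R x)"
  proof -
    have "coeff ?F (size A) = 1" using degF by simp
    thus ?thesis using 2[of "size A"] 3 2[of 0] by (cases "size A") auto
  qed
  show ?case
    using e z c by (intro exI[of _ "Q + T"] exI[of _ ?S]) simp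
qed

text \<open>
  All \<open>P - w\<close> have the same derivative, and passing from \<open>P\<close> to \<open>P - w\<close> changes the remainder of \<open>R P'\<close>
  by \<open>w\<close> times the quotient, whose degree is too small to affect the coefficient in \<open>trace_residue\<close>.
\<close>

lemma fibre_sum_constant:
  fixes P R :: "complex poly"
  assumes "lead_coeff P = 1" "degree R < degree P"
  shows "\<exists>\<kappa>. \<forall>w. (\<Sum>x\<in>#proots (P - [:w:]). poly R x) = \<kappa>"
proof -
  let ?n = "degree P"
  have n: "?n \<ge> 1" using assms by simp
  have dec: "(\<Prod>x\<in>#proots (P - [:w:]). [:-x, 1:]) = P - [:w:]" for w
    using complex_poly_decompose_multiset[of "P - [:w:]"] fibre_degree[OF n, of w] assms(1) by simp
  have sz: "size (proots (P - [:w:])) = ?n" for w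
    using fibre_degree[OF n, of w] by (simp add: size_proots_complex)
  have "\<exists>Q S. R * pderiv P = Q * (P - [:w:]) + S \<and> (\<forall>i\<ge>?n. coeff S i = 0)
      \<and> coeff S (?n - 1) = (\<Sum>x\<in>#proots (P - [:w:]). poly R x)" for w
    using trace_residue[of R "proots (P - [:w:])"] unfolding dec sz
    by (simp add: pderiv_diff pderiv_pCons)
  then obtain Q S where QS: "\<And>w. R * pderiv P = Q w * (P - [:w:]) + S w"
    "\<And>w i. i \<ge> ?n \<Longrightarrow> coeff (S w) i = 0"
    "\<And>w. coeff (S w) (?n - 1) = (\<Sum>x\<in>#proots (P - [:w:]). poly R x)" by metis
  have dS: "degree (S w) < ?n" for w
    using QS(2)[of _ w] n by (metis (no_types) leading_coeff_0_iff degree_0 not_le less_le_trans zero_less_one)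
  have dQ: "degree (Q w) < ?n - 1 \<or> Q w = 0" for w
  proof (cases "Q w = 0")
    case False
    have "Q w * (P - [:w:]) = R * pderiv P - S w" using QS(1)[of w] by simp
    moreover have "degree (R * pderiv P - S w) \<le> max (degree (R * pderiv P)) (degree (S w))"
      by (rule degree_diff_le_max)
    moreover have "degree (R * pderiv P) \<le> degree R + (?n - 1)"
      using degree_mult_le[of R "pderiv P"] by (simp add: degree_pderiv)
    moreover have "degree (Q w * (P - [:w:])) = degree (Q w) + ?n"
      using False fibre_degree[OF n, of w] by (simp add: degree_mult_eq)
    ultimately have "degree (Q w) + ?n \<le> max (degree R + (?n - 1)) (degree (S w))"
      by (metis (no_types, lifting) max.mono order.trans order.refl)
    thus ?thesis using dS[of w] assms(2) n by linarith
  qed simp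
  have "coeff (S w) (?n - 1) = coeff (S 0) (?n - 1)" for w
  proof -
    have eq: "(Q 0 - Q w) * (P - [:w:]) = S w - S 0 - smult w (Q 0)"
      using QS(1)[of w] QS(1)[of 0] by (simp add: algebra_simps)
    have "degree (S w - S 0 - smult w (Q 0)) < ?n"
      using dS[of w] dS[of 0] dQ[of 0] n by (intro degree_diff_less) auto
    hence "Q 0 - Q w = 0"
      unfolding eq[symmetric] using fibre_degree[OF n, of w]
      by (metis degree_mult_eq le_add2 not_le)
    hence "S w = S 0 + smult w (Q 0)" using eq by (simp add: diff_eq_eq add.commute)
    moreover have "coeff (Q 0) (?n - 1) = 0" using dQ[of 0] by (auto simp: coeff_eq_0)
    ultimately show ?thesis by simp
  qed
  thus ?thesis using QS(3) by metis
qed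

text \<open>
  Strict convexity of discs: the mean square distance of the values from \<open>m\<close> is at most
  \<open>r\<^sup>2 - |m - t|\<^sup>2\<close>.
\<close>

lemma mean_norm_extremal:
  fixes f :: "'a \<Rightarrow> complex"
  assumes "\<And>x. x \<in># A \<Longrightarrow> norm (f x - t) \<le> r"
    and "(\<Sum>x\<in>#A. f x) = of_nat (size A) * m" and "norm (m - t) \<ge> r" and "x \<in># A"
  shows "f x = m"
proof -
  have A0: "size A > 0" using assms(4) by (cases A) auto
  have r0: "r \<ge> 0" using assms(1)[OF assms(4)] norm_ge_zero order_trans by blast
  have pt: "(norm (f y - m))\<^sup>2 \<le> r\<^sup>2 - 2 * Re ((f y - t) * cnj (m - t)) + (norm (m - t))\<^sup>2" if "y \<in># A" for y
  proof -
    have "(norm (f y - m))\<^sup>2 = (norm (f y - t))\<^sup>2 - 2 * Re ((f y - t) * cnj (m - t)) + (norm (m - t))\<^sup>2"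
      unfolding cmod_power2 by (simp add: power2_eq_square algebra_simps)
    moreover have "(norm (f y - t))\<^sup>2 \<le> r\<^sup>2" using assms(1)[OF that] by (intro power_mono) auto
    ultimately show ?thesis by linarith
  qed
  have s1: "(\<Sum>y\<in>#A. (f y - t) * cnj (m - t)) = of_nat (size A) * ((m - t) * cnj (m - t))"
  proof -
    have "(\<Sum>y\<in>#A. (f y - t) * cnj (m - t)) = (\<Sum>y\<in>#A. f y - t) * cnj (m - t)"
      by (simp add: sum_mset_distrib_right)
    also have "(\<Sum>y\<in>#A. f y - t) = of_nat (size A) * (m - t)"
    proof -
      have "(\<Sum>y\<in>#B. f y - t) = (\<Sum>y\<in>#B. f y) - of_nat (size B) * t" for B
        by (induction B) (simp_all add: algebra_simps)
      thus ?thesis using assms(2) by (simp add: algebra_simps)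
    qed
    finally show ?thesis by simp
  qed
  have reS: "Re (\<Sum>y\<in>#A. g y) = (\<Sum>y\<in>#A. Re (g y))" for g :: "'a \<Rightarrow> complex"
    by (induction A) auto
  have s2: "(\<Sum>y\<in>#A. Re ((f y - t) * cnj (m - t))) = of_nat (size A) * (norm (m - t))\<^sup>2"
    unfolding reS[symmetric] s1 complex_norm_square[symmetric] by (simp del: of_real_power)
  have "(\<Sum>y\<in>#A. (norm (f y - m))\<^sup>2) \<le> (\<Sum>y\<in>#A. r\<^sup>2 - 2 * Re ((f y - t) * cnj (m - t)) + (norm (m - t))\<^sup>2)"
    by (intro sum_mset_mono pt)
  also have "\<dots> = real (size A) * r\<^sup>2 - 2 * (\<Sum>y\<in>#A. Re ((f y - t) * cnj (m - t))) + real (size A) * (norm (m - t))\<^sup>2"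
  proof -
    have "(\<Sum>y\<in>#B. u - 2 * g y + v) = real (size B) * u - 2 * (\<Sum>y\<in>#B. g y) + real (size B) * v"
      for B :: "'a multiset" and g :: "'a \<Rightarrow> real" and u v
      by (induction B) (simp_all add: algebra_simps)
    thus ?thesis .
  qed
  also have "\<dots> = real (size A) * (r\<^sup>2 - (norm (m - t))\<^sup>2)" unfolding s2 by (simp add: algebra_simps)
  also have "\<dots> \<le> 0" using assms(3) r0 by (simp add: mult_nonneg_nonpos power_mono)
  finally have le: "(\<Sum>y\<in>#A. (norm (f y - m))\<^sup>2) \<le> 0" .
  from assms(4) obtain B where B: "A = add_mset x B" by (metis mset_add)
  have "(\<Sum>y\<in>#B. (norm (f y - m))\<^sup>2) \<ge> 0" by (induction B) auto
  moreover have "(norm (f x - m))\<^sup>2 + (\<Sum>y\<in>#B. (norm (f y - m))\<^sup>2) \<le> 0" using le unfolding B by simp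
  ultimately have "(norm (f x - m))\<^sup>2 \<le> 0" by linarith
  thus ?thesis by simp
qed

section \<open>Polynomials with a common preimage\<close>

text \<open>
  For compact \<open>E\<close> this is the radius of the smallest disc about \<open>t\<close> that contains \<open>E\<close>.
\<close>

definition far :: "complex set \<Rightarrow> complex \<Rightarrow> real" where
  "far E t = Sup ((\<lambda>x. norm (x - t)) ` E)"

lemma far_ge:
  assumes "bounded E" "x \<in> E"
  shows "norm (x - t) \<le> far E t"
proof -
  obtain B where B: "\<forall>x\<in>E. norm x \<le> B" using assms(1) bounded_iff by blast
  have "bdd_above ((\<lambda>x. norm (x - t)) ` E)"
  proof (rule bdd_aboveI2)
    show "norm (x - t) \<le> B + norm t" if "x \<in> E" for x
      using norm_triangle_ineq4[of x t] B that by force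
  qed
  thus ?thesis unfolding far_def using assms(2) by (intro cSup_upper) auto
qed

lemma far_attained:
  assumes "compact E" "E \<noteq> {}"
  shows "\<exists>x\<in>E. norm (x - t) = far E t"
proof -
  have "continuous_on E (\<lambda>x. norm (x - t))" by (intro continuous_intros)
  from continuous_attains_sup[OF assms this] obtain x where
    x: "x \<in> E" "\<forall>y\<in>E. norm (y - t) \<le> norm (x - t)" by blast
  have "far E t \<le> norm (x - t)" unfolding far_def using x by (intro cSup_least) auto
  thus ?thesis using x far_ge[OF compact_imp_bounded[OF assms(1)] x(1), of t] by force
qed

text \<open>
  On the fibre over \<open>w\<close>, \<open>P1\<close> is \<open>w\<close> plus the values of \<open>P1 - P2\<close>, which has smaller degree.
\<close>

lemma fibre_sum_shift:
  fixes P1 P2 :: "complex poly"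
  assumes "lead_coeff P1 = 1" "lead_coeff P2 = 1" "degree P1 = degree P2" "degree P2 \<ge> 1"
  shows "\<exists>\<kappa>. \<forall>w. (\<Sum>x\<in>#proots (P2 - [:w:]). poly P1 x) = of_nat (degree P2) * (w + \<kappa>)"
proof -
  have "degree (P1 - P2) < degree P2"
  proof (cases "P1 = P2")
    case False
    thus ?thesis using assms by (intro degree_less_if_less_eqI) (auto intro: degree_diff_le)
  qed (use assms in simp)
  from fibre_sum_constant[OF assms(2) this] obtain K where
    K: "\<And>w. (\<Sum>x\<in>#proots (P2 - [:w:]). poly (P1 - P2) x) = K" by blast
  have "(\<Sum>x\<in>#proots (P2 - [:w:]). poly P1 x) = of_nat (degree P2) * (w + K / of_nat (degree P2))" for w
  proof -
    have "(\<Sum>x\<in>#proots (P2 - [:w:]). poly P1 x) = (\<Sum>x\<in>#proots (P2 - [:w:]). w + poly (P1 - P2) x)"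
      using fibre_degree[OF assms(4), of w] by (intro arg_cong[of _ _ sum_mset] image_mset_cong) auto
    also have "\<dots> = of_nat (size (proots (P2 - [:w:]))) * w + K"
      unfolding sum_mset.distrib K by simp
    also have "size (proots (P2 - [:w:])) = degree P2"
      using fibre_degree[OF assms(4), of w] by (simp add: size_proots_complex)
    finally show ?thesis using assms(4) by (simp add: field_simps)
  qed
  thus ?thesis by blast
qed

lemma norm_sum_mset_le:
  assumes "\<And>x. x \<in># A \<Longrightarrow> norm (f x :: complex) \<le> r"
  shows "norm (\<Sum>x\<in>#A. f x) \<le> of_nat (size A) * r"
  using assms
proof (induction A)
  case (add x A)
  have "norm (f x + (\<Sum>x\<in>#A. f x)) \<le> norm (f x) + norm (\<Sum>x\<in>#A. f x)" by (rule norm_triangle_ineq)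
  also have "\<dots> \<le> r + of_nat (size A) * r" by (intro add_mono add) auto
  finally show ?case by (simp add: algebra_simps)
qed simp

lemma far_shift_le:
  fixes P1 P2 :: "complex poly"
  assumes "degree P2 \<ge> 1"
    and "\<And>w. (\<Sum>x\<in>#proots (P2 - [:w:]). poly P1 x) = of_nat (degree P2) * (w + \<kappa>)"
    and "compact E1" "compact E2" "E2 \<noteq> {}" "poly P2 -` E2 \<subseteq> poly P1 -` E1"
  shows "far E2 (t - \<kappa>) \<le> far E1 t"
proof -
  obtain w where w: "w \<in> E2" "norm (w - (t - \<kappa>)) = far E2 (t - \<kappa>)"
    using far_attained[OF assms(4,5)] by blast
  let ?A = "proots (P2 - [:w:])"
  have sz: "size ?A = degree P2"
    using fibre_degree[OF assms(1), of w] by (simp add: size_proots_complex)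
  have "norm (\<Sum>x\<in>#?A. poly P1 x - t) \<le> of_nat (size ?A) * far E1 t"
  proof (rule norm_sum_mset_le)
    fix x assume "x \<in># ?A"
    hence "poly P2 x = w" using fibre_degree[OF assms(1), of w] by simp
    hence "poly P1 x \<in> E1" using assms(6) w(1) by auto
    thus "norm (poly P1 x - t) \<le> far E1 t" by (intro far_ge compact_imp_bounded assms)
  qed
  also have "(\<Sum>x\<in>#?A. poly P1 x - t) = of_nat (degree P2) * (w - (t - \<kappa>))"
  proof -
    have "(\<Sum>y\<in>#B. poly P1 y - t) = (\<Sum>y\<in>#B. poly P1 y) - of_nat (size B) * t" for B
      by (induction B) (simp_all add: algebra_simps)
    from this[of "proots (P2 - [:w:])"] show ?thesis
      unfolding assms(2) sz by (simp add: algebra_simps)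
  qed
  finally show ?thesis using w(2) assms(1) sz by (simp add: norm_mult)
qed

text \<open>
  By \<open>fibre_sum_shift\<close>, every \<open>w + \<kappa>\<close> with \<open>w \<in> E2\<close> is a mean of points of \<open>E1\<close>, and every \<open>w + \<kappa>'\<close> with
  \<open>w \<in> E1\<close> a mean of points of \<open>E2\<close>. Both shifts together map \<open>E2\<close> into its own convex hull, so they cancel, and
  \<open>E1\<close> has the same farthest distances as \<open>E2 + \<kappa>\<close>. Over a farthest point of \<open>E2\<close> all values of \<open>P1\<close> then coincide
  with their mean. Two such points suffice, since their fibres have more than \<open>degree P2\<close> points.
\<close>

theorem preimage_rigidity:
  fixes P1 P2 :: "complex poly"
  assumes "lead_coeff P1 = 1" "lead_coeff P2 = 1" "degree P1 = degree P2" "degree P2 \<ge> 1"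
    and "compact E1" "compact E2" "a \<in> E2" "b \<in> E2" "a \<noteq> b"
    and eq: "poly P1 -` E1 = poly P2 -` E2"
  shows "\<exists>e. P2 = P1 + [:e:]"
proof -
  let ?n = "degree P2"
  have dP1: "degree P1 \<ge> 1" using assms(3,4) by simp
  obtain \<kappa> where \<kappa>: "\<And>w. (\<Sum>x\<in>#proots (P2 - [:w:]). poly P1 x) = of_nat (degree P2) * (w + \<kappa>)"
    using fibre_sum_shift[OF assms(1-4)] by blast
  obtain \<kappa>' where \<kappa>': "\<And>w. (\<Sum>x\<in>#proots (P1 - [:w:]). poly P2 x) = of_nat (degree P1) * (w + \<kappa>')"
    using fibre_sum_shift[OF assms(2,1) assms(3)[symmetric] dP1] by blast
  have ne2: "E2 \<noteq> {}" using assms by auto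
  have ne1: "E1 \<noteq> {}"
  proof -
    obtain x where "poly P2 x = a" using poly_surj[OF assms(4), of a] by blast
    hence "x \<in> poly P1 -` E1" using assms(7) unfolding eq by simp
    thus ?thesis by auto
  qed
  have l2: "far E2 (t - \<kappa>) \<le> far E1 t" for t
    by (rule far_shift_le[OF assms(4) \<kappa> assms(5,6) ne2]) (simp add: eq)
  have l1: "far E1 (t - \<kappa>') \<le> far E2 t" for t
    by (rule far_shift_le[OF dP1 \<kappa>' assms(6,5) ne1]) (simp add: eq)
  define s where "s = \<kappa> + \<kappa>'"
  have it: "far E2 (- (of_nat m * s)) \<le> far E2 0" for m
  proof (induction m)
    case (Suc m)
    have "far E2 (- (of_nat m * s) - \<kappa>' - \<kappa>) \<le> far E2 (- (of_nat m * s))"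
      using l2[of "- (of_nat m * s) - \<kappa>'"] l1[of "- (of_nat m * s)"] by linarith
    moreover have "- (of_nat m * s) - \<kappa>' - \<kappa> = - (of_nat (Suc m) * s)"
      by (simp add: s_def algebra_simps)
    ultimately show ?case using Suc by simp
  qed simp
  \<comment> \<open>the farthest distance of \<open>E2\<close> from a point that tends to infinity is unbounded\<close>
  have "s = 0"
  proof (rule ccontr)
    assume "s \<noteq> 0"
    then obtain m :: nat where m: "of_nat m * norm s > far E2 0 + norm a"
      using reals_Archimedean3[of "norm s"] by auto
    have "norm (of_nat m * s) \<le> norm (a - - (of_nat m * s)) + norm a"
      using norm_triangle_ineq4[of "a + of_nat m * s" a] by simp
    also have "norm (a - - (of_nat m * s)) \<le> far E2 (- (of_nat m * s))"
      by (intro far_ge compact_imp_bounded assms)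
    also note it
    finally show False using m by (simp add: norm_mult)
  qed
  hence l1': "far E1 t \<le> far E2 (t - \<kappa>)" for t
    using l1[of "t - \<kappa>"] by (simp add: s_def algebra_simps eq_neg_iff_add_eq_0)
  have agree: "poly P1 x = poly P2 x + \<kappa>" if "w \<in> E2" "norm (w - t) = far E2 t" "poly P2 x = w" for x w t
  proof -
    have "poly P1 x = w + \<kappa>"
    proof (rule mean_norm_extremal[where f = "poly P1" and m = "w + \<kappa>" and A = "proots (P2 - [:w:])" and t = "t + \<kappa>" and r = "far E1 (t + \<kappa>)"])
      have sz: "size (proots (P2 - [:w:])) = ?n"
        using fibre_degree[OF assms(4), of w] by (simp add: size_proots_complex)
      show "(\<Sum>x\<in>#proots (P2 - [:w:]). poly P1 x) = of_nat (size (proots (P2 - [:w:]))) * (w + \<kappa>)"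
        using \<kappa>[of w] sz by simp
      show "x \<in># proots (P2 - [:w:])" using that fibre_degree[OF assms(4), of w] by simp
      show "far E1 (t + \<kappa>) \<le> norm (w + \<kappa> - (t + \<kappa>))" using l1'[of "t + \<kappa>"] that by simp
      fix y assume "y \<in># proots (P2 - [:w:])"
      hence "poly P2 y = w" using fibre_degree[OF assms(4), of w] by simp
      hence "poly P1 y \<in> E1" using eq that by auto
      thus "norm (poly P1 y - (t + \<kappa>)) \<le> far E1 (t + \<kappa>)" by (intro far_ge compact_imp_bounded assms)
    qed
    thus ?thesis using that by simp
  qed
  \<comment> \<open>a point farthest from \<open>a\<close>, and one farthest from that point; they differ because \<open>E2\<close> has two points\<close>
  obtain w1 where w1: "w1 \<in> E2" "norm (w1 - a) = far E2 a" using far_attained[OF assms(6) ne2] by blast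
  obtain w2 where w2: "w2 \<in> E2" "norm (w2 - w1) = far E2 w1" using far_attained[OF assms(6) ne2] by blast
  have "w1 \<noteq> w2"
  proof
    assume "w1 = w2"
    hence "far E2 w1 = 0" using w2 by simp
    hence "norm (a - w1) \<le> 0" "norm (b - w1) \<le> 0"
      using far_ge[OF compact_imp_bounded[OF assms(6)] assms(7), of w1]
        far_ge[OF compact_imp_bounded[OF assms(6)] assms(8), of w1] by linarith+
    thus False using assms(9) by simp
  qed
  have "P1 = P2 + [:\<kappa>:]"
  proof (rule poly_eqI_degree[where A = "poly P2 -` {w1, w2}"])
    show "poly P1 x = poly (P2 + [:\<kappa>:]) x" if "x \<in> poly P2 -` {w1, w2}" for x
      using that agree[OF w1] agree[OF w2] by auto
    show "degree P1 < card (poly P2 -` {w1, w2})"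
      using card_fibre_two_points[OF assms(4) \<open>w1 \<noteq> w2\<close>] assms(3) by simp
    have "degree (P2 + [:\<kappa>:]) = degree P2" using assms(4) by (intro degree_add_eq_left) auto
    thus "degree (P2 + [:\<kappa>:]) < card (poly P2 -` {w1, w2})"
      using card_fibre_two_points[OF assms(4) \<open>w1 \<noteq> w2\<close>] by simp
  qed
  hence "P2 = P1 + [:-\<kappa>:]" by simp
  thus ?thesis by blast
qed


text \<open>
  The monic case applies to \<open>P1\<close> and to \<open>w \<mapsto> P2 (c w + k)\<close>, divided by their leading coefficients.
\<close>

theorem affine_preimage_rigidity:
  fixes P1 P2 :: "complex poly"
  assumes "degree P1 = n" "degree P2 = n" "n \<ge> 1" "compact E1" "compact E2" "a \<in> E1" "b \<in> E1" "a \<noteq> b"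
    and "c \<noteq> 0" and im: "(\<lambda>w. c * w + k) ` (poly P1 -` E1) = poly P2 -` E2"
  obtains u e where "u = c ^ n * lead_coeff P2 / lead_coeff P1"
    "pcompose P2 [:k, c:] = smult u P1 + [:e:]" "E2 = (\<lambda>x. u * x + e) ` E1"
proof -
  define l1 where "l1 = lead_coeff P1"
  define l2 where "l2 = lead_coeff P2 * c ^ n"
  have P0: "P1 \<noteq> 0" "P2 \<noteq> 0" using assms(1-3) by auto
  have l0: "l1 \<noteq> 0" "l2 \<noteq> 0" using P0 assms(9) by (auto simp: l1_def l2_def)
  define A1 where "A1 = smult (1 / l1) P1"
  define A2 where "A2 = smult (1 / l2) (pcompose P2 [:k, c:])"
  let ?F1 = "(\<lambda>x. (1 / l1) * x) ` E1" and ?F2 = "(\<lambda>x. (1 / l2) * x) ` E2"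
  have lin: "degree [:k, c:] = 1" "lead_coeff [:k, c:] = c" using assms(9) by simp_all
  have dc: "degree (pcompose P2 [:k, c:]) = n"
    using assms(2) lin by (simp add: degree_pcompose)
  have dc': "lead_coeff (pcompose P2 [:k, c:]) = l2"
  proof -
    have "lead_coeff (pcompose P2 [:k, c:]) = lead_coeff P2 * lead_coeff [:k, c:] ^ degree P2"
      by (rule lead_coeff_comp) (use lin in simp)
    thus ?thesis unfolding lin(2) assms(2) l2_def .
  qed
  have "\<exists>e. A1 = A2 + [:e:]"
  proof (rule preimage_rigidity[of A2 A1 ?F2 ?F1 "(1 / l1) * a" "(1 / l1) * b"])
    show "lead_coeff A2 = 1" "lead_coeff A1 = 1"
      using l0 unfolding A1_def A2_def lead_coeff_smult dc' by (simp_all add: l1_def)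
    show "degree A2 = degree A1" "1 \<le> degree A1"
      using l0 dc assms(1,3) by (simp_all add: A1_def A2_def)
    show "compact ?F2" "compact ?F1" by (intro compact_continuous_image continuous_intros assms)+
    show "(1 / l1) * a \<in> ?F1" "(1 / l1) * b \<in> ?F1" using assms(6,7) by blast+
    show "(1 / l1) * a \<noteq> (1 / l1) * b" using assms(8) l0 by simp
    have "poly A2 -` ?F2 = {w. poly P2 (c * w + k) \<in> E2}"
      using l0 by (auto simp: A2_def poly_pcompose image_iff algebra_simps)
    also have "\<dots> = poly P1 -` E1"
    proof -
      have "poly P2 (c * w + k) \<in> E2 \<longleftrightarrow> poly P1 w \<in> E1" for w
      proof -
        have "poly P2 (c * w + k) \<in> E2 \<longleftrightarrow> c * w + k \<in> (\<lambda>w. c * w + k) ` (poly P1 -` E1)"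
          unfolding im by simp
        also have "\<dots> \<longleftrightarrow> poly P1 w \<in> E1" using assms(9) by auto
        finally show ?thesis .
      qed
      thus ?thesis by auto
    qed
    also have "\<dots> = poly A1 -` ?F1" using l0 by (auto simp: A1_def image_iff)
    finally show "poly A2 -` ?F2 = poly A1 -` ?F1" .
  qed
  then obtain e where e: "A1 = A2 + [:e:]" by blast
  have "smult l2 A2 = smult l2 A1 - [:l2 * e:]" unfolding e by (simp add: smult_add_right)
  hence pc: "pcompose P2 [:k, c:] = smult (l2 / l1) P1 + [:- (l2 * e):]"
    using l0 by (simp add: A1_def A2_def)
  have "E2 = poly P2 ` (poly P2 -` E2)" by (rule poly_image_vimage[symmetric]) (use assms in simp)
  also have "\<dots> = poly (pcompose P2 [:k, c:]) ` (poly P1 -` E1)"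
    unfolding im[symmetric] image_image poly_pcompose by (simp add: algebra_simps)
  also have "\<dots> = (\<lambda>x. (l2 / l1) * x + - (l2 * e)) ` (poly P1 ` (poly P1 -` E1))"
    unfolding pc image_image by simp
  also have "poly P1 ` (poly P1 -` E1) = E1" by (rule poly_image_vimage) (use assms in simp)
  finally show ?thesis using pc by (intro that[of "l2 / l1" "- (l2 * e)"]) (simp_all add: l2_def l1_def)
qed

lemma coeff_pcompose_linear_subleading:
  fixes P :: "complex poly"
  assumes "degree P = n" "n \<ge> 1"
  shows "coeff (pcompose P [:k, c:]) (n - 1) = c ^ (n - 1) * (coeff P (n - 1) + of_nat n * k * lead_coeff P)"
proof -
  have "pcompose P [:k, c:] = (\<Sum>i\<le>n. smult (coeff P i) ([:k, c:] ^ i))"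
  proof -
    have pow: "pcompose (A ^ i) B = pcompose A B ^ i" for A B :: "complex poly" and i
      by (induction i) (simp_all add: pcompose_1 pcompose_mult)
    have "pcompose P [:k, c:] = pcompose (\<Sum>i\<le>n. monom (coeff P i) i) [:k, c:]"
      using poly_as_sum_of_monoms'[of P n] assms(1) by simp
    thus ?thesis unfolding pcompose_sum
      by (simp add: pcompose_smult pow monom_altdef pcompose_pCons)
  qed
  hence "coeff (pcompose P [:k, c:]) (n - 1) = (\<Sum>i\<le>n. coeff P i * coeff ([:k, c:] ^ i) (n - 1))"
    by (simp add: coeff_sum)
  also have "\<dots> = (\<Sum>i\<in>{n - 1, n}. coeff P i * coeff ([:k, c:] ^ i) (n - 1))"
  proof (intro sum.mono_neutral_right ballI)
    fix i assume "i \<in> {..n} - {n - 1, n}"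
    hence "i < n - 1" by auto
    moreover have "degree ([:k, c:] ^ i) \<le> i"
      using degree_power_le[of "[:k, c:]" i] by (metis degree_pCons_eq_if degree_0 mult.commute mult.right_neutral mult_le_mono1 One_nat_def dual_order.trans degree_pCons_le)
    ultimately show "coeff P i * coeff ([:k, c:] ^ i) (n - 1) = 0" by (simp add: coeff_eq_0)
  qed auto
  also have "\<dots> = coeff P (n - 1) * c ^ (n - 1) + lead_coeff P * (of_nat n * c ^ (n - 1) * k)"
  proof -
    have "coeff ([:k, c:] ^ (n - 1)) (n - 1) = c ^ (n - 1)" by (simp add: coeff_linear_poly_power)
    moreover have "coeff ([:k, c:] ^ n) (n - 1) = of_nat n * c ^ (n - 1) * k"
      using assms(2) coeff_linear_poly_power[of "n - 1" n k c] by (cases n) (simp_all del: power_Suc)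
    ultimately show ?thesis using assms by simp
  qed
  finally show ?thesis by (simp add: algebra_simps)
qed

text \<open>
  The coefficient of degree \<open>n - 1\<close> of \<open>P2 (c w + k)\<close> is a nonzero multiple of \<open>k\<close>. For \<open>n \<ge> 2\<close>, the additive
  constant does not contribute to it.
\<close>

corollary centred_preimage_rigidity:
  fixes P1 P2 :: "complex poly"
  assumes "degree P1 = n" "degree P2 = n" "n \<ge> 2" "coeff P1 (n - 1) = 0" "coeff P2 (n - 1) = 0"
    and "compact E1" "compact E2" "infinite E1" and "c \<noteq> 0"
    and im: "(\<lambda>w. c * w + k) ` (poly P1 -` E1) = poly P2 -` E2"
  obtains u e where "u = c ^ n * lead_coeff P2 / lead_coeff P1" "k = 0"
    "\<And>w. poly P2 (c * w) = u * poly P1 w + e" "E2 = (\<lambda>x. u * x + e) ` E1"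
proof -
  obtain a b where ab: "a \<in> E1" "b \<in> E1" "a \<noteq> b"
    using assms(8) by (metis finite.emptyI finite_insert finite_subset insertCI subsetI)
  have n1: "n \<ge> 1" using assms(3) by simp
  obtain u e where ue: "u = c ^ n * lead_coeff P2 / lead_coeff P1"
    "pcompose P2 [:k, c:] = smult u P1 + [:e:]" "E2 = (\<lambda>x. u * x + e) ` E1"
    using affine_preimage_rigidity[OF assms(1,2) n1 assms(6,7) ab assms(9) im] by metis
  have "coeff (smult u P1 + [:e:]) (n - 1) = 0"
    using assms(3,4) by (cases n) (auto simp: coeff_pCons split: nat.splits)
  hence "c ^ (n - 1) * (of_nat n * k * lead_coeff P2) = 0"
    using coeff_pcompose_linear_subleading[OF assms(2) n1, of k c] ue(2) assms(5) by simp
  moreover have "lead_coeff P2 \<noteq> 0" using assms(2,3) by auto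
  ultimately have k0: "k = 0" using assms(3,9) by simp
  have "poly P2 (c * w) = u * poly P1 w + e" for w
    using arg_cong[OF ue(2), of "\<lambda>P. poly P w"] by (simp add: poly_pcompose k0 mult.commute)
  with k0 ue show ?thesis using that by blast
qed

text \<open>
  Beardon's description of the symmetries of a Julia set. Rigidity for \<open>p\<close> and itself gives
  \<open>p (c z) = c\<^sup>n p z + e\<close>, and \<open>x \<mapsto> c\<^sup>n x + e\<close> is a symmetry of \<open>Y\<close> again. So its translation part \<open>e\<close> vanishes
  for the same reason as \<open>k\<close>.
\<close>

lemma centred_symmetry:
  fixes p :: "complex poly"
  assumes "degree p = n" "n \<ge> 2" "coeff p (n - 1) = 0" "compact Y" "infinite Y" "poly p -` Y = Y"
    and "c \<noteq> 0" "(\<lambda>z. c * z + k) ` Y = Y"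
  shows "k = 0" "poly p (c * z) = c ^ n * poly p z"
proof -
  obtain u e where 1: "u = c ^ n * lead_coeff p / lead_coeff p" "k = 0"
    "\<And>w. poly p (c * w) = u * poly p w + e" "Y = (\<lambda>x. u * x + e) ` Y"
    using centred_preimage_rigidity[OF assms(1,1,2,3,3,4,4,5,7)] assms(6,8) by metis
  have "lead_coeff p \<noteq> 0" using assms(1,2) by auto
  hence u: "u = c ^ n" using 1(1) by simp
  hence u0: "u \<noteq> 0" using assms(7) by simp
  obtain u' e' where 2: "e = 0"
    using centred_preimage_rigidity[OF assms(1,1,2,3,3,4,4,5) u0, of e] assms(6) 1(4) by metis
  show "k = 0" by fact
  show "poly p (c * z) = c ^ n * poly p z" using 1(3) 2 u by simp
qed

section \<open>Recognising monomials\<close>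

lemma monom_if_no_nonzero_root:
  fixes h :: "complex poly"
  assumes "h \<noteq> 0" "\<And>x. poly h x = 0 \<Longrightarrow> x = 0"
  shows "h = monom (lead_coeff h) (degree h)"
proof -
  have "set_mset (proots h) \<subseteq> {0}" using assms by auto
  hence "proots h = replicate_mset (size (proots h)) 0"
    by (metis set_mset_subset_singletonD size_replicate_mset)
  hence "proots h = replicate_mset (degree h) 0" by (simp add: size_proots_complex)
  hence "h = smult (lead_coeff h) ([:0, 1:] ^ degree h)"
    using complex_poly_decompose_multiset[of h] by simp
  thus ?thesis by (simp add: monom_altdef)
qed

text \<open>
  A nonzero root would have infinitely many images, all of them roots.
\<close>

lemma monom_if_roots_invariant:
  fixes h :: "complex poly"
  assumes "infinite M" "\<And>\<mu> z. \<mu> \<in> M \<Longrightarrow> z \<noteq> 0 \<Longrightarrow> poly h z = 0 \<Longrightarrow> poly h (\<mu> * z) = 0"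
  shows "h = monom (lead_coeff h) (degree h)"
proof (cases "h = 0")
  case False
  show ?thesis
  proof (rule monom_if_no_nonzero_root[OF False], rule ccontr)
    fix x assume x: "poly h x = 0" "x \<noteq> 0"
    have "(\<lambda>\<mu>. \<mu> * x) ` M \<subseteq> {y. poly h y = 0}" using assms(2) x by blast
    moreover have "infinite ((\<lambda>\<mu>. \<mu> * x) ` M)"
      using assms(1) x by (subst finite_image_iff) (auto intro: inj_onI)
    ultimately show False using poly_roots_finite[OF False] finite_subset by blast
  qed
qed simp

lemma poly_eq_on_infinite:
  fixes P R :: "complex poly"
  assumes "infinite A" "\<And>x. x \<in> A \<Longrightarrow> poly P x = poly R x"
  shows "P = R"
proof (rule ccontr)
  assume "P \<noteq> R"
  hence "finite {x. poly (P - R) x = 0}" by (intro poly_roots_finite) simp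
  moreover have "A \<subseteq> {x. poly (P - R) x = 0}" using assms(2) by auto
  ultimately show False using assms(1) finite_subset by blast
qed

text \<open>
  On the unit circle, the conjugate of \<open>h(z)\<close> is \<open>z\<^bsup>-n\<^esup> r(z)\<close>, where \<open>r\<close> is the reversed polynomial with
  conjugate coefficients. Thus \<open>|h|\<^sup>2 = \<rho>\<^sup>2\<close> becomes the polynomial identity \<open>h r = \<rho>\<^sup>2 z\<^sup>n\<close>, which leaves no
  root but zero to \<open>h\<close>.
\<close>

lemma monom_if_norm_constant_on_circle:
  fixes h :: "complex poly"
  assumes "infinite M" "M \<subseteq> sphere 0 1" "\<And>z. z \<in> M \<Longrightarrow> norm (poly h z) = \<rho>" "\<rho> \<noteq> 0"
  shows "h = monom (lead_coeff h) (degree h)" "norm (lead_coeff h) = \<rho>"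
proof -
  have h0: "h \<noteq> 0" using assms(1,3,4) by (metis norm_zero poly_0 finite.emptyI equals0I)
  let ?r = "map_poly cnj (reflect_poly h)"
  have r: "poly ?r z = z ^ degree h * cnj (poly h z)" if "z \<in> sphere 0 1" for z
  proof -
    have z: "z * cnj z = 1" using that by (simp flip: complex_norm_square)
    hence z0: "z \<noteq> 0" by auto
    have "poly ?r z = cnj (poly (reflect_poly h) (cnj z))"
      by (metis poly_cnj complex_cnj_cnj)
    also have "\<dots> = cnj (cnj z ^ degree h * poly h (inverse (cnj z)))"
      using z0 by (simp add: poly_reflect_poly_nz)
    also have "inverse (cnj z) = z" using z by (metis inverse_unique mult.commute)
    finally show ?thesis by simp
  qed
  have "h * ?r = monom (of_real (\<rho>\<^sup>2)) (degree h)"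
  proof (rule ccontr)
    assume "h * ?r \<noteq> monom (of_real (\<rho>\<^sup>2)) (degree h)"
    hence "finite {z. poly (h * ?r - monom (of_real (\<rho>\<^sup>2)) (degree h)) z = 0}"
      by (intro poly_roots_finite) simp
    moreover have "M \<subseteq> {z. poly (h * ?r - monom (of_real (\<rho>\<^sup>2)) (degree h)) z = 0}"
    proof
      fix z assume z: "z \<in> M"
      have "poly h z * cnj (poly h z) = of_real (\<rho>\<^sup>2)"
        using assms(3)[OF z] by (simp flip: complex_norm_square)
      thus "z \<in> {z. poly (h * ?r - monom (of_real (\<rho>\<^sup>2)) (degree h)) z = 0}"
        using r[of z] z assms(2) by (auto simp: poly_monom algebra_simps)
    qed
    ultimately show False using assms(1) finite_subset by blast
  qed
  hence e: "poly h x * poly ?r x = of_real (\<rho>\<^sup>2) * x ^ degree h" for x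
    by (metis poly_mult poly_monom)
  show m: "h = monom (lead_coeff h) (degree h)"
  proof (rule monom_if_no_nonzero_root[OF h0])
    fix x assume "poly h x = 0"
    thus "x = 0" using e[of x] assms(4) by simp
  qed
  obtain z where z: "z \<in> M" using assms(1) by (metis finite.emptyI equals0I)
  have "\<rho> = norm (poly (monom (lead_coeff h) (degree h)) z)" using assms(3)[OF z] m by simp
  thus "norm (lead_coeff h) = \<rho>" using z assms(2) by (auto simp: poly_monom norm_mult norm_power)
qed

text \<open>
  Both sides are the absolute value of the resultant of \<open>F\<close> and \<open>h\<close>.
\<close>

lemma prod_over_roots:
  fixes F h :: "complex poly"
  assumes "lead_coeff F = 1"
  shows "(\<Prod>x\<in>#proots F. norm (poly h x)) = norm (lead_coeff h) ^ degree F * (\<Prod>y\<in>#proots h. norm (poly F y))"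
proof -
  have nm: "norm (poly (\<Prod>x\<in>#A. [:-x, 1:]) y) = (\<Prod>x\<in>#A. norm (y - x))" for A and y :: complex
    by (induction A) (simp_all add: norm_mult flip: left_diff_distrib)
  have F: "norm (poly F y) = (\<Prod>x\<in>#proots F. norm (y - x))" for y
    using complex_poly_decompose_multiset[of F] nm[of "proots F" y] assms by simp
  have h: "norm (poly h y) = norm (lead_coeff h) * (\<Prod>x\<in>#proots h. norm (y - x))" for y
    using arg_cong[OF complex_poly_decompose_multiset[of h], of "\<lambda>P. norm (poly P y)"] nm[of "proots h" y]
    by (simp add: norm_mult)
  have "(\<Prod>x\<in>#A. c * (\<Prod>y\<in>#B. norm (x - y))) = c ^ size A * (\<Prod>y\<in>#B. \<Prod>x\<in>#A. norm (y - x))"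
    for A B :: "complex multiset" and c :: real
    by (induction A) (simp_all add: prod_mset.distrib norm_minus_commute)
  thus ?thesis unfolding F h by (simp add: size_proots_complex)
qed

section \<open>Polynomial maps and filled Julia sets\<close>

lemma open_poly_image:
  fixes P :: "complex poly"
  assumes "degree P \<ge> 1" "open U"
  shows "open (poly P ` U)"
proof -
  have "\<not> poly P constant_on UNIV"
  proof
    assume "poly P constant_on UNIV"
    then obtain c where c: "\<And>x. poly P x = c" unfolding constant_on_def by blast
    obtain x where "poly P x = c + 1" using poly_surj[OF assms(1)] by blast
    thus False using c by simp
  qed
  thus ?thesis using assms(2)
    by (intro open_mapping_thm[where S = UNIV]) (auto intro!: holomorphic_intros)
qed

lemma interior_vimage_poly:
  fixes P :: "complex poly"
  assumes "degree P \<ge> 1"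
  shows "interior (poly P -` A) = poly P -` interior A"
proof
  have "open (poly P ` interior (poly P -` A))" by (intro open_poly_image assms open_interior)
  moreover have "poly P ` interior (poly P -` A) \<subseteq> A" using interior_subset by blast
  ultimately have "poly P ` interior (poly P -` A) \<subseteq> interior A" by (rule interior_maximal[rotated])
  thus "interior (poly P -` A) \<subseteq> poly P -` interior A" by blast
  show "poly P -` interior A \<subseteq> interior (poly P -` A)"
  proof (rule interior_maximal)
    show "poly P -` interior A \<subseteq> poly P -` A" using interior_subset by blast
    show "open (poly P -` interior A)" by (intro open_vimage open_interior continuous_intros)
  qed
qed

lemma frontier_vimage_poly:
  fixes P :: "complex poly"
  assumes "degree P \<ge> 1"
  shows "frontier (poly P -` A) = poly P -` frontier A"
proof -
  have "- (poly P -` A) = poly P -` (- A)" by auto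
  thus ?thesis unfolding frontier_def closure_interior
    using interior_vimage_poly[OF assms, of A] interior_vimage_poly[OF assms, of "- A"] by auto
qed

lemma poly_escape:
  fixes P :: "complex poly"
  assumes "degree P \<ge> 2"
  shows "\<exists>R\<ge>1. \<forall>z. norm z \<ge> R \<longrightarrow> norm (poly P z) \<ge> 2 * norm z"
proof -
  obtain a P1 where P: "P = pCons a P1" by (cases P)
  obtain a1 P2 where P1: "P1 = pCons a1 P2" by (cases P1)
  have "P2 \<noteq> 0" using assms unfolding P P1 by (auto split: if_splits)
  from poly_infinity[OF this, of 3 a1] obtain r where
    r: "\<And>z. r \<le> norm z \<Longrightarrow> 3 \<le> norm (poly P1 z)" unfolding P1 by blast
  have "norm (poly P z) \<ge> 2 * norm z" if "norm z \<ge> max 1 (max r (norm a))" for z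
  proof -
    have "3 * norm z \<le> norm (poly P1 z) * norm z" using r[of z] that by (intro mult_right_mono) auto
    also have "\<dots> = norm (poly P z - a)" by (simp add: P norm_mult)
    also have "\<dots> \<le> norm (poly P z) + norm a" by (rule norm_triangle_ineq4)
    finally show ?thesis using that by simp
  qed
  thus ?thesis by (intro exI[of _ "max 1 (max r (norm a))"]) auto
qed

lemma filled_juliaI:
  assumes "\<And>n. norm ((poly P ^^ n) z) \<le> B"
  shows "z \<in> filled_julia P"
  unfolding filled_julia_def using assms by (auto simp: bounded_iff)

lemma filled_juliaD:
  assumes "z \<in> filled_julia P"
  shows "\<exists>B. \<forall>n. norm ((poly P ^^ n) z) \<le> B"
proof -
  obtain B where B: "\<And>n. n \<ge> 1 \<Longrightarrow> norm ((poly P ^^ n) z) \<le> B"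
    using assms unfolding filled_julia_def bounded_iff by blast
  have "norm ((poly P ^^ n) z) \<le> max B (norm z)" for n
    using B[of n] by (cases n) auto
  thus ?thesis by blast
qed

lemma filled_julia_shift: "poly P z \<in> filled_julia P \<longleftrightarrow> z \<in> filled_julia P"
proof
  assume "poly P z \<in> filled_julia P"
  then obtain B where B: "\<And>n. norm ((poly P ^^ n) (poly P z)) \<le> B" using filled_juliaD by blast
  have "norm ((poly P ^^ n) z) \<le> max B (norm z)" for n
  proof (cases n)
    case (Suc m)
    thus ?thesis using B[of m] unfolding Suc funpow_Suc_right by simp
  qed simp
  thus "z \<in> filled_julia P" by (rule filled_juliaI)
next
  assume "z \<in> filled_julia P"
  then obtain B where B: "\<And>n. norm ((poly P ^^ n) z) \<le> B" using filled_juliaD by blast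
  have "norm ((poly P ^^ n) (poly P z)) \<le> B" for n
    using B[of "Suc n"] unfolding funpow_Suc_right by simp
  thus "poly P z \<in> filled_julia P" by (rule filled_juliaI)
qed

lemma filled_julia_orbit: "(poly P ^^ n) z \<in> filled_julia P \<longleftrightarrow> z \<in> filled_julia P"
  by (induction n) (simp_all add: filled_julia_shift)

lemma escape_iterate:
  assumes "\<And>z. norm z \<ge> R \<Longrightarrow> norm (poly P z) \<ge> 2 * norm z" "norm z \<ge> R" "R \<ge> 1"
  shows "norm ((poly P ^^ n) z) \<ge> 2 ^ n * norm z \<and> norm ((poly P ^^ n) z) \<ge> R"
proof (induction n)
  case (Suc n)
  have "norm ((poly P ^^ Suc n) z) \<ge> 2 * norm ((poly P ^^ n) z)" using assms(1) Suc by simp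
  with Suc assms(3) show ?case by auto
qed (use assms in simp)

lemma filled_julia_eq:
  assumes "\<And>z. norm z \<ge> R \<Longrightarrow> norm (poly P z) \<ge> 2 * norm z" "R \<ge> 1"
  shows "filled_julia P = {z. \<forall>n. norm ((poly P ^^ n) z) \<le> R}"
proof (intro equalityI subsetI)
  fix z assume z: "z \<in> filled_julia P"
  show "z \<in> {z. \<forall>n. norm ((poly P ^^ n) z) \<le> R}"
  proof (rule ccontr)
    assume "\<not> ?thesis"
    then obtain n where n: "norm ((poly P ^^ n) z) > R" by (auto simp: not_le)
    from z have "(poly P ^^ n) z \<in> filled_julia P" by (simp add: filled_julia_orbit)
    then obtain B where B: "\<And>m. norm ((poly P ^^ m) ((poly P ^^ n) z)) \<le> B" using filled_juliaD by blast
    obtain m :: nat where m: "B < 2 ^ m" using real_arch_pow[of 2 B] by auto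
    have "2 ^ m * 1 \<le> 2 ^ m * norm ((poly P ^^ n) z)" using n assms(2) by (intro mult_left_mono) auto
    also have "\<dots> \<le> norm ((poly P ^^ m) ((poly P ^^ n) z))"
      using escape_iterate[of R P, OF assms(1) _ assms(2)] n by simp
    also note B[of m]
    finally show False using m by simp
  qed
qed (auto intro: filled_juliaI)

section \<open>Iteration in the fibres\<close>

lemma coeff_fiber: "coeff (fiber q z) i = poly (coeff q i) z"
  unfolding fiber_def by (simp add: coeff_map_poly)

lemma degree_fiber_le: "degree (fiber q z) \<le> degree q"
  by (rule degree_le) (simp add: coeff_fiber coeff_eq_0)

lemma degree_fiber:
  assumes "poly (lead_coeff q) z \<noteq> 0"
  shows "degree (fiber q z) = degree q" "lead_coeff (fiber q z) = poly (lead_coeff q) z"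
proof -
  show "degree (fiber q z) = degree q"
    using assms by (intro antisym degree_fiber_le le_degree) (simp add: coeff_fiber)
  thus "lead_coeff (fiber q z) = poly (lead_coeff q) z" by (simp add: coeff_fiber)
qed

lemma poly_fiber: "poly (fiber q z) w = (\<Sum>i\<le>degree q. poly (coeff q i) z * w ^ i)"
proof -
  have "poly (fiber q z) w = (\<Sum>i\<le>degree (fiber q z). coeff (fiber q z) i * w ^ i)" by (rule poly_altdef)
  also have "\<dots> = (\<Sum>i\<le>degree q. coeff (fiber q z) i * w ^ i)"
    by (intro sum.mono_neutral_left) (auto simp: degree_fiber_le coeff_eq_0 intro: order_trans)
  finally show ?thesis by (simp add: coeff_fiber)
qed

lemma skew_iterate: "(skew p q ^^ n) (z, w) = ((poly p ^^ n) z, fiber_iter p q n z w)"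
proof -
  have "fst ((skew p q ^^ n) (z, w)) = (poly p ^^ n) z"
    by (induction n) (simp_all add: skew_def case_prod_beta)
  thus ?thesis by (simp add: fiber_iter_def prod_eq_iff)
qed

lemma fiber_iter_0 [simp]: "fiber_iter p q 0 z w = w"
  by (simp add: fiber_iter_def)

lemma fiber_iter_Suc: "fiber_iter p q (Suc n) z w = poly (fiber q ((poly p ^^ n) z)) (fiber_iter p q n z w)"
proof -
  have "fiber_iter p q (Suc n) z w = snd (skew p q ((skew p q ^^ n) (z, w)))"
    by (simp add: fiber_iter_def)
  also have "\<dots> = snd (skew p q ((poly p ^^ n) z, fiber_iter p q n z w))"
    by (simp only: skew_iterate)
  finally show ?thesis by (simp add: skew_def)
qed

lemma fiber_iter_Suc': "fiber_iter p q (Suc n) z w = fiber_iter p q n (poly p z) (poly (fiber q z) w)"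
  unfolding fiber_iter_def funpow_Suc_right o_apply by (simp add: skew_def)

lemma coeff_bound:
  fixes q :: "complex poly poly"
  shows "\<exists>M\<ge>1. \<forall>x i. norm x \<le> B \<longrightarrow> norm (poly (coeff q i) x) \<le> M"
proof -
  have "\<exists>m\<ge>0. \<forall>x. norm x \<le> B \<longrightarrow> norm (poly h x) \<le> m" for h :: "complex poly"
  proof -
    have "compact (poly h ` cball 0 B)" by (intro compact_continuous_image continuous_intros compact_cball)
    then obtain m where m: "\<And>x. norm x \<le> B \<Longrightarrow> norm (poly h x) \<le> m"
      using compact_imp_bounded bounded_iff by (metis image_eqI mem_cball_0)
    thus ?thesis by (intro exI[of _ "max 0 m"]) (auto simp: max.coboundedI2)
  qed
  hence "\<forall>h::complex poly. \<exists>m\<ge>0. \<forall>x. norm x \<le> B \<longrightarrow> norm (poly h x) \<le> m" by blast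
  from choice[OF this] obtain m where
    m: "\<And>h::complex poly. m h \<ge> 0" "\<And>(h::complex poly) x. norm x \<le> B \<Longrightarrow> norm (poly h x) \<le> m h" by blast
  let ?M = "1 + (\<Sum>i\<le>degree q. m (coeff q i))"
  have "norm (poly (coeff q i) x) \<le> ?M" if "norm x \<le> B" for x i
  proof (cases "i \<le> degree q")
    case True
    hence "m (coeff q i) \<le> (\<Sum>i\<le>degree q. m (coeff q i))" by (intro member_le_sum) (use m in auto)
    thus ?thesis using m(2)[OF that, of "coeff q i"] by linarith
  next
    case False
    thus ?thesis using m(1) by (simp add: coeff_eq_0 sum_nonneg add_nonneg_nonneg)
  qed
  moreover have "?M \<ge> 1" using m(1) by (simp add: sum_nonneg)
  ultimately show ?thesis by blast
qed

lemma fibre_singleton_power: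
  fixes P :: "complex poly"
  assumes "degree P \<ge> 1" "poly P -` {a} = {c}"
  shows "poly P w - a = lead_coeff P * (w - c) ^ degree P"
proof -
  have "set_mset (proots (P - [:a:])) = {c}"
    using assms fibre_degree[OF assms(1), of a] by (auto simp: set_eq_iff)
  hence "proots (P - [:a:]) = replicate_mset (size (proots (P - [:a:]))) c"
    by (metis set_mset_subset_singletonD size_replicate_mset order_refl)
  hence "proots (P - [:a:]) = replicate_mset (degree P) c"
    using fibre_degree[OF assms(1), of a] by (simp add: size_proots_complex)
  hence "P - [:a:] = smult (lead_coeff P) ([:- c, 1:] ^ degree P)"
    using complex_poly_decompose_multiset[of "P - [:a:]"] fibre_degree[OF assms(1), of a] by simp
  hence "poly (P - [:a:]) w = poly (smult (lead_coeff P) ([:- c, 1:] ^ degree P)) w" by simp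
  thus ?thesis by simp
qed

section \<open>Fibres over tame points\<close>

lemma summable_const_over_power:
  fixes d :: nat and C :: real
  assumes "d \<ge> 2"
  shows "summable (\<lambda>n. C / real d ^ n)"
proof -
  have "summable (\<lambda>n. C * (1 / real d) ^ n)"
    using assms by (intro summable_mult summable_geometric) auto
  thus ?thesis by (simp add: power_one_over)
qed

text \<open>
  This expresses \<open>\<Phi>(z) > -\<infinity>\<close>: over a bounded orbit, the terms of \<open>\<Phi>\<close> are bounded above by a summable
  sequence, and \<open>\<beta>\<close> controls how negative they are.
\<close>

definition tame :: "complex poly \<Rightarrow> complex poly \<Rightarrow> nat \<Rightarrow> complex \<Rightarrow> bool" where
  "tame p b d z \<longleftrightarrow> (\<exists>\<beta>::nat \<Rightarrow> real. (\<forall>n. \<beta> n \<ge> 0 \<and> norm (poly b ((poly p ^^ n) z)) \<ge> exp (- \<beta> n)) \<and>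
     summable (\<lambda>n. \<beta> n / real d ^ n))"

locale skew_map =
  fixes p :: "complex poly" and q :: "complex poly poly"
  assumes deg_p: "degree p \<ge> 2" and deg_q: "degree q \<ge> 2"
begin

abbreviation "d \<equiv> degree q"
abbreviation "b \<equiv> lead_coeff q"
abbreviation "orb \<equiv> \<lambda>n z. (poly p ^^ n) z"
abbreviation "Q \<equiv> fiber_iter p q"
abbreviation "K \<equiv> fiber_filled_julia p q"
abbreviation "E \<equiv> \<lambda>z. frontier (fiber_filled_julia p q z)"

lemma orbit_coeff_bound:
  assumes "z \<in> filled_julia p"
  obtains M where "M \<ge> 1" "\<And>n i. norm (poly (coeff q i) (orb n z)) \<le> M"
  using filled_juliaD[OF assms] coeff_bound[of _ q] by metis

lemma fiber_growth:
  assumes "M \<ge> 1" "\<And>i. norm (poly (coeff q i) z) \<le> M"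
  shows "ln (max 1 (norm (poly (fiber q z) w))) \<le> real d * ln (max 1 (norm w)) + ln (real (Suc d) * M)"
proof -
  let ?m = "max 1 (norm w)"
  have "norm (poly (fiber q z) w) \<le> (\<Sum>i\<le>d. M * ?m ^ d)"
    unfolding poly_fiber
  proof (rule sum_norm_le)
    fix i assume i: "i \<in> {..d}"
    have "norm w ^ i \<le> ?m ^ i" by (intro power_mono) auto
    also have "\<dots> \<le> ?m ^ d" using i by (intro power_increasing) auto
    finally show "norm (poly (coeff q i) z * w ^ i) \<le> M * ?m ^ d"
      unfolding norm_mult norm_power using assms by (intro mult_mono) auto
  qed
  also have "\<dots> = real (Suc d) * M * ?m ^ d" by simp
  finally have 1: "norm (poly (fiber q z) w) \<le> real (Suc d) * M * ?m ^ d" .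
  have "1 * 1 \<le> (real (Suc d) * M) * ?m ^ d"
  proof (rule mult_mono)
    show "1 \<le> real (Suc d) * M" using assms(1) mult_mono[of 1 "real (Suc d)" 1 M] by simp
  qed (use assms(1) in auto)
  hence "max 1 (norm (poly (fiber q z) w)) \<le> real (Suc d) * M * ?m ^ d" using 1 by simp
  hence "ln (max 1 (norm (poly (fiber q z) w))) \<le> ln (real (Suc d) * M * ?m ^ d)"
    by (intro ln_mono) auto
  also have "\<dots> = ln (real (Suc d) * M) + real d * ln ?m"
    using assms(1) by (subst ln_mult) (auto simp: ln_realpow)
  finally show ?thesis by simp
qed

lemma d_pow_zero: "(\<lambda>n. C / real d ^ n) \<longlonglongrightarrow> 0"
proof -
  have "(\<lambda>n. C * (1 / real d) ^ n) \<longlonglongrightarrow> C * 0"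
    using deg_q by (intro tendsto_mult tendsto_const LIMSEQ_power_zero) auto
  thus ?thesis by (simp add: power_one_over)
qed

text \<open>
  By \<open>fiber_growth\<close> and \<open>2 \<le> d\<close>, adding \<open>C / d\<^sup>n\<close> turns the sequence into a decreasing one.
\<close>

lemma green_LIMSEQ:
  assumes "z \<in> filled_julia p"
  shows "(\<lambda>n. ln (max 1 (norm (Q n z w))) / real d ^ n) \<longlonglongrightarrow> green p q z w"
proof -
  obtain M where M: "M \<ge> 1" "\<And>n i. norm (poly (coeff q i) (orb n z)) \<le> M"
    using orbit_coeff_bound[OF assms] by metis
  let ?C = "ln (real (Suc d) * M)"
  let ?a = "\<lambda>n. ln (max 1 (norm (Q n z w))) / real d ^ n"
  let ?e = "\<lambda>n. ?a n + ?C / real d ^ n"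
  have C0: "?C \<ge> 0" using M(1) mult_mono[of 1 "real (Suc d)" 1 M] by simp
  have dec: "?e (Suc n) \<le> ?e n" for n
  proof -
    have "ln (max 1 (norm (Q (Suc n) z w))) + ?C \<le> real d * ln (max 1 (norm (Q n z w))) + 2 * ?C"
      unfolding fiber_iter_Suc using fiber_growth[OF M(1), of "orb n z" "Q n z w"] M(2) by simp
    also have "\<dots> \<le> real d * ln (max 1 (norm (Q n z w))) + real d * ?C"
      using deg_q C0 by (intro add_left_mono mult_right_mono) auto
    finally have "(ln (max 1 (norm (Q (Suc n) z w))) + ?C) / real d ^ Suc n
      \<le> (real d * (ln (max 1 (norm (Q n z w))) + ?C)) / real d ^ Suc n"
      by (intro divide_right_mono) (auto simp: algebra_simps)
    thus ?thesis using deg_q by (simp add: add_divide_distrib del: of_nat_Suc)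
  qed
  have "decseq ?e" by (rule decseq_SucI) (rule dec)
  moreover have "Bseq ?e"
  proof (rule BseqI')
    fix n
    have "0 \<le> ?e n" using C0 by simp
    moreover have "?e n \<le> ?e 0" using \<open>decseq ?e\<close> by (rule decseqD) simp
    ultimately show "norm (?e n) \<le> ?e 0" by simp
  qed
  ultimately have "convergent ?e" by (intro Bseq_monoseq_convergent decseq_imp_monoseq)
  then obtain l where "?e \<longlonglongrightarrow> l" unfolding convergent_def by blast
  hence "(\<lambda>n. ?e n - ?C / real d ^ n) \<longlonglongrightarrow> l - 0" by (intro tendsto_diff d_pow_zero)
  hence "convergent ?a" unfolding convergent_def by auto
  thus ?thesis unfolding green_def by (simp add: convergent_LIMSEQ_iff)
qed

lemma green_shift:
  assumes "z \<in> filled_julia p"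
  shows "green p q (poly p z) (poly (fiber q z) w) = real d * green p q z w"
proof -
  have "(\<lambda>n. ln (max 1 (norm (Q n (poly p z) (poly (fiber q z) w)))) / real d ^ n)
      \<longlonglongrightarrow> green p q (poly p z) (poly (fiber q z) w)"
    by (rule green_LIMSEQ) (use assms in \<open>simp add: filled_julia_shift\<close>)
  moreover have "(\<lambda>n. real d * (ln (max 1 (norm (Q (Suc n) z w))) / real d ^ Suc n)) \<longlonglongrightarrow> real d * green p q z w"
    by (intro tendsto_mult tendsto_const LIMSEQ_Suc[OF green_LIMSEQ[OF assms]])
  moreover have "real d * (ln (max 1 (norm (Q (Suc n) z w))) / real d ^ Suc n) =
     ln (max 1 (norm (Q n (poly p z) (poly (fiber q z) w)))) / real d ^ n" for n
    using deg_q by (simp add: fiber_iter_Suc')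
  ultimately show ?thesis using LIMSEQ_unique by auto
qed

lemma K_vimage:
  assumes "z \<in> filled_julia p"
  shows "K z = poly (fiber q z) -` K (poly p z)"
  using green_shift[OF assms] deg_q by (auto simp: fiber_filled_julia_def)

lemma E_vimage:
  assumes "z \<in> filled_julia p" "degree (fiber q z) \<ge> 1"
  shows "E z = poly (fiber q z) -` E (poly p z)"
  unfolding K_vimage[OF assms(1)] by (rule frontier_vimage_poly[OF assms(2)])

lemma E_empty:
  assumes "z \<in> filled_julia p" "degree (fiber q z) = 0"
  shows "E z = {}"
proof -
  obtain c where "fiber q z = [:c:]" using assms(2) by (rule degree_eq_zeroE)
  hence "K z = {} \<or> K z = UNIV" unfolding K_vimage[OF assms(1)] by auto
  thus ?thesis by auto
qed

lemma green_zeroI: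
  assumes "z \<in> filled_julia p" "\<And>n. norm (Q n z w) \<le> exp (\<Lambda> n)" "\<And>n. \<Lambda> n \<ge> 0"
    "(\<lambda>n. \<Lambda> n / real d ^ n) \<longlonglongrightarrow> 0"
  shows "w \<in> K z"
proof -
  have "(\<lambda>n. ln (max 1 (norm (Q n z w))) / real d ^ n) \<longlonglongrightarrow> 0"
  proof (rule tendsto_sandwich[OF _ _ tendsto_const assms(4)])
    show "\<forall>\<^sub>F n in sequentially. 0 \<le> ln (max 1 (norm (Q n z w))) / real d ^ n" by simp
    have "ln (max 1 (norm (Q n z w))) \<le> \<Lambda> n" for n
    proof -
      have "max 1 (norm (Q n z w)) \<le> exp (\<Lambda> n)" using assms(2,3)[of n] by simp
      thus ?thesis by (metis ln_exp ln_mono less_max_iff_disj zero_less_one exp_gt_zero)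
    qed
    thus "\<forall>\<^sub>F n in sequentially. ln (max 1 (norm (Q n z w))) / real d ^ n \<le> \<Lambda> n / real d ^ n"
      by (intro always_eventually allI divide_right_mono) auto
  qed
  hence "green p q z w = 0" using LIMSEQ_unique green_LIMSEQ[OF assms(1)] by blast
  thus ?thesis by (simp add: fiber_filled_julia_def)
qed

text \<open>
  Outside the disc of radius \<open>exp \<tau>\<close>, the leading term is at least twice as large as the sum of the others.
\<close>

lemma fiber_dominance:
  assumes "M \<ge> 1" "\<And>i. norm (poly (coeff q i) z) \<le> M" "\<beta> \<ge> 0" "norm (poly b z) \<ge> exp (- \<beta>)"
    and "\<tau> = \<beta> + ln (2 * real d * M)" "norm w \<ge> exp \<tau>"
  shows "norm (poly (fiber q z) w) \<ge> exp (- \<tau>) * norm w ^ d"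
proof -
  have dM: "2 * real d * M \<ge> 2"
  proof -
    have "1 * 1 \<le> real d * M" using assms(1) deg_q by (intro mult_mono) auto
    thus ?thesis by simp
  qed
  hence dM0: "2 * real d * M > 0" by linarith
  have e\<tau>: "exp \<tau> = exp \<beta> * (2 * real d * M)"
    unfolding assms(5) exp_add exp_ln[OF dM0] ..
  have "ln (2 * real d * M) \<ge> 0" using dM by simp
  hence "exp \<tau> \<ge> 1" using assms(3,5) by simp
  hence w1: "norm w \<ge> 1" using assms(6) by linarith
  have dS: "norm w ^ d = norm w * norm w ^ (d - 1)" using deg_q by (cases d) auto
  have "norm (\<Sum>i<d. poly (coeff q i) z * w ^ i) \<le> (\<Sum>i<d. M * norm w ^ (d - 1))"
  proof (rule sum_norm_le)
    fix i assume "i \<in> {..<d}"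
    hence "norm w ^ i \<le> norm w ^ (d - 1)" using w1 by (intro power_increasing) auto
    thus "norm (poly (coeff q i) z * w ^ i) \<le> M * norm w ^ (d - 1)"
      unfolding norm_mult norm_power using assms by (intro mult_mono) auto
  qed
  hence low: "norm (\<Sum>i<d. poly (coeff q i) z * w ^ i) \<le> real d * M * norm w ^ (d - 1)" by simp
  have split: "poly (fiber q z) w = poly b z * w ^ d + (\<Sum>i<d. poly (coeff q i) z * w ^ i)"
    unfolding poly_fiber lessThan_Suc_atMost[symmetric] sum.lessThan_Suc by simp
  have "real d * M \<le> exp (- \<beta>) * exp \<tau> / 2" 
  proof -
    have "exp (- \<beta>) * exp \<tau> = 2 * real d * M" unfolding e\<tau> mult.assoc[symmetric] exp_add[symmetric] by simp
    thus ?thesis by simp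
  qed
  also have "\<dots> \<le> norm (poly b z) * norm w / 2"
    using assms by (intro divide_right_mono mult_mono) auto
  finally have "real d * M * norm w ^ (d - 1) \<le> (norm (poly b z) * norm w / 2) * norm w ^ (d - 1)"
    by (intro mult_right_mono) auto
  also have "\<dots> = norm (poly b z) * norm w ^ d / 2" unfolding dS by simp
  finally have half: "real d * M * norm w ^ (d - 1) \<le> norm (poly b z) * norm w ^ d / 2" .
  have "exp (- \<tau>) \<le> exp (- \<beta>) / 2"
  proof -
    have "exp (- \<tau>) = exp (- \<beta>) / (2 * real d * M)" 
      by (simp only: exp_minus e\<tau> divide_inverse mult.assoc inverse_mult_distrib)
    also have "\<dots> \<le> exp (- \<beta>) / 2" using dM by (intro divide_left_mono) auto
    finally show ?thesis .
  qed
  also have "\<dots> \<le> norm (poly b z) / 2" using assms(4) by simp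
  finally have "exp (- \<tau>) * norm w ^ d \<le> norm (poly b z) / 2 * norm w ^ d" by (intro mult_right_mono) auto
  also have "\<dots> = norm (poly b z) * norm w ^ d - norm (poly b z) * norm w ^ d / 2" by simp
  also have "\<dots> \<le> norm (poly b z) * norm w ^ d - norm (\<Sum>i<d. poly (coeff q i) z * w ^ i)"
    by (intro diff_left_mono order_trans[OF low half])
  also have "\<dots> = norm (poly b z * w ^ d) - norm (\<Sum>i<d. poly (coeff q i) z * w ^ i)"
    by (simp only: norm_mult norm_power)
  also have "\<dots> \<le> norm (poly (fiber q z) w)" unfolding split by (rule norm_diff_ineq)
  finally show ?thesis .
qed

text \<open>
  The sequence \<open>L\<close> solves \<open>L\<^sub>n = \<tau>\<^sub>n + L\<^sub>n\<^sub>+\<^sub>1 / d\<close> with \<open>\<tau>\<close> from \<open>fiber_dominance\<close>. Hence every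
  point outside the disc of radius \<open>exp L\<^sub>n\<close> is mapped outside the disc of radius \<open>exp L\<^sub>n\<^sub>+\<^sub>1\<close>, and its excess
  \<open>log |w| - L\<^sub>n\<close> is multiplied by at least \<open>d\<close>, so that the Green function is positive there. Conversely,
  \<open>L\<^sub>n / d\<^sup>n\<close> is the tail of a convergent series, so orbits that stay in these discs have Green function zero.
\<close>

lemma filled_fibre_description:
  fixes \<beta> :: "nat \<Rightarrow> real"
  assumes z: "z \<in> filled_julia p"
    and M: "M \<ge> 1" "\<And>n i. norm (poly (coeff q i) (orb n z)) \<le> M"
    and \<beta>: "\<And>n. \<beta> n \<ge> 0" "\<And>n. norm (poly b (orb n z)) \<ge> exp (- \<beta> n)"
    and sm: "summable (\<lambda>n. \<beta> n / real d ^ n)"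
  defines "L \<equiv> \<lambda>n. \<Sum>i. (\<beta> (n + i) + ln (2 * real d * M)) / real d ^ i"
  shows "\<And>n. L n \<ge> 0" "(\<lambda>n. L n / real d ^ n) \<longlonglongrightarrow> 0"
    "\<And>n w. norm w > exp (L n) \<Longrightarrow> norm (poly (fiber q (orb n z)) w) > exp (L (Suc n))"
    "K z = {w. \<forall>n. norm (Q n z w) \<le> exp (L n)}"
proof -
  define \<tau> where "\<tau> n = \<beta> n + ln (2 * real d * M)" for n
  have dM: "2 * real d * M \<ge> 2"
  proof -
    have "1 * 1 \<le> real d * M" using M(1) deg_q by (intro mult_mono) auto
    thus ?thesis by simp
  qed
  have \<tau>0: "\<tau> n \<ge> 0" for n using \<beta>(1)[of n] dM by (simp add: \<tau>_def)
  have d0: "real d > 0" "real d \<ge> 2" using deg_q by auto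
  let ?f = "\<lambda>n. \<tau> n / real d ^ n"
  have smt: "summable ?f"
    using summable_add[OF sm summable_const_over_power[OF deg_q]] unfolding \<tau>_def add_divide_distrib .
  have Lf: "L n = real d ^ n * (\<Sum>i. ?f (i + n))" and smn: "summable (\<lambda>i. \<tau> (n + i) / real d ^ i)" for n
  proof -
    have s: "summable (\<lambda>i. ?f (i + n))" using smt by (rule summable_ignore_initial_segment)
    have e: "\<tau> (n + i) / real d ^ i = real d ^ n * ?f (i + n)" for i
      using d0 by (simp add: power_add add.commute)
    show "L n = real d ^ n * (\<Sum>i. ?f (i + n))"
      unfolding L_def suminf_mult[OF s] \<tau>_def[symmetric] e ..
    show "summable (\<lambda>i. \<tau> (n + i) / real d ^ i)" unfolding e using s by (rule summable_mult)
  qed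
  show L0: "L n \<ge> 0" for n
    unfolding L_def \<tau>_def[symmetric] by (rule suminf_nonneg[OF smn]) (use \<tau>0 in auto)
  show Llim: "(\<lambda>n. L n / real d ^ n) \<longlonglongrightarrow> 0"
  proof -
    have "(\<lambda>n. suminf ?f - (\<Sum>i<n. ?f i)) \<longlonglongrightarrow> suminf ?f - suminf ?f"
      by (intro tendsto_diff tendsto_const summable_LIMSEQ smt)
    thus ?thesis unfolding Lf using d0 by (simp add: suminf_minus_initial_segment[OF smt])
  qed
  have Lrec: "L n = \<tau> n + L (Suc n) / real d" for n
  proof -
    have "L n = \<tau> n + (\<Sum>i. \<tau> (Suc n + i) / real d ^ Suc i)"
      using suminf_split_head[OF smn[of n]] unfolding L_def \<tau>_def[symmetric] by simp
    also have "(\<Sum>i. \<tau> (Suc n + i) / real d ^ Suc i) = (\<Sum>i. \<tau> (Suc n + i) / real d ^ i) / real d"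
      by (subst suminf_divide[OF smn, symmetric]) (simp add: field_simps)
    finally show ?thesis unfolding L_def \<tau>_def[symmetric] .
  qed
  have grow: "norm (poly (fiber q (orb n z)) w) \<ge> exp (L (Suc n) + real d * \<epsilon>)"
    if "\<epsilon> \<ge> 0" "norm w \<ge> exp (L n + \<epsilon>)" for n w \<epsilon>
  proof -
    have "L n \<ge> \<tau> n" using Lrec[of n] L0[of "Suc n"] d0 by simp
    hence "exp (\<tau> n) \<le> exp (L n + \<epsilon>)" using that(1) by simp
    hence w: "norm w \<ge> exp (\<tau> n)" using that(2) by linarith
    have "L (Suc n) = real d * (L n - \<tau> n)" using Lrec[of n] d0 by (simp add: field_simps)
    also have "\<dots> \<le> real d * L n - \<tau> n"
      using \<tau>0[of n] d0 mult_right_mono[of 1 "real d" "\<tau> n"] by (simp add: algebra_simps)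
    finally have "exp (L (Suc n) + real d * \<epsilon>) \<le> exp (- \<tau> n + real d * (L n + \<epsilon>))"
      by (simp add: algebra_simps)
    also have "\<dots> = exp (- \<tau> n) * exp (L n + \<epsilon>) ^ d"
      unfolding exp_add[of "- \<tau> n"] exp_of_nat_mult ..
    also have "\<dots> \<le> exp (- \<tau> n) * norm w ^ d" using that(2) by (intro mult_left_mono power_mono) auto
    also have "\<dots> \<le> norm (poly (fiber q (orb n z)) w)"
      by (rule fiber_dominance[OF M(1) M(2) \<beta>(1)[of n] \<beta>(2) \<tau>_def w])
    finally show ?thesis .
  qed
  show esc: "norm (poly (fiber q (orb n z)) w) > exp (L (Suc n))" if "norm w > exp (L n)" for n w
  proof -
    have pos: "norm w > 0" using that by (metis exp_gt_zero less_trans)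
    define \<epsilon> where "\<epsilon> = ln (norm w) - L n"
    have "ln (exp (L n)) < ln (norm w)" using that pos by (subst ln_less_cancel_iff) auto
    hence "\<epsilon> > 0" by (simp add: \<epsilon>_def)
    moreover have "norm w = exp (L n + \<epsilon>)" using pos by (simp add: \<epsilon>_def)
    ultimately have "exp (L (Suc n) + real d * \<epsilon>) \<le> norm (poly (fiber q (orb n z)) w)"
      using grow[of \<epsilon> n w] by simp
    moreover have "exp (L (Suc n)) < exp (L (Suc n) + real d * \<epsilon>)" using \<open>\<epsilon> > 0\<close> d0 by simp
    ultimately show ?thesis by linarith
  qed
  show "K z = {w. \<forall>n. norm (Q n z w) \<le> exp (L n)}"
  proof (intro equalityI subsetI)
    fix w assume w: "w \<in> K z"
    show "w \<in> {w. \<forall>n. norm (Q n z w) \<le> exp (L n)}"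
    proof (rule ccontr)
      assume "\<not> ?thesis"
      then obtain n where n: "norm (Q n z w) > exp (L n)" by (auto simp: not_le)
      have pos: "norm (Q n z w) > 0" using n by (metis exp_gt_zero less_trans)
      define \<epsilon> where "\<epsilon> = ln (norm (Q n z w)) - L n"
      have "ln (exp (L n)) < ln (norm (Q n z w))" using n pos by (subst ln_less_cancel_iff) auto
      hence \<epsilon>: "\<epsilon> > 0" by (simp add: \<epsilon>_def)
      have ind: "norm (Q (m + n) z w) \<ge> exp (L (m + n) + real d ^ m * \<epsilon>)" for m
      proof (induction m)
        case 0
        show ?case using pos by (simp add: \<epsilon>_def)
      next
        case (Suc m)
        have "exp (L (Suc (m + n)) + real d * (real d ^ m * \<epsilon>)) \<le> norm (Q (Suc (m + n)) z w)"
          unfolding fiber_iter_Suc by (rule grow) (use Suc \<epsilon> in auto)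
        thus ?case by (simp add: mult.assoc)
      qed
      have "\<epsilon> / real d ^ n \<le> ln (max 1 (norm (Q (m + n) z w))) / real d ^ (m + n)" for m
      proof -
        have "real d ^ m * \<epsilon> \<le> ln (exp (L (m + n) + real d ^ m * \<epsilon>))" using L0 by simp
        also have "\<dots> \<le> ln (max 1 (norm (Q (m + n) z w)))"
          using ind[of m] by (intro ln_mono) (auto simp: less_max_iff_disj)
        finally have "real d ^ m * \<epsilon> / real d ^ (m + n) \<le> ln (max 1 (norm (Q (m + n) z w))) / real d ^ (m + n)"
          by (intro divide_right_mono) auto
        thus ?thesis using d0 by (simp add: power_add)
      qed
      moreover have "(\<lambda>m. ln (max 1 (norm (Q (m + n) z w))) / real d ^ (m + n)) \<longlonglongrightarrow> green p q z w"
        using LIMSEQ_ignore_initial_segment[OF green_LIMSEQ[OF z]] .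
      ultimately have "\<epsilon> / real d ^ n \<le> green p q z w" by (intro LIMSEQ_le_const) auto
      moreover have "\<epsilon> / real d ^ n > 0" using \<epsilon> d0 by simp
      ultimately show False using w by (simp add: fiber_filled_julia_def)
    qed
  next
    fix w assume "w \<in> {w. \<forall>n. norm (Q n z w) \<le> exp (L n)}"
    thus "w \<in> K z" using green_zeroI[OF z, of w L] L0 Llim by blast
  qed
qed

lemma tame_fibre_description:
  assumes "z \<in> filled_julia p" "tame p b d z"
  obtains L where "\<And>n. L n \<ge> 0" "(\<lambda>n. L n / real d ^ n) \<longlonglongrightarrow> 0"
    "\<And>n w. norm w > exp (L n) \<Longrightarrow> norm (poly (fiber q (orb n z)) w) > exp (L (Suc n))"
    "K z = {w. \<forall>n. norm (Q n z w) \<le> exp (L n)}"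
proof -
  obtain \<beta> :: "nat \<Rightarrow> real" where \<beta>: "\<And>n. \<beta> n \<ge> 0" "\<And>n. norm (poly b (orb n z)) \<ge> exp (- \<beta> n)"
    "summable (\<lambda>n. \<beta> n / real d ^ n)" using assms(2) unfolding tame_def by blast
  obtain M where M: "M \<ge> 1" "\<And>n i. norm (poly (coeff q i) (orb n z)) \<le> M"
    using orbit_coeff_bound[OF assms(1)] by metis
  show ?thesis by (rule that) (fact filled_fibre_description[OF assms(1) M \<beta>])+
qed

lemma tame_shift:
  assumes "tame p b d z"
  shows "tame p b d (orb n z)"
proof -
  obtain \<beta> :: "nat \<Rightarrow> real" where \<beta>: "\<And>n. \<beta> n \<ge> 0" "\<And>n. norm (poly b (orb n z)) \<ge> exp (- \<beta> n)"
    "summable (\<lambda>n. \<beta> n / real d ^ n)" using assms unfolding tame_def by blast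
  have "summable (\<lambda>m. real d ^ n * (\<beta> (m + n) / real d ^ (m + n)))"
    by (intro summable_mult summable_ignore_initial_segment[OF \<beta>(3)])
  moreover have "real d ^ n * (\<beta> (m + n) / real d ^ (m + n)) = \<beta> (m + n) / real d ^ m" for m
    using deg_q by (simp add: power_add)
  ultimately have "summable (\<lambda>m. \<beta> (m + n) / real d ^ m)" by simp
  moreover have "orb m (orb n z) = orb (m + n) z" for m by (simp add: funpow_add)
  ultimately show ?thesis unfolding tame_def using \<beta>(1,2)
    by (intro exI[of _ "\<lambda>m. \<beta> (m + n)"]) simp
qed

lemma tame_nonzero:
  assumes "tame p b d z"
  shows "poly b (orb n z) \<noteq> 0"
proof -
  obtain \<beta> :: "nat \<Rightarrow> real" where "norm (poly b (orb n z)) \<ge> exp (- \<beta> n)"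
    using assms unfolding tame_def by blast
  moreover have "exp (- \<beta> n) > 0" by simp
  ultimately show ?thesis by (metis norm_zero not_le)
qed

primrec fiber_iter_poly :: "nat \<Rightarrow> complex \<Rightarrow> complex poly" where
  "fiber_iter_poly 0 z = [:0, 1:]"
| "fiber_iter_poly (Suc n) z = pcompose (fiber q (orb n z)) (fiber_iter_poly n z)"

lemma poly_fiber_iter_poly: "poly (fiber_iter_poly n z) w = Q n z w"
  by (induction n) (simp_all add: poly_pcompose fiber_iter_Suc)

lemma degree_fiber_iter_poly:
  assumes "\<And>m. poly b (orb m z) \<noteq> 0"
  shows "degree (fiber_iter_poly n z) = d ^ n"
  by (induction n) (simp_all add: degree_pcompose degree_fiber assms)

lemma continuous_fiber_iter [continuous_intros]: "continuous_on A (Q n z)"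
proof -
  have "Q n z = poly (fiber_iter_poly n z)" by (simp add: fun_eq_iff poly_fiber_iter_poly)
  thus ?thesis by (simp add: continuous_on_poly continuous_on_id)
qed

lemma E_vimage_iter:
  assumes "z \<in> filled_julia p" "\<And>m. poly b (orb m z) \<noteq> 0"
  shows "E z = Q n z -` E (orb n z)"
proof (induction n)
  case (Suc n)
  have "E (orb n z) = poly (fiber q (orb n z)) -` E (poly p (orb n z))"
    using assms deg_q by (intro E_vimage) (simp_all add: filled_julia_orbit degree_fiber)
  thus ?case unfolding Suc by (auto simp: fiber_iter_Suc)
qed auto

lemma E_image_iter:
  assumes "z \<in> filled_julia p" "\<And>m. poly b (orb m z) \<noteq> 0"
  shows "Q n z ` E z = E (orb n z)"
proof -
  have "degree (fiber_iter_poly n z) \<ge> 1" using degree_fiber_iter_poly[OF assms(2)] deg_q by simp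
  hence "poly (fiber_iter_poly n z) ` (poly (fiber_iter_poly n z) -` E (orb n z)) = E (orb n z)"
    by (rule poly_image_vimage)
  thus ?thesis unfolding E_vimage_iter[OF assms, of n] by (simp add: poly_fiber_iter_poly[abs_def] fun_eq_iff vimage_def)
qed

text \<open>
  \<open>K z\<close> is a nested intersection of the compact nonempty preimages of the discs of radius \<open>exp L\<^sub>n\<close>.
\<close>

lemma tame_K_bounded_nonempty:
  assumes z: "z \<in> filled_julia p" and "tame p b d z"
  shows "compact (K z)" "K z \<noteq> {}"
proof -
  obtain L where D: "\<And>n. L n \<ge> 0" "(\<lambda>n. L n / real d ^ n) \<longlonglongrightarrow> 0"
    "\<And>n w. norm w > exp (L n) \<Longrightarrow> norm (poly (fiber q (orb n z)) w) > exp (L (Suc n))"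
    "K z = {w. \<forall>n. norm (Q n z w) \<le> exp (L n)}"
    by (fact tame_fibre_description[OF assms])
  let ?A = "\<lambda>n. {w. norm (Q n z w) \<le> exp (L n)}"
  have K: "K z = (\<Inter>n. ?A n)" unfolding D(4) by auto
  have anti: "?A (Suc n) \<subseteq> ?A n" for n
    using D(3)[of n] by (auto simp: fiber_iter_Suc) (meson not_le)
  have A0: "?A n \<subseteq> ?A 0" for n
    using lift_Suc_antimono_le[of ?A, OF anti] by blast
  have cl: "closed (?A n)" for n
    by (intro closed_Collect_le continuous_intros)
  have cp: "compact (?A n)" for n
  proof -
    have "bounded (?A 0)" unfolding bounded_iff by auto
    hence "bounded (?A n)" using A0 bounded_subset by blast
    thus ?thesis using cl by (simp add: compact_eq_bounded_closed)
  qed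
  have ne: "?A n \<noteq> {}" for n
  proof -
    have "degree (fiber_iter_poly n z) \<ge> 1"
      using degree_fiber_iter_poly[OF tame_nonzero[OF assms(2)]] deg_q by simp
    then obtain w where "Q n z w = 0" using poly_surj[of _ 0] unfolding poly_fiber_iter_poly[symmetric] by blast
    hence "w \<in> ?A n" by simp
    thus ?thesis by blast
  qed
  show "K z \<noteq> {}" unfolding K
    by (rule compact_nest[OF cp ne]) (rule lift_Suc_antimono_le[of ?A, OF anti])
  have "closed (\<Inter>n. ?A n)" using cl by (intro closed_INT) auto
  moreover have "bounded (\<Inter>n. ?A n)"
    by (rule bounded_subset[OF compact_imp_bounded[OF cp[of 0]]]) (rule INT_lower, simp)
  ultimately show "compact (K z)" unfolding K by (simp add: compact_eq_bounded_closed)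
qed

text \<open>
  If \<open>E z\<close> were a point, the boundaries over the whole orbit would be points \<open>c\<^sub>n\<close>, and the fibre maps would be
  \<open>w \<mapsto> c\<^sub>n\<^sub>+\<^sub>1 + b\<^sub>d (w - c\<^sub>n)\<^sup>d\<close>. With \<open>M\<close> a bound for the coefficients, they keep
  the distance to \<open>c\<^sub>n\<close> below \<open>1 / M\<close>, so a neighbourhood of \<open>c\<^sub>0\<close> belongs
  to \<open>K z\<close>.
\<close>

lemma tame_E_not_singleton:
  assumes z: "z \<in> filled_julia p" and t: "tame p b d z"
  shows "E z \<noteq> {c}"
proof
  assume Ec: "E z = {c}"
  define cc where "cc n = Q n z c" for n
  note nz = tame_nonzero[OF t]
  have En: "E (orb n z) = {cc n}" for n
    using E_image_iter[OF z nz, of n] unfolding Ec cc_def by simp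
  obtain M where M: "M \<ge> 1" "\<And>n i. norm (poly (coeff q i) (orb n z)) \<le> M"
    using orbit_coeff_bound[OF z] by metis
  obtain L where D: "\<And>n. L n \<ge> 0" "(\<lambda>n. L n / real d ^ n) \<longlonglongrightarrow> 0"
    "\<And>n w. norm w > exp (L n) \<Longrightarrow> norm (poly (fiber q (orb n z)) w) > exp (L (Suc n))"
    "K z = {w. \<forall>n. norm (Q n z w) \<le> exp (L n)}"
    by (fact tame_fibre_description[OF z t])
  have "c \<in> K z" using Ec frontier_subset_compact[OF tame_K_bounded_nonempty(1)[OF z t]] by blast
  hence cL: "norm (cc n) \<le> exp (L n)" for n unfolding D(4) cc_def by blast
  have pow: "poly (fiber q (orb n z)) w - cc (Suc n) = poly b (orb n z) * (w - cc n) ^ d" for n w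
  proof -
    have dg: "degree (fiber q (orb n z)) = d" "lead_coeff (fiber q (orb n z)) = poly b (orb n z)"
      using degree_fiber[OF nz] by auto
    have "E (orb n z) = poly (fiber q (orb n z)) -` E (poly p (orb n z))"
      using z dg deg_q by (intro E_vimage) (simp_all add: filled_julia_orbit)
    hence "poly (fiber q (orb n z)) -` {cc (Suc n)} = {cc n}" using En[of n] En[of "Suc n"] by simp
    from fibre_singleton_power[OF _ this] show ?thesis using dg deg_q by simp
  qed
  have near: "norm (Q n z w - cc n) \<le> 1 / M" if w: "norm (w - c) \<le> 1 / M" for n w
  proof (induction n)
    case 0
    thus ?case using w by (simp add: cc_def)
  next
    case (Suc n)
    have "norm (Q (Suc n) z w - cc (Suc n)) = norm (poly b (orb n z)) * norm (Q n z w - cc n) ^ d"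
      unfolding fiber_iter_Suc pow by (simp add: norm_mult norm_power)
    also have "\<dots> \<le> M * (1 / M) ^ d" using M Suc by (intro mult_mono power_mono) auto
    also have "\<dots> = (1 / M) ^ (d - 1)" using M(1) deg_q by (cases d) auto
    also have "\<dots> \<le> (1 / M) ^ 1" using M(1) deg_q by (intro power_decreasing) auto
    finally show ?case by simp
  qed
  have "cball c (1 / M) \<subseteq> K z"
  proof
    fix w assume "w \<in> cball c (1 / M)"
    hence w: "norm (w - c) \<le> 1 / M" by (simp add: dist_norm norm_minus_commute)
    show "w \<in> K z"
    proof (rule green_zeroI[OF z, where \<Lambda> = "\<lambda>n. L n + ln 2"])
      fix n
      have "norm (Q n z w) \<le> norm (cc n) + norm (Q n z w - cc n)" by (rule norm_triangle_sub)
      also have "\<dots> \<le> exp (L n) + 1 / M" using cL near[OF w] by (intro add_mono)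
      also have "\<dots> \<le> exp (L n) + exp (L n)"
      proof -
        have "1 / M \<le> 1" using M(1) by simp
        also have "1 \<le> exp (L n)" using D(1) by simp
        finally show ?thesis by simp
      qed
      also have "\<dots> = exp (L n + ln 2)" by (simp add: exp_add)
      finally show "norm (Q n z w) \<le> exp (L n + ln 2)" .
      show "L n + ln 2 \<ge> 0" using D(1)[of n] by simp
    next
      have "(\<lambda>n. L n / real d ^ n + ln 2 / real d ^ n) \<longlonglongrightarrow> 0 + 0"
        by (intro tendsto_add D(2) d_pow_zero)
      thus "(\<lambda>n. (L n + ln 2) / real d ^ n) \<longlonglongrightarrow> 0" by (simp add: add_divide_distrib)
    qed
  qed
  hence "c \<in> interior (K z)" using M(1) by (intro interiorI[of "ball c (1 / M)"]) auto
  thus False using Ec unfolding frontier_def by auto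
qed

text \<open>
  \<open>E z\<close> is the preimage of \<open>E\<close> over \<open>p\<^sup>n(z)\<close>, which has two points, under a polynomial of degree \<open>d\<^sup>n\<close>.
\<close>

lemma tame_E_compact_infinite:
  assumes z: "z \<in> filled_julia p" and t: "tame p b d z"
  shows "compact (E z)" "infinite (E z)"
proof -
  show "compact (E z)" using tame_K_bounded_nonempty(1)[OF assms] by (rule compact_frontier)
  have ne: "E x \<noteq> {}" if "x \<in> filled_julia p" "tame p b d x" for x
    using tame_K_bounded_nonempty[OF that] compact_imp_bounded not_bounded_UNIV
    by (auto simp: frontier_eq_empty)
  show "infinite (E z)"
  proof
    assume fin: "finite (E z)"
    define n where "n = card (E z)"
    have zn: "orb n z \<in> filled_julia p" "tame p b d (orb n z)"
      using z t by (simp_all add: filled_julia_orbit tame_shift)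
    obtain x where x: "x \<in> E (orb n z)" using ne[OF zn] by blast
    then obtain y where y: "y \<in> E (orb n z)" "x \<noteq> y"
      using tame_E_not_singleton[OF zn, of x] by blast
    have dg: "degree (fiber_iter_poly n z) = d ^ n" by (rule degree_fiber_iter_poly[OF tame_nonzero[OF t]])
    hence "card (poly (fiber_iter_poly n z) -` {x, y}) > d ^ n"
      using card_fibre_two_points[of "fiber_iter_poly n z" x y] y deg_q by simp
    moreover have "poly (fiber_iter_poly n z) -` {x, y} \<subseteq> E z"
      unfolding E_vimage_iter[OF z tame_nonzero[OF t], of n] using x y by (auto simp: poly_fiber_iter_poly)
    hence "card (poly (fiber_iter_poly n z) -` {x, y}) \<le> n" unfolding n_def by (rule card_mono[OF fin])
    ultimately have "d ^ n < n" by linarith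
    moreover have "n < 2 ^ n" by simp
    moreover have "(2::nat) ^ n \<le> d ^ n" using deg_q by (intro power_mono) auto
    ultimately show False by linarith
  qed
qed

text \<open>
  For a fibre map that is independent of \<open>z\<close>, the discs in \<open>filled_fibre_description\<close> have constant radius.
\<close>

lemma K_autonomous:
  assumes "z \<in> filled_julia p" "\<And>x. fiber q x = P"
  shows "K z = filled_julia P"
proof (intro equalityI subsetI)
  have P: "lead_coeff P \<noteq> 0" "degree P \<ge> 2" and bP: "poly b x = lead_coeff P" for x
  proof -
    have b0: "b \<noteq> 0" using deg_q by auto
    then obtain x0 where "poly b x0 \<noteq> 0" using poly_all_0_iff_0 by blast
    thus "degree P \<ge> 2" using degree_fiber(1)[of q x0] assms(2) deg_q by simp
    thus "lead_coeff P \<noteq> 0" by auto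
    have dP: "degree P = d" using degree_fiber(1)[of q x0] \<open>poly b x0 \<noteq> 0\<close> assms(2) by simp
    show "poly b x = lead_coeff P" using coeff_fiber[of q x d] assms(2) dP by simp
  qed
  have QP: "Q n z w = (poly P ^^ n) w" for n w
    by (induction n) (simp_all add: fiber_iter_Suc assms(2))
  obtain M where M: "M \<ge> 1" "\<And>n i. norm (poly (coeff q i) (orb n z)) \<le> M"
    using orbit_coeff_bound[OF assms(1)] by metis
  define \<beta> where "\<beta> = (\<lambda>n::nat. max 0 (- ln (norm (lead_coeff P))))"
  have sm: "summable (\<lambda>n. \<beta> n / real d ^ n)"
    unfolding \<beta>_def by (rule summable_const_over_power[OF deg_q])
  have \<beta>: "\<beta> n \<ge> 0" "norm (poly b (orb n z)) \<ge> exp (- \<beta> n)" for n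
  proof -
    have "exp (- \<beta> n) \<le> exp (ln (norm (lead_coeff P)))" unfolding exp_le_cancel_iff \<beta>_def by simp
    also have "\<dots> = norm (lead_coeff P)" using P(1) by simp
    finally show "norm (poly b (orb n z)) \<ge> exp (- \<beta> n)" unfolding bP .
  qed (simp add: \<beta>_def)
  define L where "L n = (\<Sum>i. (\<beta> (n + i) + ln (2 * real d * M)) / real d ^ i)" for n
  note D = filled_fibre_description[OF assms(1) M \<beta> sm, folded L_def]
  have Lc: "L n = L 0" for n by (simp add: L_def \<beta>_def)
  {
    fix w assume "w \<in> K z"
    hence "norm ((poly P ^^ n) w) \<le> exp (L 0)" for n unfolding D(4) QP using Lc[of n] by (metis (mono_tags, lifting) mem_Collect_eq)
    thus "w \<in> filled_julia P" by (rule filled_juliaI)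
  next
    fix w assume "w \<in> filled_julia P"
    then obtain B where B: "\<And>n. norm ((poly P ^^ n) w) \<le> B" using filled_juliaD by blast
    show "w \<in> K z"
    proof (rule green_zeroI[OF assms(1), where \<Lambda> = "\<lambda>n. ln (max 1 B)"])
      show "norm (Q n z w) \<le> exp (ln (max 1 B))" for n unfolding QP using B[of n] by simp
      show "0 \<le> ln (max 1 B)" by simp
    qed (rule d_pow_zero)
  }
qed

end

section \<open>Julia sets in one variable\<close>

lemma fiber_const: "fiber (map_poly (\<lambda>c. [:c:]) P) z = P"
  by (rule poly_eqI) (simp add: coeff_fiber coeff_map_poly)

text \<open>
  \<open>P\<close> is the fibre map of \<open>(z, w) \<mapsto> (z\<^sup>2, P(w))\<close> over the fixed point \<open>1\<close>.
\<close>

lemma julia_facts: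
  assumes "degree P \<ge> 2"
  shows "compact (julia P)" "infinite (julia P)" "poly P -` julia P = julia P" "compact (filled_julia P)"
    "filled_julia P = {w. lim (\<lambda>n. ln (max 1 (norm ((poly P ^^ n) w))) / real (degree P) ^ n) = 0}"
proof -
  let ?q = "map_poly (\<lambda>c. [:c:]) P" and ?p = "monom 1 2 :: complex poly"
  have dq: "degree ?q = degree P" by (rule degree_map_poly) simp
  interpret skew_map ?p ?q
    by standard (use assms dq in \<open>simp_all add: degree_monom_eq\<close>)
  have orb1: "(poly ?p ^^ n) 1 = 1" for n by (induction n) (simp_all add: poly_monom)
  have z: "1 \<in> filled_julia ?p" by (rule filled_juliaI[of _ _ 1]) (simp add: orb1)
  have lc: "lead_coeff ?q = [:lead_coeff P:]" by (simp add: dq coeff_map_poly)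
  have l0: "lead_coeff P \<noteq> 0" using assms by auto
  have "tame ?p (lead_coeff ?q) (degree ?q) 1"
    unfolding tame_def lc
  proof (intro exI[of _ "\<lambda>n. max 0 (- ln (norm (lead_coeff P)))"] conjI allI)
    show "summable (\<lambda>n. max 0 (- ln (norm (lead_coeff P))) / real (degree ?q) ^ n)"
      by (rule summable_const_over_power[OF deg_q])
    have "exp (- max 0 (- ln (norm (lead_coeff P)))) \<le> exp (ln (norm (lead_coeff P)))"
      unfolding exp_le_cancel_iff by simp
    also have "\<dots> = norm (lead_coeff P)" using l0 by simp
    finally show "exp (- max 0 (- ln (norm (lead_coeff P)))) \<le> norm (poly [:lead_coeff P:] ((poly ?p ^^ n) 1))" for n
      by simp
  qed simp
  note t = tame_E_compact_infinite[OF z this] tame_K_bounded_nonempty[OF z this]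
  have K1: "fiber_filled_julia ?p ?q 1 = filled_julia P"
    by (rule K_autonomous[OF z fiber_const])
  hence E1: "frontier (fiber_filled_julia ?p ?q 1) = julia P" by (simp add: julia_def)
  show "compact (julia P)" "infinite (julia P)" using t unfolding E1 by auto
  show "compact (filled_julia P)" using t unfolding K1 by auto
  have "fiber_iter ?p ?q n 1 w = (poly P ^^ n) w" for n w
    by (induction n) (simp_all add: fiber_iter_Suc fiber_const)
  thus "filled_julia P = {w. lim (\<lambda>n. ln (max 1 (norm ((poly P ^^ n) w))) / real (degree P) ^ n) = 0}"
    using K1 dq by (simp add: fiber_filled_julia_def green_def)
  have "poly ?p 1 = 1" by (simp add: poly_monom)
  thus "poly P -` julia P = julia P"
    using E_vimage[OF z] assms unfolding fiber_const E1[symmetric] by simp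
qed

section \<open>Tame points of the Julia set of the base\<close>

primrec iter_poly :: "complex poly \<Rightarrow> nat \<Rightarrow> complex poly" where
  "iter_poly p 0 = [:0, 1:]"
| "iter_poly p (Suc n) = pcompose p (iter_poly p n)"

lemma poly_iter_poly: "poly (iter_poly p n) z = (poly p ^^ n) z"
  by (induction n) (simp_all add: poly_pcompose)

lemma degree_iter_poly: "degree (iter_poly p n) = degree p ^ n"
  by (induction n) (simp_all add: degree_pcompose)

lemma lead_coeff_iter_poly:
  assumes "degree p \<ge> 1" "lead_coeff p = 1"
  shows "lead_coeff (iter_poly p n) = 1"
proof (induction n)
  case (Suc n)
  have "lead_coeff (pcompose p (iter_poly p n)) = lead_coeff p * lead_coeff (iter_poly p n) ^ degree p"
    by (rule lead_coeff_comp) (use assms(1) in \<open>simp add: degree_iter_poly\<close>)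
  thus ?case using Suc assms(2) by simp
qed simp

lemma sum_mset_le_imp_ex:
  fixes f :: "'a \<Rightarrow> real"
  assumes "(\<Sum>x\<in>#A. f x) \<le> real (size A) * c" "A \<noteq> {#}"
  shows "\<exists>x\<in>#A. f x \<le> c"
proof (rule ccontr)
  assume "\<not> ?thesis"
  hence "\<And>x. x \<in># A \<Longrightarrow> f x > c" by force
  hence "(\<Sum>x\<in>#A. f x) > real (size A) * c"
    using assms(2)
  proof (induction A)
    case (add x A)
    show ?case
    proof (cases "A = {#}")
      case True
      thus ?thesis using add.prems by simp
    next
      case False
      hence "(\<Sum>x\<in>#A. f x) > real (size A) * c" using add by simp
      moreover have "f x > c" using add.prems by simp
      ultimately show ?thesis by (simp add: algebra_simps)
    qed
  qed simp
  thus False using assms(1) by simp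
qed

lemma ln_prod_mset:
  assumes "\<And>x. x \<in># A \<Longrightarrow> f x > (0::real)"
  shows "ln (\<Prod>x\<in>#A. f x) = (\<Sum>x\<in>#A. ln (f x)) \<and> (\<Prod>x\<in>#A. f x) > 0"
  using assms by (induction A) (auto simp: ln_mult_pos)

lemma prod_mset_ge_power:
  assumes "\<And>x. x \<in># A \<Longrightarrow> f x \<ge> c" "(c::real) \<ge> 0"
  shows "(\<Prod>x\<in>#A. f x) \<ge> c ^ size A"
  using assms
proof (induction A)
  case (add x A)
  have "c * c ^ size A \<le> f x * (\<Prod>x\<in>#A. f x)"
    using add by (intro mult_mono) (auto intro: order_trans)
  thus ?case by simp
qed simp

text \<open>
  The orbits of the roots of \<open>g\<close> form a countable set, so an escaping point outside this set exists. Each of these orbits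
  is bounded by \<open>R\<close> or tends to infinity, so it comes close to \<open>z0\<close> at most finitely often.
\<close>

lemma exists_regular_value:
  fixes p g :: "complex poly"
  assumes "g \<noteq> 0" and R: "\<And>z. norm z \<ge> R \<Longrightarrow> norm (poly p z) \<ge> 2 * norm z" "R \<ge> 1"
  obtains z0 \<eta> where "norm z0 > R" "\<eta> > 0" "\<eta> \<le> 1"
    "\<And>y m. poly g y = 0 \<Longrightarrow> norm ((poly p ^^ m) y - z0) \<ge> \<eta>"
proof -
  let ?S = "{y. poly g y = 0}"
  have finS: "finite ?S" by (rule poly_roots_finite[OF assms(1)])
  let ?O = "\<Union>m. (poly p ^^ m) ` ?S"
  have "countable ?O" using finS by (intro countable_UN) (auto intro: countable_finite)
  moreover have "complex_of_real -` ?O \<subseteq> Re ` ?O"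
  proof
    fix x assume "x \<in> complex_of_real -` ?O"
    hence "Re (complex_of_real x) \<in> Re ` ?O" by (intro imageI) (simp only: vimage_eq)
    thus "x \<in> Re ` ?O" by (simp only: Re_complex_of_real)
  qed
  ultimately have "countable (complex_of_real -` ?O)" by (meson countable_image countable_subset)
  hence "\<not> {R + 1..R + 2} \<subseteq> complex_of_real -` ?O"
    using countable_subset uncountable_closed_interval[of "R + 1" "R + 2"] by auto
  then obtain x where x: "x \<in> {R + 1..R + 2}" "x \<notin> complex_of_real -` ?O" by blast
  hence x: "x \<ge> R + 1" "complex_of_real x \<notin> ?O" by (simp, simp only: vimage_eq not_False_eq_True)
  define z0 where "z0 = complex_of_real x"
  have z0: "norm z0 \<ge> R + 1" using x R(2) by (simp add: z0_def)
  have ne: "(poly p ^^ m) y \<noteq> z0" if "y \<in> ?S" for m y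
  proof
    assume "(poly p ^^ m) y = z0"
    hence "z0 \<in> ?O" using that by (intro UN_I[of m] UNIV_I image_eqI[of _ _ y]) simp_all
    thus False using x(2) unfolding z0_def by contradiction
  qed
  have ex: "\<exists>\<eta>>0. \<forall>m. norm ((poly p ^^ m) y - z0) \<ge> \<eta>" if y: "y \<in> ?S" for y
  proof -
    have "\<exists>k. \<forall>m\<ge>k. norm ((poly p ^^ m) y - z0) \<ge> 1"
    proof (cases "\<forall>m. norm ((poly p ^^ m) y) \<le> R")
      case True
      have "norm ((poly p ^^ m) y - z0) \<ge> 1" for m
      proof -
        have "norm z0 - norm ((poly p ^^ m) y) \<le> norm ((poly p ^^ m) y - z0)"
          unfolding norm_minus_commute[of _ z0] by (rule norm_triangle_ineq2)
        moreover have "norm ((poly p ^^ m) y) \<le> R" using True by blast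
        ultimately show ?thesis using z0 by linarith
      qed
      thus ?thesis by blast
    next
      case False
      then obtain m0 where m0: "norm ((poly p ^^ m0) y) \<ge> R" by (auto simp: not_le intro: less_imp_le)
      obtain k where k: "norm z0 + 1 < 2 ^ k" using real_arch_pow[of 2 "norm z0 + 1"] by auto
      have "norm ((poly p ^^ m) y - z0) \<ge> 1" if m: "m \<ge> m0 + k" for m
      proof -
        have "(poly p ^^ m) y = (poly p ^^ (m - m0)) ((poly p ^^ m0) y)"
          using m by (metis add_leD1 funpow_add le_add_diff_inverse2 o_apply)
        hence "norm ((poly p ^^ m) y) \<ge> 2 ^ (m - m0) * norm ((poly p ^^ m0) y)"
          using escape_iterate[of R p, OF R(1) m0 R(2)] by simp
        moreover have "2 ^ k * 1 \<le> 2 ^ (m - m0) * norm ((poly p ^^ m0) y)"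
          using m m0 R(2) by (intro mult_mono power_increasing) auto
        ultimately have "norm ((poly p ^^ m) y) \<ge> norm z0 + 1" using k by linarith
        thus ?thesis using norm_triangle_ineq2[of "(poly p ^^ m) y" z0] by linarith
      qed
      thus ?thesis by blast
    qed
    then obtain k where k: "\<And>m. m \<ge> k \<Longrightarrow> norm ((poly p ^^ m) y - z0) \<ge> 1" by blast
    let ?V = "insert 1 ((\<lambda>m. norm ((poly p ^^ m) y - z0)) ` {..<k})"
    have "Min ?V > 0" using ne[OF y] by (subst Min_gr_iff) auto
    moreover have "norm ((poly p ^^ m) y - z0) \<ge> Min ?V" for m
    proof (cases "m < k")
      case False
      hence "norm ((poly p ^^ m) y - z0) \<ge> 1" using k by simp
      moreover have "Min ?V \<le> 1" by (intro Min_le) auto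
      ultimately show ?thesis by linarith
    qed (intro Min_le, auto)
    ultimately show ?thesis by blast
  qed
  then obtain e where e: "\<And>y. y \<in> ?S \<Longrightarrow> e y > 0" "\<And>y m. y \<in> ?S \<Longrightarrow> norm ((poly p ^^ m) y - z0) \<ge> e y"
    by metis
  let ?V = "insert 1 (e ` ?S)"
  show ?thesis
  proof (rule that)
    show "norm z0 > R" using z0 by simp
    show "Min ?V > 0" using e finS by (subst Min_gr_iff) auto
    show "Min ?V \<le> 1" using finS by (intro Min_le) auto
    fix y m assume y: "poly g y = 0"
    hence "Min ?V \<le> e y" using finS by (intro Min_le) auto
    thus "norm ((poly p ^^ m) y - z0) \<ge> Min ?V" using e(2)[of y m] y by auto
  qed
qed

text \<open>
  Let \<open>z0\<close> be as in \<open>exists_regular_value\<close>. The product of \<open>|g \<circ> p\<^sup>k|\<close> over the \<open>\<delta>\<^sup>n\<close> roots of \<open>p\<^sup>n - z0\<close> is, up to a power of the leading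
  coefficient of \<open>g\<close>, a product of values of \<open>p\<^sup>n - z0\<close> at the \<open>\<delta>\<^sup>k degree g\<close> roots of \<open>g \<circ> p\<^sup>k\<close>, each at least \<open>\<eta>\<close> in absolute value; so
  the mean of \<open>ln |g \<circ> p\<^sup>k|\<close> is bounded below uniformly in \<open>k \<le> n\<close>. Hence for every \<open>n\<close> some root \<open>x\<^sub>n\<close> has
  weighted partial sums of \<open>- ln |g \<circ> p\<^sup>k|\<close>, \<open>k \<le> n\<close>, below a fixed bound. The roots \<open>x\<^sub>n\<close> escape, but later and later,
  so an accumulation point \<open>l\<close> of them lies in the Julia set, and it inherits the bound.
\<close>

lemma exists_tame_point:
  fixes p g :: "complex poly"
  assumes p: "degree p \<ge> 2" "lead_coeff p = 1" and g: "g \<noteq> 0" and d: "d \<ge> 2"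
  shows "\<exists>z\<in>julia p. tame p g d z"
proof -
  let ?orb = "\<lambda>n z. (poly p ^^ n) z"
  obtain R where R: "R \<ge> 1" "\<And>z. norm z \<ge> R \<Longrightarrow> norm (poly p z) \<ge> 2 * norm z"
    using poly_escape[OF p(1)] by blast
  obtain z0 \<eta> where z0: "norm z0 > R" and \<eta>: "\<eta> > 0" "\<eta> \<le> 1"
    "\<And>y m. poly g y = 0 \<Longrightarrow> norm (?orb m y - z0) \<ge> \<eta>"
    using exists_regular_value[OF g R(2,1)] by metis
  have K: "filled_julia p = {z. \<forall>n. norm (?orb n z) \<le> R}" by (rule filled_julia_eq[OF R(2,1)])
  define F where "F n = iter_poly p n - [:z0:]" for n
  define Z where "Z n = proots (F n)" for n
  define N where "N n = degree p ^ n" for n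
  have N1: "N n \<ge> 1" for n using p(1) by (simp add: N_def)
  have dF: "degree (F n) = N n" "lead_coeff (F n) = 1" "F n \<noteq> 0" for n
  proof -
    have "degree (iter_poly p n) \<ge> 1" using N1[of n] by (simp add: degree_iter_poly N_def)
    from fibre_degree[OF this, of z0] show "degree (F n) = N n" "lead_coeff (F n) = 1" "F n \<noteq> 0"
      using lead_coeff_iter_poly[of p n] p by (simp_all add: F_def degree_iter_poly N_def)
  qed
  have szZ: "size (Z n) = N n" for n unfolding Z_def by (simp add: size_proots_complex dF)
  have Z: "x \<in># Z n \<longleftrightarrow> ?orb n x = z0" for x n
    unfolding Z_def using dF(3)[of n] by (simp add: F_def poly_iter_poly)
  have Zb: "norm (?orb k x) \<le> norm z0" if "x \<in># Z n" "k \<le> n" for x n k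
  proof (rule ccontr)
    assume c: "\<not> ?thesis"
    have "?orb n x = ?orb (n - k) (?orb k x)"
      using that(2) by (metis funpow_add le_add_diff_inverse2 o_apply)
    hence "norm (?orb n x) \<ge> 2 ^ (n - k) * norm (?orb k x)"
      using escape_iterate[of R p, OF R(2) _ R(1), of "?orb k x" "n - k"] c z0 by simp
    moreover have "1 * norm (?orb k x) \<le> 2 ^ (n - k) * norm (?orb k x)" by (intro mult_right_mono) auto
    ultimately show False using c that(1) by (simp add: Z)
  qed
  have gnz: "poly g (?orb k x) \<noteq> 0" if "x \<in># Z n" "k \<le> n" for x n k
  proof
    assume "poly g (?orb k x) = 0"
    from \<eta>(3)[OF this, of "n - k"] have "norm (?orb n x - z0) \<ge> \<eta>"
      using that(2) by (metis funpow_add le_add_diff_inverse2 o_apply)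
    thus False using that(1) \<eta>(1) by (simp add: Z)
  qed
  obtain M where M: "M \<ge> 1" "\<And>x. norm x \<le> norm z0 \<Longrightarrow> norm (poly g x) \<le> M"
    using coeff_bound[of "norm z0" "[:g:]"] by (metis coeff_pCons_0)
  define m where "m = ln M"
  have lnm: "ln (norm (poly g x)) \<le> m" if "norm x \<le> norm z0" "poly g x \<noteq> 0" for x
    unfolding m_def using M(1) M(2)[OF that(1)] that(2) by (intro ln_mono) auto
  define A where "A = norm (lead_coeff g) * \<eta> ^ degree g"
  have A0: "A > 0" using g \<eta>(1) by (simp add: A_def)
  have avg: "(\<Sum>x\<in>#Z n. ln (norm (poly g (?orb k x)))) \<ge> real (N n) * ln A" if k: "k \<le> n" for n k
  proof -
    define h where "h = pcompose g (iter_poly p k)"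
    have hx: "poly h x = poly g (?orb k x)" for x by (simp add: h_def poly_pcompose poly_iter_poly)
    have dh: "degree h = degree g * N k" by (simp add: h_def degree_pcompose degree_iter_poly N_def)
    have lh: "lead_coeff h = lead_coeff g"
    proof -
      have "lead_coeff h = lead_coeff g * lead_coeff (iter_poly p k) ^ degree g"
        unfolding h_def by (rule lead_coeff_comp) (use p(1) in \<open>simp add: degree_iter_poly\<close>)
      thus ?thesis using lead_coeff_iter_poly[of p k] p by simp
    qed
    have h0: "h \<noteq> 0" using lh g by auto
    have "degree h \<le> degree g * N n" unfolding dh N_def using p(1) k by (intro mult_left_mono power_increasing) auto
    hence "\<eta> ^ (degree g * N n) \<le> \<eta> ^ degree h" using \<eta> by (intro power_decreasing) auto
    also have "\<dots> \<le> (\<Prod>y\<in>#proots h. norm (poly (F n) y))"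
      unfolding size_proots_complex[symmetric]
    proof (rule prod_mset_ge_power)
      fix y assume "y \<in># proots h"
      hence "poly g (?orb k y) = 0" using h0 hx by simp
      from \<eta>(3)[OF this, of "n - k"] show "norm (poly (F n) y) \<ge> \<eta>"
        using k by (simp add: F_def poly_iter_poly) (metis funpow_add le_add_diff_inverse2 o_apply)
    qed (use \<eta> in simp)
    finally have "norm (lead_coeff g) ^ N n * \<eta> ^ (degree g * N n)
        \<le> norm (lead_coeff h) ^ degree (F n) * (\<Prod>y\<in>#proots h. norm (poly (F n) y))"
      unfolding lh dF(1) by (intro mult_left_mono) auto
    also have "\<dots> = (\<Prod>x\<in>#Z n. norm (poly h x))"
      unfolding Z_def by (rule prod_over_roots[OF dF(2), symmetric])
    finally have "A ^ N n \<le> (\<Prod>x\<in>#Z n. norm (poly h x))"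
      by (simp add: A_def power_mult_distrib power_mult)
    moreover have "norm (poly h x) > 0" if "x \<in># Z n" for x using gnz[OF that k] by (simp add: hx)
    ultimately have "ln (A ^ N n) \<le> (\<Sum>x\<in>#Z n. ln (norm (poly h x)))"
      using ln_prod_mset[of "Z n" "\<lambda>x. norm (poly h x)"] A0 by (metis ln_mono zero_less_power)
    thus ?thesis using A0 by (simp add: ln_realpow hx)
  qed
  define a where "a k x = m - ln (norm (poly g (?orb k x)))" for k x
  have a0: "a k x \<ge> 0" if "x \<in># Z n" "k \<le> n" for k x n
    using lnm[OF Zb[OF that] gnz[OF that]] by (simp add: a_def)
  define C where "C = max 0 (m - ln A)"
  have asum: "(\<Sum>x\<in>#Z n. a k x) \<le> real (N n) * C" if "k \<le> n" for n k
  proof -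
    have "(\<Sum>x\<in>#B. a k x) = real (size B) * m - (\<Sum>x\<in>#B. ln (norm (poly g (?orb k x))))" for B
      by (induction B) (simp_all add: a_def algebra_simps)
    hence "(\<Sum>x\<in>#Z n. a k x) \<le> real (N n) * (m - ln A)"
      using avg[OF that] szZ[of n] unfolding right_diff_distrib by simp
    also have "\<dots> \<le> real (N n) * C" by (intro mult_left_mono) (auto simp: C_def)
    finally show ?thesis .
  qed
  have geo: "(\<Sum>k\<le>n. 1 / real d ^ k) \<le> 2" for n
  proof -
    have "(\<Sum>k\<le>n. 1 / real d ^ k) \<le> (\<Sum>k\<le>n. (1 / 2) ^ k)"
      unfolding power_one_over using d by (intro sum_mono divide_left_mono power_mono) auto
    also have "\<dots> \<le> (\<Sum>k. (1 / 2) ^ k)" by (intro sum_le_suminf) (auto intro: summable_geometric)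
    also have "\<dots> = 2" by (subst suminf_geometric) auto
    finally show ?thesis .
  qed
  have "\<exists>x\<in>#Z n. (\<Sum>k\<le>n. a k x / real d ^ k) \<le> 2 * C" for n
  proof (rule sum_mset_le_imp_ex)
    have "(\<Sum>x\<in>#Z n. \<Sum>k\<le>n. a k x / real d ^ k) = (\<Sum>k\<le>n. (\<Sum>x\<in>#Z n. a k x) / real d ^ k)"
    proof -
      have "(\<Sum>x\<in>#B. \<Sum>k\<le>n. a k x / real d ^ k) = (\<Sum>k\<le>n. (\<Sum>x\<in>#B. a k x) / real d ^ k)" for B
        by (induction B) (simp_all add: sum.distrib add_divide_distrib)
      thus ?thesis .
    qed
    also have "\<dots> \<le> (\<Sum>k\<le>n. real (N n) * C / real d ^ k)"
      by (intro sum_mono divide_right_mono asum) auto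
    also have "\<dots> = real (N n) * C * (\<Sum>k\<le>n. 1 / real d ^ k)" by (simp add: sum_distrib_left)
    also have "\<dots> \<le> real (N n) * C * 2" using geo[of n] by (intro mult_left_mono) (auto simp: C_def)
    finally show "(\<Sum>x\<in>#Z n. \<Sum>k\<le>n. a k x / real d ^ k) \<le> real (size (Z n)) * (2 * C)"
      by (simp add: szZ mult_ac)
    show "Z n \<noteq> {#}" using szZ[of n] N1[of n] by force
  qed
  then obtain x where x: "\<And>n. x n \<in># Z n" "\<And>n. (\<Sum>k\<le>n. a k (x n) / real d ^ k) \<le> 2 * C" by metis
  have "\<forall>n. x n \<in> cball 0 (norm z0)" using Zb[OF x(1), of 0] by simp
  then obtain l r where lr: "strict_mono r" "(x \<circ> r) \<longlonglongrightarrow> l"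
    using compact_cball[of 0 "norm z0"] unfolding compact_def by metis
  have orbl: "(\<lambda>n. ?orb k (x (r n))) \<longlonglongrightarrow> ?orb k l" for k
  proof -
    have "isCont (poly (iter_poly p k)) l" by simp
    hence "(\<lambda>n. poly (iter_poly p k) ((x \<circ> r) n)) \<longlonglongrightarrow> poly (iter_poly p k) l"
      using lr(2) by (rule isCont_tendsto_compose)
    thus ?thesis by (simp add: poly_iter_poly)
  qed
  have evk: "\<forall>\<^sub>F n in sequentially. r n \<ge> k" for k
    using eventually_ge_at_top[of k] by eventually_elim (metis lr(1) seq_suble le_trans)
  have lb: "norm (?orb k l) \<le> norm z0" for k
  proof (rule tendsto_upperbound[OF tendsto_norm[OF orbl[of k]]])
    show "\<forall>\<^sub>F n in sequentially. norm (?orb k (x (r n))) \<le> norm z0"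
      using evk[of k] by eventually_elim (use Zb[OF x(1)] in blast)
  qed simp
  have lK: "l \<in> filled_julia p" by (rule filled_juliaI[OF lb])
  have xK: "x n \<notin> filled_julia p" for n
  proof
    assume "x n \<in> filled_julia p"
    hence "norm (?orb n (x n)) \<le> R" unfolding K by blast
    thus False using x(1)[of n] z0 by (simp add: Z)
  qed
  have "l \<in> closure (- filled_julia p)" unfolding closure_sequential
    using lr(2) xK by (intro exI[of _ "x \<circ> r"]) auto
  hence lJ: "l \<in> julia p" using lK closure_subset
    by (auto simp: julia_def frontier_def closure_interior)
  have gl: "(\<lambda>n. norm (poly g (?orb k (x (r n))))) \<longlonglongrightarrow> norm (poly g (?orb k l))" for k
    by (intro tendsto_norm) (rule isCont_tendsto_compose[OF _ orbl], simp)
  \<comment> \<open>a single term of the bounded sum keeps \<open>g (p\<^sup>k (x n))\<close> away from zero, uniformly in \<open>n\<close>\<close>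
  have glnz: "poly g (?orb k l) \<noteq> 0" for k
  proof -
    have "exp (m - 2 * C * real d ^ k) \<le> norm (poly g (?orb k (x n)))" if n: "n \<ge> k" for n
    proof -
      have "a k (x n) / real d ^ k \<le> (\<Sum>k\<le>n. a k (x n) / real d ^ k)"
        using n a0[OF x(1)] by (intro member_le_sum) auto
      also note x(2)[of n]
      finally have "a k (x n) \<le> 2 * C * real d ^ k" using d by (simp add: field_simps)
      hence "m - 2 * C * real d ^ k \<le> ln (norm (poly g (?orb k (x n))))" by (simp add: a_def)
      hence "exp (m - 2 * C * real d ^ k) \<le> exp (ln (norm (poly g (?orb k (x n)))))" by simp
      thus ?thesis using gnz[OF x(1) n] by simp
    qed
    hence "\<forall>\<^sub>F n in sequentially. exp (m - 2 * C * real d ^ k) \<le> norm (poly g (?orb k (x (r n))))"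
      using evk[of k] by (auto elim: eventually_mono)
    from tendsto_lowerbound[OF gl[of k] this] have "exp (m - 2 * C * real d ^ k) \<le> norm (poly g (?orb k l))"
      by simp
    thus ?thesis by (metis exp_gt_zero norm_zero not_le)
  qed
  have al: "(\<lambda>n. a k (x (r n))) \<longlonglongrightarrow> a k l" for k
    unfolding a_def using glnz[of k] by (intro tendsto_diff tendsto_const tendsto_ln gl) auto
  have "tame p g d l" unfolding tame_def
  proof (intro exI[of _ "\<lambda>k. a k l"] conjI allI)
    have al0: "a k l \<ge> 0" for k using lnm[OF lb[of k] glnz[of k]] by (simp add: a_def)
    show "a k l \<ge> 0" for k by (rule al0)
    show "exp (- a k l) \<le> norm (poly g (?orb k l))" for k
    proof -
      have "exp (- a k l) \<le> exp (ln (norm (poly g (?orb k l))))"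
        unfolding exp_le_cancel_iff a_def m_def using M(1) by simp
      thus ?thesis using glnz[of k] by simp
    qed
    show "summable (\<lambda>k. a k l / real d ^ k)"
    proof (rule summableI_nonneg_bounded)
      show "a k l / real d ^ k \<ge> 0" for k using al0 by simp
      fix j
      have "(\<lambda>n. \<Sum>k<j. a k (x (r n)) / real d ^ k) \<longlonglongrightarrow> (\<Sum>k<j. a k l / real d ^ k)"
        using d by (intro tendsto_sum tendsto_divide al tendsto_const) auto
      moreover have "\<forall>\<^sub>F n in sequentially. (\<Sum>k<j. a k (x (r n)) / real d ^ k) \<le> 2 * C"
        using evk[of j]
      proof eventually_elim
        case (elim n)
        have "(\<Sum>k<j. a k (x (r n)) / real d ^ k) \<le> (\<Sum>k\<le>r n. a k (x (r n)) / real d ^ k)"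
          using elim a0[OF x(1)] by (intro sum_mono2) auto
        also note x(2)
        finally show ?case .
      qed
      ultimately show "(\<Sum>k<j. a k l / real d ^ k) \<le> 2 * C" by (rule tendsto_upperbound) simp
    qed
  qed
  thus ?thesis using lJ by blast
qed

lemma julia_subset_filled:
  assumes "degree P \<ge> 2"
  shows "julia P \<subseteq> filled_julia P"
  using julia_facts(4)[OF assms] unfolding julia_def by (rule frontier_subset_compact)

text \<open>
  A point that is tame for \<open>g h\<close> is tame for \<open>g\<close> and is no root of \<open>h\<close>, and \<open>h\<close> may vanish at any given finite
  set.
\<close>

lemma infinitely_many_tame_points:
  fixes p g :: "complex poly"
  assumes p: "degree p \<ge> 2" "lead_coeff p = 1" and g: "g \<noteq> 0" and d: "d \<ge> 2"
  shows "infinite {z \<in> julia p. tame p g d z}"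
proof
  let ?T = "{z \<in> julia p. tame p g d z}"
  assume fin: "finite ?T"
  define h where "h = (\<Prod>x\<in>?T. [:-x, 1:])"
  have h0: "h \<noteq> 0" using fin by (auto simp: h_def)
  obtain z where z: "z \<in> julia p" "tame p (g * h) d z"
    using exists_tame_point[OF p _ d, of "g * h"] g h0 by auto
  obtain \<beta> :: "nat \<Rightarrow> real" where \<beta>: "\<And>n. \<beta> n \<ge> 0" "\<And>n. norm (poly (g * h) ((poly p ^^ n) z)) \<ge> exp (- \<beta> n)"
    "summable (\<lambda>n. \<beta> n / real d ^ n)" using z(2) unfolding tame_def by blast
  obtain B where B: "\<And>n. norm ((poly p ^^ n) z) \<le> B"
    using filled_juliaD julia_subset_filled[OF p(1)] z(1) by blast
  obtain M where M: "M \<ge> 1" "\<And>x. norm x \<le> B \<Longrightarrow> norm (poly h x) \<le> M"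
    using coeff_bound[of B "[:h:]"] by (metis coeff_pCons_0)
  have "tame p g d z" unfolding tame_def
  proof (intro exI[of _ "\<lambda>n. \<beta> n + ln M"] conjI allI)
    show "\<beta> n + ln M \<ge> 0" for n using \<beta>(1)[of n] M(1) by simp
    show "exp (- (\<beta> n + ln M)) \<le> norm (poly g ((poly p ^^ n) z))" for n
    proof -
      have "exp (- \<beta> n) \<le> norm (poly g ((poly p ^^ n) z)) * norm (poly h ((poly p ^^ n) z))"
        using \<beta>(2)[of n] by (simp add: norm_mult)
      also have "\<dots> \<le> norm (poly g ((poly p ^^ n) z)) * M" by (intro mult_left_mono M B) auto
      finally have "exp (- \<beta> n) / M \<le> norm (poly g ((poly p ^^ n) z))"
        using M(1) by (simp add: field_simps)
      moreover have "exp (- (\<beta> n + ln M)) = exp (- \<beta> n) / M"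
        using M(1) by (simp add: exp_diff flip: diff_conv_add_uminus)
      ultimately show ?thesis by simp
    qed
    show "summable (\<lambda>n. (\<beta> n + ln M) / real d ^ n)"
      using summable_add[OF \<beta>(3) summable_const_over_power[OF d]] by (simp add: add_divide_distrib)
  qed
  hence "z \<in> ?T" using z(1) by simp
  hence "poly h z = 0" using fin by (simp add: h_def poly_prod prod_zero_iff)
  moreover have "poly (g * h) z \<noteq> 0"
    using \<beta>(2)[of 0] exp_gt_zero[of "- \<beta> 0"] by (metis funpow_0 norm_zero not_le)
  ultimately show False by simp
qed

section \<open>Preimages and rotations of Julia sets\<close>

lemma scaling_image_eqI:
  fixes c :: complex
  assumes "c \<noteq> 0" "\<And>w. c * w \<in> A \<longleftrightarrow> w \<in> B"
  shows "(\<lambda>w. c * w) ` B = A"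
proof (intro equalityI subsetI)
  fix x assume x: "x \<in> A"
  have e: "x = c * (x / c)" using assms(1) by simp
  hence "x / c \<in> B" using assms(2)[of "x / c"] x by simp
  thus "x \<in> (\<lambda>w. c * w) ` B" using e by (rule rev_image_eqI)
qed (use assms(2) in blast)

lemma frontier_scaling:
  fixes c :: complex
  assumes "c \<noteq> 0"
  shows "frontier ((\<lambda>w. c * w) ` S) = (\<lambda>w. c * w) ` frontier S"
proof -
  have im: "(\<lambda>w. c * w) ` T = poly [:0, 1 / c:] -` T" for T
    using assms by (auto simp: image_iff) (metis nonzero_mult_div_cancel_left times_divide_eq_right)
  show ?thesis unfolding im by (rule frontier_vimage_poly) (use assms in simp)
qed

lemma rotation_preserves_julia:
  fixes P :: "complex poly"
  assumes n: "norm \<mu> = 1" and pm: "\<And>z. poly P (\<mu> * z) = \<mu> ^ m * poly P z"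
  shows "(poly P ^^ k) (\<mu> * z) = \<mu> ^ (m ^ k) * (poly P ^^ k) z"
    "(\<lambda>z. \<mu> * z) ` julia P = julia P"
proof -
  have nz: "\<mu> \<noteq> 0" using n by auto
  have pmk: "poly P (\<mu> ^ k * z) = \<mu> ^ (m * k) * poly P z" for k z
  proof (induction k)
    case (Suc k)
    have "poly P (\<mu> * (\<mu> ^ k * z)) = \<mu> ^ m * (\<mu> ^ (m * k) * poly P z)" unfolding pm Suc ..
    thus ?case by (simp add: power_add mult_ac)
  qed simp
  show orb: "(poly P ^^ k) (\<mu> * z) = \<mu> ^ (m ^ k) * (poly P ^^ k) z" for k z
    by (induction k) (simp_all add: pmk)
  hence no: "norm ((poly P ^^ k) (\<mu> * z)) = norm ((poly P ^^ k) z)" for k z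
    by (simp add: norm_mult norm_power n)
  have fil: "\<mu> * z \<in> filled_julia P \<longleftrightarrow> z \<in> filled_julia P" for z
    using filled_juliaI[of P "\<mu> * z"] filled_juliaI[of P z] filled_juliaD[of "\<mu> * z" P] filled_juliaD[of z P]
    unfolding no by blast
  have "(\<lambda>z. \<mu> * z) ` filled_julia P = filled_julia P" by (rule scaling_image_eqI[OF nz fil])
  thus "(\<lambda>z. \<mu> * z) ` julia P = julia P"
    unfolding julia_def frontier_scaling[OF nz, symmetric] by simp
qed

lemma bounded_vimage_poly:
  fixes P :: "complex poly"
  assumes "degree P \<ge> 1" "bounded A"
  shows "bounded (poly P -` A)"
proof -
  obtain a P' where P: "P = pCons a P'" by (cases P)
  have "P' \<noteq> 0" using assms(1) unfolding P by auto
  obtain B where B: "\<And>x. x \<in> A \<Longrightarrow> norm x \<le> B" using assms(2) bounded_iff by blast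
  from poly_infinity[OF \<open>P' \<noteq> 0\<close>, of "B + 1" a] obtain r where
    r: "\<And>z. r \<le> norm z \<Longrightarrow> B + 1 \<le> norm (poly P z)" unfolding P by blast
  have "norm z \<le> r" if "z \<in> poly P -` A" for z
    using r[of z] B[of "poly P z"] that by force
  thus ?thesis unfolding bounded_iff by blast
qed

lemma infinite_vimage_poly_iff:
  fixes P :: "complex poly"
  assumes "degree P \<ge> 1"
  shows "infinite (poly P -` A) \<longleftrightarrow> infinite A"
proof
  assume "infinite (poly P -` A)"
  show "infinite A"
  proof
    assume "finite A"
    have "finite (poly P -` {a})" for a
    proof -
      have "poly P -` {a} = {x. poly (P - [:a:]) x = 0}" by auto
      thus ?thesis using poly_roots_finite[OF fibre_degree(2)[OF assms]] by simp
    qed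
    hence "finite (\<Union>a\<in>A. poly P -` {a})" using \<open>finite A\<close> by blast
    moreover have "poly P -` A = (\<Union>a\<in>A. poly P -` {a})" by auto
    ultimately show False using \<open>infinite (poly P -` A)\<close> by simp
  qed
next
  assume "infinite A"
  thus "infinite (poly P -` A)" using poly_image_vimage[OF assms, of A] by (metis finite_imageI)
qed

lemma infinite_image_of_finite_fibres:
  fixes P :: "complex poly"
  assumes "degree P \<ge> 1" "infinite S"
  shows "infinite (poly P ` S)"
proof
  assume "finite (poly P ` S)"
  hence "finite (poly P -` (poly P ` S))" using infinite_vimage_poly_iff[OF assms(1)] by blast
  moreover have "S \<subseteq> poly P -` (poly P ` S)" by auto
  ultimately show False using assms(2) finite_subset by blast
qed

lemma islimpt_poly_image:
  fixes P :: "complex poly"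
  assumes "degree P \<ge> 1" "z islimpt W" "poly P ` W \<subseteq> W"
  shows "poly P z islimpt W"
  unfolding islimpt_eq_acc_point
proof (intro allI impI)
  fix U assume "poly P z \<in> U" "open U"
  hence U: "poly P z \<in> U \<and> open U" by simp
  hence "open (poly P -` U)" by (intro open_vimage continuous_intros) auto
  hence "infinite (poly P -` U \<inter> W)" using assms(2) U unfolding islimpt_eq_acc_point by blast
  hence "infinite (poly P ` (poly P -` U \<inter> W))" by (rule infinite_image_of_finite_fibres[OF assms(1)])
  moreover have "poly P ` (poly P -` U \<inter> W) \<subseteq> U \<inter> W" using assms(3) by auto
  ultimately show "infinite (U \<inter> W)" using finite_subset by blast
qed

lemma islimpt_poly_vimage:
  fixes P :: "complex poly"
  assumes "degree P \<ge> 1" "poly P z islimpt W" "poly P -` W - F \<subseteq> W" "finite F"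
  shows "z islimpt W"
  unfolding islimpt_eq_acc_point
proof (intro allI impI)
  fix U assume "z \<in> U" "open U"
  hence U: "z \<in> U \<and> open U" by simp
  hence "open (poly P ` U)" "poly P z \<in> poly P ` U" using open_poly_image[OF assms(1)] by auto
  hence "infinite (poly P ` U \<inter> W)" using assms(2) unfolding islimpt_eq_acc_point by blast
  moreover have "poly P ` U \<inter> W \<subseteq> poly P ` (U \<inter> poly P -` W)" by auto
  ultimately have "infinite (U \<inter> poly P -` W)" by (meson finite_imageI finite_subset)
  hence "infinite ((U \<inter> poly P -` W) - F)" using assms(4) by simp
  moreover have "(U \<inter> poly P -` W) - F \<subseteq> U \<inter> W" using assms(3) by auto
  ultimately show "infinite (U \<inter> W)" using finite_subset by blast
qed

text \<open>
  By \<open>card_fibre_two_points\<close> for the iterates, a finite completely invariant set is a single point \<open>a\<close>. Then \<open>p\<close> is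
  \<open>a + c (w - a)\<^sup>n\<close>, so \<open>a\<close> is an attracting fixed point and not in the Julia set.
\<close>

lemma completely_invariant_infinite:
  assumes p: "degree p \<ge> 2" and Y: "poly p -` Y = Y" "Y \<noteq> {}" "Y \<subseteq> julia p"
  shows "infinite Y"
proof
  assume fin: "finite Y"
  have it: "poly (iter_poly p n) -` Y = Y" for n
  proof (induction n)
    case (Suc n)
    have "poly (iter_poly p (Suc n)) -` Y = poly (iter_poly p n) -` (poly p -` Y)"
      by (auto simp: poly_pcompose)
    thus ?case using Suc Y(1) by simp
  qed auto
  have "\<exists>a. Y = {a}"
  proof (rule ccontr)
    assume "\<nexists>a. Y = {a}"
    then obtain a b where ab: "a \<in> Y" "b \<in> Y" "a \<noteq> b" using Y(2) by blast
    define n where "n = card Y"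
    have "degree (iter_poly p n) \<ge> 1" using p by (simp add: degree_iter_poly)
    hence "degree p ^ n < card (poly (iter_poly p n) -` {a, b})"
      using card_fibre_two_points[OF _ ab(3)] by (metis degree_iter_poly)
    also have "\<dots> \<le> card Y"
      using it[of n] ab by (intro card_mono fin) blast
    finally have "degree p ^ n < n" by (simp add: n_def)
    moreover have "n < 2 ^ n" by simp
    moreover have "(2::nat) ^ n \<le> degree p ^ n" using p by (intro power_mono) auto
    ultimately show False by linarith
  qed
  then obtain a where a: "Y = {a}" by blast
  have pw: "poly p w - a = lead_coeff p * (w - a) ^ degree p" for w
    using fibre_singleton_power[of p a a w] p Y(1) unfolding a by simp
  let ?c = "norm (lead_coeff p)"
  define r where "r = min 1 (1 / ?c)"
  have c0: "?c > 0" using p by auto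
  have r: "r > 0" "r \<le> 1" "?c * r \<le> 1" using c0 by (auto simp: r_def min_def field_simps)
  have "ball a r \<subseteq> filled_julia p"
  proof
    fix z assume z: "z \<in> ball a r"
    have "norm ((poly p ^^ n) z - a) \<le> r" for n
    proof (induction n)
      case 0
      thus ?case using z by (simp add: dist_norm norm_minus_commute)
    next
      case (Suc n)
      have "norm ((poly p ^^ Suc n) z - a) = ?c * norm ((poly p ^^ n) z - a) ^ degree p"
        by (simp add: pw norm_mult norm_power)
      also have "\<dots> \<le> ?c * r ^ degree p" using Suc by (intro mult_left_mono power_mono) auto
      also have "\<dots> \<le> ?c * r ^ 2" using p r by (intro mult_left_mono power_decreasing) auto
      also have "\<dots> = (?c * r) * r" by (simp add: power2_eq_square)
      also have "\<dots> \<le> 1 * r" using r by (intro mult_right_mono) auto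
      finally show ?case by simp
    qed
    hence "norm ((poly p ^^ n) z) \<le> norm a + r" for n
      using norm_triangle_sub[of "(poly p ^^ n) z" a] by (smt (verit))
    thus "z \<in> filled_julia p" by (rule filled_juliaI)
  qed
  hence "a \<in> interior (filled_julia p)" using r by (intro interiorI[of "ball a r"]) auto
  thus False using Y(3) unfolding a julia_def frontier_def by auto
qed

lemma infinite_powers_one:
  fixes M :: "complex set"
  assumes "infinite M" "\<And>\<mu>. \<mu> \<in> M \<Longrightarrow> \<mu> \<noteq> 0" "\<And>\<mu>. \<mu> \<in> M \<Longrightarrow> \<mu> powi n = 1"
  shows "n = 0"
proof (rule ccontr)
  assume n: "n \<noteq> 0"
  have "M \<subseteq> {z. z ^ nat \<bar>n\<bar> = 1}"
  proof
    fix \<mu> assume \<mu>: "\<mu> \<in> M"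
    have "\<mu> powi \<bar>n\<bar> = 1"
      using assms(3)[OF \<mu>] by (cases "n \<ge> 0") (simp_all add: power_int_minus)
    thus "\<mu> \<in> {z. z ^ nat \<bar>n\<bar> = 1}" by (simp add: power_int_def)
  qed
  moreover have "finite {z::complex. z ^ nat \<bar>n\<bar> = 1}"
    using n by (intro finite_roots_unity) auto
  ultimately show False using assms(1) finite_subset by blast
qed

section \<open>Symmetries of the Julia set of a skew product in normal form\<close>

locale skew_normal = skew_map +
  assumes normal: "normal_form p q"
begin

abbreviation "\<delta> \<equiv> degree p"
abbreviation "fib \<equiv> \<lambda>z. skew_julia p q `` {z}"

lemma monic: "lead_coeff p = 1" "lead_coeff b = 1" "coeff p (\<delta> - 1) = 0" "coeff q (d - 1) = 0"
  using normal unfolding normal_form_def by auto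

lemma b_nonzero: "b \<noteq> 0" using deg_q by auto

lemma fib_eq: "fib z = (if z \<in> julia p then E z else {})"
  unfolding skew_julia_def by auto

lemma in_filled: "z \<in> julia p \<Longrightarrow> z \<in> filled_julia p"
  using julia_subset_filled[OF deg_p] by blast

lemma julia_p_shift: "poly p z \<in> julia p \<longleftrightarrow> z \<in> julia p"
  using julia_facts(3)[OF deg_p] by auto

text \<open>
  Fibres that are large enough for \<open>centred_preimage_rigidity\<close>. Unlike tameness, this property is visibly
  invariant under symmetries of the Julia set.
\<close>

definition good :: "complex set" where
  "good = {z \<in> julia p. bounded (E z) \<and> infinite (E z)}"

lemma good_infinite: "infinite good"
proof -
  have "{z \<in> julia p. tame p b d z} \<subseteq> good"
  proof safe
    fix z assume z: "z \<in> julia p" "tame p b d z"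
    show "z \<in> good" using tame_E_compact_infinite[OF in_filled[OF z(1)] z(2)] z(1)
      unfolding good_def by (simp add: compact_imp_bounded)
  qed
  moreover have "infinite {z \<in> julia p. tame p b d z}"
    by (rule infinitely_many_tame_points[OF deg_p monic(1) b_nonzero deg_q])
  ultimately show ?thesis using finite_subset by blast
qed

lemma good_julia: "z \<in> good \<Longrightarrow> z \<in> julia p" by (simp add: good_def)

lemma good_compact: "z \<in> good \<Longrightarrow> compact (E z)"
  by (simp add: good_def compact_eq_bounded_closed)

lemma good_degree:
  assumes "z \<in> good"
  shows "degree (fiber q z) \<ge> 1"
proof (rule ccontr)
  assume "\<not> ?thesis"
  hence "E z = {}" using E_empty[OF in_filled[OF good_julia[OF assms]]] by simp
  thus False using assms by (simp add: good_def)
qed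

lemma good_E: "z \<in> good \<Longrightarrow> E z = poly (fiber q z) -` E (poly p z)"
  by (rule E_vimage[OF in_filled[OF good_julia] good_degree])

lemma good_forward:
  assumes "z \<in> good"
  shows "poly p z \<in> good"
proof -
  note dg = good_degree[OF assms] and e = good_E[OF assms]
  have "E (poly p z) = poly (fiber q z) ` E z" unfolding e poly_image_vimage[OF dg] ..
  hence "compact (E (poly p z))"
    using good_compact[OF assms] by (auto intro!: compact_continuous_image continuous_intros)
  moreover have "infinite (E (poly p z))"
    using assms e infinite_vimage_poly_iff[OF dg] by (simp add: good_def)
  ultimately show ?thesis using assms by (simp add: good_def julia_p_shift compact_imp_bounded)
qed

lemma good_backward:
  assumes "poly p z \<in> good" "poly b z \<noteq> 0"
  shows "z \<in> good"
proof -
  have dg: "degree (fiber q z) \<ge> 1" using degree_fiber[OF assms(2)] deg_q by simp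
  have zJ: "z \<in> julia p" using good_julia[OF assms(1)] by (simp add: julia_p_shift)
  have "E z = poly (fiber q z) -` E (poly p z)" by (rule E_vimage[OF in_filled[OF zJ] dg])
  thus ?thesis using assms(1) zJ bounded_vimage_poly[OF dg] infinite_vimage_poly_iff[OF dg]
    by (simp add: good_def)
qed

text \<open>
  A point of the preimage of \<open>good\<close> can fail to be good at the finitely many roots of \<open>b\<close>. Passing to limit points
  repairs this: \<open>good_limits\<close> is completely invariant.
\<close>

definition good_limits :: "complex set" where "good_limits = {y. y islimpt good}"

lemma good_limits_props: "compact good_limits" "infinite good_limits" "poly p -` good_limits = good_limits"
proof -
  have WJ: "good \<subseteq> julia p" using good_julia by blast
  have cJ: "compact (julia p)" by (rule julia_facts(1)[OF deg_p])
  have YJ: "good_limits \<subseteq> julia p"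
    using islimpt_subset[OF _ WJ] closed_limpt[of "julia p"] compact_imp_closed[OF cJ]
    by (auto simp: good_limits_def)
  have "closed good_limits" unfolding good_limits_def by (rule closed_limpts)
  thus "compact good_limits" using YJ cJ by (metis bounded_subset compact_eq_bounded_closed)
  have dp: "degree p \<ge> 1" using deg_p by simp
  show inv: "poly p -` good_limits = good_limits"
  proof (intro equalityI subsetI)
    fix z assume "z \<in> good_limits"
    hence "z islimpt good" by (simp add: good_limits_def)
    moreover have "poly p ` good \<subseteq> good" by (intro image_subsetI good_forward)
    ultimately have "poly p z islimpt good" by (rule islimpt_poly_image[OF dp])
    thus "z \<in> poly p -` good_limits" by (simp add: good_limits_def)
  next
    fix z assume "z \<in> poly p -` good_limits"
    hence "poly p z islimpt good" by (simp add: good_limits_def)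
    moreover have "poly p -` good - {z. poly b z = 0} \<subseteq> good"
      by (rule subsetI, rule good_backward) simp_all
    ultimately have "z islimpt good"
      by (rule islimpt_poly_vimage[OF dp _ _ poly_roots_finite[OF b_nonzero]])
    thus "z \<in> good_limits" by (simp add: good_limits_def)
  qed
  have "good_limits \<noteq> {}"
  proof -
    have "\<exists>x\<in>julia p. x islimpt good"
      using cJ good_infinite WJ by (simp add: compact_eq_Bolzano_Weierstrass)
    thus ?thesis by (auto simp: good_limits_def)
  qed
  thus "infinite good_limits" by (intro completely_invariant_infinite[OF deg_p inv] YJ)
qed

lemma fibre_rigidity:
  assumes "z1 \<in> good" "z2 \<in> good" "poly b z1 \<noteq> 0" "poly b z2 \<noteq> 0" "\<nu> \<noteq> 0"
    and "E z2 = (\<lambda>w. \<nu> * w + k) ` E z1"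
  obtains e where "k = 0"
    "\<And>w. poly (fiber q z2) (\<nu> * w) = \<nu> ^ d * poly b z2 / poly b z1 * poly (fiber q z1) w + e"
    "E (poly p z2) = (\<lambda>x. \<nu> ^ d * poly b z2 / poly b z1 * x + e) ` E (poly p z1)"
proof -
  note d1 = degree_fiber[OF assms(3)] and d2 = degree_fiber[OF assms(4)]
  have sub: "coeff (fiber q z) (d - 1) = 0" for z by (simp add: coeff_fiber monic(4)[simplified])
  have im: "(\<lambda>w. \<nu> * w + k) ` (poly (fiber q z1) -` E (poly p z1)) = poly (fiber q z2) -` E (poly p z2)"
    using assms(6) unfolding good_E[OF assms(1)] good_E[OF assms(2)] by simp
  have inf: "infinite (E (poly p z1))" using good_forward[OF assms(1)] by (simp add: good_def)
  show ?thesis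
    using centred_preimage_rigidity[OF d1(1) d2(1) deg_q sub sub good_compact[OF good_forward[OF assms(1)]]
        good_compact[OF good_forward[OF assms(2)]] inf assms(5) im] that d1(2) d2(2) by metis
qed

text \<open>
  By \<open>fibre_rigidity\<close>, the sets over \<open>p(z1)\<close> and \<open>p(z2)\<close> are again related by an affine map, to which the same lemma
  applies. Therefore its translation part vanishes.
\<close>

lemma fibre_rigidity_centred:
  assumes "z1 \<in> good" "z2 \<in> good" "poly b z1 \<noteq> 0" "poly b z2 \<noteq> 0" "\<nu> \<noteq> 0"
    and "poly b (poly p z1) \<noteq> 0" "poly b (poly p z2) \<noteq> 0"
    and "E z2 = (\<lambda>w. \<nu> * w) ` E z1"
  defines "u \<equiv> \<nu> ^ d * poly b z2 / poly b z1"
  shows "u \<noteq> 0" "E (poly p z2) = (\<lambda>x. u * x) ` E (poly p z1)"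
    "poly (coeff q i) z2 * \<nu> ^ i = u * poly (coeff q i) z1"
proof -
  show u: "u \<noteq> 0" using assms by (simp add: u_def)
  have "E z2 = (\<lambda>w. \<nu> * w + 0) ` E z1" using assms(8) by simp
  from fibre_rigidity[OF assms(1-5) this] obtain e where
    e: "\<And>w. poly (fiber q z2) (\<nu> * w) = u * poly (fiber q z1) w + e"
    "E (poly p z2) = (\<lambda>x. u * x + e) ` E (poly p z1)" unfolding u_def by metis
  have e0: "e = 0"
    using fibre_rigidity[OF good_forward[OF assms(1)] good_forward[OF assms(2)] assms(6,7) u e(2)] by metis
  show "E (poly p z2) = (\<lambda>x. u * x) ` E (poly p z1)" using e(2) e0 by simp
  have "pcompose (fiber q z2) [:0, \<nu>:] = smult u (fiber q z1)"
    by (rule poly_eq_on_infinite[of UNIV]) (use e(1) e0 infinite_UNIV_char_0 in \<open>simp_all add: poly_pcompose mult.commute\<close>)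
  hence "coeff (pcompose (fiber q z2) [:0, \<nu>:]) i = u * poly (coeff q i) z1" by (simp add: coeff_fiber)
  thus "poly (coeff q i) z2 * \<nu> ^ i = u * poly (coeff q i) z1"
    by (simp add: coeff_pcompose_linear coeff_fiber mult.commute)
qed

lemma fib_transform:
  assumes "c1 \<noteq> 0" "(\<lambda>(z, w). (c1 * z + c2, c3 * w + poly c4 z)) ` skew_julia p q = skew_julia p q"
  shows "fib (c1 * z + c2) = (\<lambda>w. c3 * w + poly c4 z) ` fib z"
proof (intro equalityI subsetI)
  fix y assume "y \<in> fib (c1 * z + c2)"
  hence "(c1 * z + c2, y) \<in> (\<lambda>(z, w). (c1 * z + c2, c3 * w + poly c4 z)) ` skew_julia p q"
    unfolding assms(2) by simp
  then obtain x w where "(x, w) \<in> skew_julia p q" "c1 * z + c2 = c1 * x + c2" "y = c3 * w + poly c4 x" by auto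
  thus "y \<in> (\<lambda>w. c3 * w + poly c4 z) ` fib z" using assms(1) by auto
next
  fix y assume "y \<in> (\<lambda>w. c3 * w + poly c4 z) ` fib z"
  then obtain w where w: "(z, w) \<in> skew_julia p q" "y = c3 * w + poly c4 z" by auto
  hence "(c1 * z + c2, y) \<in> (\<lambda>(z, w). (c1 * z + c2, c3 * w + poly c4 z)) ` skew_julia p q" by force
  thus "y \<in> fib (c1 * z + c2)" unfolding assms(2) by simp
qed

lemma good_transform:
  assumes "c3 \<noteq> 0" "fib z' = (\<lambda>w. c3 * w + k) ` fib z" "z \<in> good"
  shows "z' \<in> good" "E z' = (\<lambda>w. c3 * w + k) ` E z"
proof -
  have fz: "fib z = E z" using good_julia[OF assms(3)] by (simp add: fib_eq)
  have "E z \<noteq> {}" using assms(3) by (auto simp: good_def)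
  hence ne: "fib z' \<noteq> {}" unfolding assms(2) fz by simp
  hence zJ: "z' \<in> julia p" by (auto simp: fib_eq split: if_splits)
  show e: "E z' = (\<lambda>w. c3 * w + k) ` E z" using zJ assms(2) fz by (simp add: fib_eq)
  have "compact (E z')" unfolding e
    by (intro compact_continuous_image continuous_intros good_compact[OF assms(3)])
  moreover have "infinite (E z')" unfolding e
    using assms(1,3) by (subst finite_image_iff) (auto simp: good_def intro: inj_onI)
  ultimately show "z' \<in> good" using zJ by (simp add: good_def compact_imp_bounded)
qed

lemma good_limits_transform:
  assumes "c1 \<noteq> 0" "\<And>z. z \<in> good \<Longrightarrow> c1 * z + c2 \<in> good" "z \<in> good_limits"
  shows "c1 * z + c2 \<in> good_limits"
proof -
  have "poly [:c2, c1:] z islimpt good"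
    by (rule islimpt_poly_image) (use assms in \<open>auto simp: good_limits_def add.commute mult.commute\<close>)
  thus ?thesis by (simp add: good_limits_def add.commute mult.commute)
qed

text \<open>
  The first component of a symmetry preserves \<open>good\<close> and hence \<open>good_limits\<close>, where \<open>centred_symmetry\<close> applies.
\<close>

lemma base_symmetry:
  assumes "c1 \<noteq> 0" "c3 \<noteq> 0" "(\<lambda>(z, w). (c1 * z + c2, c3 * w + poly c4 z)) ` skew_julia p q = skew_julia p q"
  shows "c2 = 0" "poly p (c1 * z) = c1 ^ \<delta> * poly p z" "z \<in> good \<Longrightarrow> c1 * z \<in> good"
    "z \<in> good \<Longrightarrow> E (c1 * z) = (\<lambda>w. c3 * w + poly c4 z) ` E z"
proof -
  note ft = fib_transform[OF assms(1,3)]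
  have W1: "c1 * z + c2 \<in> good" if "z \<in> good" for z using good_transform(1)[OF assms(2) ft that] .
  have W2: "(1 / c1) * z + - c2 / c1 \<in> good" if "z \<in> good" for z
  proof -
    let ?z = "(1 / c1) * z + - c2 / c1"
    have cz: "c1 * ?z + c2 = z" using assms(1) by (simp add: field_simps)
    have "fib z = (\<lambda>w. c3 * w + poly c4 ?z) ` fib ?z" using ft[of ?z] unfolding cz .
    hence "fib ?z = (\<lambda>w. (1 / c3) * w + - poly c4 ?z / c3) ` fib z"
      using assms(2) by (simp add: image_image field_simps)
    from good_transform(1)[OF _ this that] show ?thesis using assms(2) by simp
  qed
  have "(\<lambda>z. c1 * z + c2) ` good_limits = good_limits"
  proof (intro equalityI subsetI)
    fix y assume "y \<in> good_limits"
    hence "(1 / c1) * y + - c2 / c1 \<in> good_limits" using good_limits_transform[of "1 / c1" "- c2 / c1"] W2 assms(1) by simp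
    moreover have "y = c1 * ((1 / c1) * y + - c2 / c1) + c2" using assms(1) by (simp add: field_simps)
    ultimately show "y \<in> (\<lambda>z. c1 * z + c2) ` good_limits" by blast
  qed (use good_limits_transform[OF assms(1) W1] in auto)
  note cs = centred_symmetry[OF refl deg_p monic(3) good_limits_props assms(1) this]
  show c2: "c2 = 0" by (rule cs(1))
  show "poly p (c1 * z) = c1 ^ \<delta> * poly p z" by (rule cs(2))
  show "c1 * z \<in> good" if "z \<in> good" using W1[OF that] c2 by simp
  show "E (c1 * z) = (\<lambda>w. c3 * w + poly c4 z) ` E z" if "z \<in> good"
    using good_transform(2)[OF assms(2) ft that] c2 by simp
qed

lemma finite_bad:
  assumes "h \<noteq> 0" "c \<noteq> 0"
  shows "finite {z::complex. poly h (c * z) = 0}"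
proof -
  have "{z. poly h (c * z) = 0} = (\<lambda>z. c * z) -` {x. poly h x = 0}" by auto
  moreover have "finite ((\<lambda>z. c * z) -` {x. poly h x = 0})"
    by (rule finite_vimageI[OF poly_roots_finite[OF assms(1)]]) (use assms(2) in \<open>auto intro: injI\<close>)
  ultimately show ?thesis by simp
qed

lemma finite_bad_poly:
  fixes h :: "complex poly"
  assumes "h \<noteq> 0" "c \<noteq> 0"
  shows "finite {z. poly h (poly (iter_poly p n) (c * z)) = 0}"
proof -
  have "pcompose h (iter_poly p n) \<noteq> 0"
  proof
    assume "pcompose h (iter_poly p n) = 0"
    moreover have "degree (iter_poly p n) \<noteq> 0" using deg_p by (simp add: degree_iter_poly)
    ultimately show False using assms(1) pcompose_eq_0 by blast
  qed
  from finite_bad[OF this assms(2)] show ?thesis by (simp add: poly_pcompose)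
qed

lemma good_generic:
  assumes "finite A"
  shows "infinite (good - A)"
  using good_infinite assms by simp

text \<open>
  The translation part \<open>c4(z)\<close> of the fibre map vanishes over all but finitely many good points \<open>z\<close>.
\<close>

lemma skew_sym_rotations:
  assumes "\<gamma> \<in> skew_sym p q"
  shows "\<exists>\<mu> \<nu>. norm \<mu> = 1 \<and> norm \<nu> = 1 \<and> \<gamma> = rot2 (\<mu>, \<nu>)"
proof -
  obtain c1 c2 c3 c4 where c: "norm c1 = 1" "norm c3 = 1"
    "\<gamma> = (\<lambda>(z, w). (c1 * z + c2, c3 * w + poly c4 z))" "\<gamma> ` skew_julia p q = skew_julia p q"
    using assms unfolding skew_sym_def transforms_def by blast
  have nz: "c1 \<noteq> 0" "c3 \<noteq> 0" using c(1,2) by auto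
  note bs = base_symmetry[OF nz c(4)[unfolded c(3)]]
  have "poly c4 z = 0" if z: "z \<in> good - ({z. poly b (1 * z) = 0} \<union> {z. poly b (c1 * z) = 0})" for z
    using fibre_rigidity[of z "c1 * z", OF _ bs(3) _ _ nz(2) bs(4)] z by auto
  moreover have "infinite (good - ({z. poly b (1 * z) = 0} \<union> {z. poly b (c1 * z) = 0}))"
    by (intro good_generic finite_UnI finite_bad b_nonzero nz) simp
  ultimately have "c4 = 0" by (intro poly_eq_on_infinite[of _ c4 0]) (assumption, simp only: poly_0)
  hence "\<gamma> = rot2 (c1, c3)" using c(3) bs(1) by (auto simp: rot2_def fun_eq_iff)
  thus ?thesis using c by blast
qed

text \<open>
  The group \<open>\<Gamma>\<^sub>f\<close>, as a set of pairs.
\<close>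

definition rotations :: "(complex \<times> complex) set" where
  "rotations = {(\<mu>, \<nu>). norm \<mu> = 1 \<and> norm \<nu> = 1 \<and> (\<forall>z. fib (\<mu> * z) = (\<lambda>w. \<nu> * w) ` fib z)}"

lemma rotations_iff: "(\<mu>, \<nu>) \<in> rotations \<longleftrightarrow> norm \<mu> = 1 \<and> norm \<nu> = 1 \<and> (\<forall>z. fib (\<mu> * z) = (\<lambda>w. \<nu> * w) ` fib z)"
  unfolding rotations_def by simp

lemma rotations_norm:
  assumes "(\<mu>, \<nu>) \<in> rotations"
  shows "norm \<mu> = 1" "norm \<nu> = 1"
  using iffD1[OF rotations_iff assms] by blast+

lemma rotations_fib:
  assumes "(\<mu>, \<nu>) \<in> rotations"
  shows "fib (\<mu> * z) = (\<lambda>w. \<nu> * w) ` fib z"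
  using iffD1[OF rotations_iff assms] by blast

lemma rotations_subset: "rotations \<subseteq> S1 \<times> S1" using rotations_norm by auto

lemma rot2_in_skew_sym:
  assumes "norm \<mu> = 1" "norm \<nu> = 1"
  shows "rot2 (\<mu>, \<nu>) \<in> skew_sym p q \<longleftrightarrow> (\<mu>, \<nu>) \<in> rotations"
proof
  have nz: "\<mu> \<noteq> 0" "\<nu> \<noteq> 0" using assms by auto
  {
    assume "rot2 (\<mu>, \<nu>) \<in> skew_sym p q"
    hence "(\<lambda>(z, w). (\<mu> * z + 0, \<nu> * w + poly 0 z)) ` skew_julia p q = skew_julia p q"
      by (simp add: skew_sym_def rot2_def)
    from fib_transform[OF nz(1) this] show "(\<mu>, \<nu>) \<in> rotations" unfolding rotations_iff using assms by simp
  next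
    assume h: "(\<mu>, \<nu>) \<in> rotations"
    have "rot2 (\<mu>, \<nu>) ` skew_julia p q = skew_julia p q"
    proof (intro equalityI subsetI)
      fix x assume "x \<in> rot2 (\<mu>, \<nu>) ` skew_julia p q"
      then obtain z w where "w \<in> fib z" "x = (\<mu> * z, \<nu> * w)" by (auto simp: rot2_def)
      hence "\<nu> * w \<in> fib (\<mu> * z)" unfolding rotations_fib[OF h] by blast
      thus "x \<in> skew_julia p q" using \<open>x = (\<mu> * z, \<nu> * w)\<close> by simp
    next
      fix x assume x: "x \<in> skew_julia p q"
      obtain z w where zw: "x = (z, w)" by (cases x)
      have "fib (\<mu> * (z / \<mu>)) = (\<lambda>w. \<nu> * w) ` fib (z / \<mu>)" by (rule rotations_fib[OF h])
      hence "fib z = (\<lambda>w. \<nu> * w) ` fib (z / \<mu>)" using nz by simp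
      then obtain w' where "w' \<in> fib (z / \<mu>)" "w = \<nu> * w'" using x zw by blast
      hence "(z / \<mu>, w') \<in> skew_julia p q" "x = rot2 (\<mu>, \<nu>) (z / \<mu>, w')" using nz zw by (auto simp: rot2_def)
      thus "x \<in> rot2 (\<mu>, \<nu>) ` skew_julia p q" by blast
    qed
    moreover have "rot2 (\<mu>, \<nu>) \<in> transforms" unfolding transforms_def
      using assms by (intro CollectI exI[of _ \<mu>] exI[of _ 0] exI[of _ \<nu>] exI[of _ 0]) (auto simp: rot2_def)
    ultimately show "rot2 (\<mu>, \<nu>) \<in> skew_sym p q" by (simp add: skew_sym_def)
  }
qed

lemma skew_sym_eq: "skew_sym p q = rot2 ` rotations"
proof (intro equalityI subsetI)
  fix \<gamma> assume g: "\<gamma> \<in> skew_sym p q"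
  then obtain \<mu> \<nu> where "norm \<mu> = 1" "norm \<nu> = 1" "\<gamma> = rot2 (\<mu>, \<nu>)" using skew_sym_rotations by blast
  thus "\<gamma> \<in> rot2 ` rotations" using g rot2_in_skew_sym by blast
next
  fix \<gamma> assume "\<gamma> \<in> rot2 ` rotations"
  then obtain \<mu> \<nu> where h: "(\<mu>, \<nu>) \<in> rotations" "\<gamma> = rot2 (\<mu>, \<nu>)" by auto
  moreover note rotations_norm[OF h(1)]
  ultimately show "\<gamma> \<in> skew_sym p q" using rot2_in_skew_sym by blast
qed

lemma inj_rot2: "inj rot2"
proof (rule injI)
  fix x y assume "rot2 x = rot2 y"
  hence "rot2 x (1, 1) = rot2 y (1, 1)" by simp
  thus "x = y" by (simp add: rot2_def split: prod.splits)
qed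

lemma skew_sym_eq_iff: "skew_sym p q = rot2 ` A \<longleftrightarrow> rotations = A"
  unfolding skew_sym_eq by (rule inj_image_eq_iff[OF inj_rot2])

lemma rotations_facts:
  assumes "(\<mu>, \<nu>) \<in> rotations"
  shows "\<mu> \<noteq> 0" "\<nu> \<noteq> 0" "poly p (\<mu> * z) = \<mu> ^ \<delta> * poly p z" "z \<in> good \<Longrightarrow> \<mu> * z \<in> good"
    "z \<in> good \<Longrightarrow> E (\<mu> * z) = (\<lambda>w. \<nu> * w) ` E z"
proof -
  note n1 = rotations_norm[OF assms]
  show nz: "\<mu> \<noteq> 0" "\<nu> \<noteq> 0" using n1 by auto
  have "rot2 (\<mu>, \<nu>) \<in> skew_sym p q" using rot2_in_skew_sym[OF n1] assms by simp
  hence "(\<lambda>(z, w). (\<mu> * z + 0, \<nu> * w + poly 0 z)) ` skew_julia p q = skew_julia p q"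
    by (simp add: skew_sym_def rot2_def)
  note bs = base_symmetry[OF nz this]
  show "poly p (\<mu> * z) = \<mu> ^ \<delta> * poly p z" "z \<in> good \<Longrightarrow> \<mu> * z \<in> good"
    "z \<in> good \<Longrightarrow> E (\<mu> * z) = (\<lambda>w. \<nu> * w) ` E z" using bs(2-4) by simp_all
qed

lemma rotations_power:
  assumes "(\<mu>, \<nu>) \<in> rotations"
  shows "(\<mu> ^ n, \<nu> ^ n) \<in> rotations"
proof -
  note n1 = rotations_norm[OF assms]
  have "fib (\<mu> ^ n * z) = (\<lambda>w. \<nu> ^ n * w) ` fib z" for z
  proof (induction n)
    case (Suc n)
    have "fib (\<mu> * (\<mu> ^ n * z)) = (\<lambda>w. \<nu> * w) ` fib (\<mu> ^ n * z)" by (rule rotations_fib[OF assms])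
    thus ?case unfolding Suc by (simp add: image_image mult.assoc)
  qed simp
  thus ?thesis unfolding rotations_iff using n1 by (simp add: norm_power)
qed

text \<open>
  The identity holds over generic good points by \<open>fibre_rigidity_centred\<close>, so it is an identity of polynomials.
\<close>

lemma rotations_coeff:
  assumes h: "(\<mu>, \<nu>) \<in> rotations"
  shows "poly b z * poly (coeff q i) (\<mu> * z) * \<nu> ^ i = \<nu> ^ d * poly b (\<mu> * z) * poly (coeff q i) z"
proof -
  note hf = rotations_facts[OF h]
  let ?B = "\<lambda>n c. {z. poly b (poly (iter_poly p n) (c * z)) = 0}"
  \<comment> \<open>roots of \<open>b\<close> among \<open>z\<close>, \<open>\<mu>z\<close>, \<open>p(z)\<close> and \<open>p(\<mu>z)\<close> are excluded\<close>
  let ?A = "?B 0 1 \<union> ?B 0 \<mu> \<union> ?B 1 1 \<union> ?B 1 \<mu>"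
  let ?P = "smult (\<nu> ^ i) (b * pcompose (coeff q i) [:0, \<mu>:])"
  let ?R = "smult (\<nu> ^ d) (pcompose b [:0, \<mu>:] * coeff q i)"
  have "?P = ?R"
  proof (rule poly_eq_on_infinite)
    show "infinite (good - ?A)" by (intro good_generic finite_UnI finite_bad_poly b_nonzero hf(1)) simp_all
    fix z assume z: "z \<in> good - ?A"
    hence nb: "poly b z \<noteq> 0" "poly b (\<mu> * z) \<noteq> 0" "poly b (poly p z) \<noteq> 0" "poly b (poly p (\<mu> * z)) \<noteq> 0"
      by (auto simp: poly_pcompose)
    have zW: "z \<in> good" using z by simp
    have "poly (coeff q i) (\<mu> * z) * \<nu> ^ i = \<nu> ^ d * poly b (\<mu> * z) / poly b z * poly (coeff q i) z"
      by (rule fibre_rigidity_centred(3)[OF zW hf(4)[OF zW] nb(1,2) hf(2) nb(3,4) hf(5)[OF zW]])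
    thus "poly ?P z = poly ?R z" using nb(1) by (simp add: poly_pcompose field_simps mult.commute)
  qed
  hence "poly ?P z = poly ?R z" by simp
  thus ?thesis by (simp add: poly_pcompose mult_ac)
qed

text \<open>
  Over \<open>p(z)\<close>, the sets are related by the factor \<open>u = \<nu>\<^sup>d b(\<mu>z) / b(z)\<close>, and the coefficients change as for a
  symmetry with second component \<open>u\<close>. The symmetry \<open>(\<mu>\<^sup>\<delta>, \<nu>\<^sup>\<delta>)\<close> has the same first component over \<open>p(z)\<close>. Comparing the
  coefficients of degree \<open>i\<close> gives \<open>u\<^bsup>d-i\<^esup> = \<nu>\<^bsup>\<delta>(d-i)\<^esup>\<close>.
\<close>

lemma rotations_lead_coeff:
  assumes h: "(\<mu>, \<nu>) \<in> rotations" and i: "i \<le> d" "coeff q i \<noteq> 0"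
  shows "(\<nu> ^ d * poly b (\<mu> * z)) ^ (d - i) = \<nu> ^ (\<delta> * (d - i)) * poly b z ^ (d - i)"
proof -
  note hf = rotations_facts[OF h]
  let ?B = "\<lambda>h n c. {z. poly h (poly (iter_poly p n) (c * z)) = 0}"
  \<comment> \<open>here the orbits of \<open>z\<close> and \<open>\<mu>z\<close> have to avoid the roots of \<open>b\<close> for one step more\<close>
  let ?A = "?B b 0 1 \<union> ?B b 0 \<mu> \<union> ?B b 1 1 \<union> ?B b 1 \<mu> \<union> ?B b 2 1 \<union> ?B b 2 \<mu> \<union> ?B (coeff q i) 1 1"
  let ?P = "smult (\<nu> ^ (d * (d - i))) (pcompose b [:0, \<mu>:] ^ (d - i))"
  let ?R = "smult (\<nu> ^ (\<delta> * (d - i))) (b ^ (d - i))"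
  have "?P = ?R"
  proof (rule poly_eq_on_infinite)
    show "infinite (good - ?A)" by (intro good_generic finite_UnI finite_bad_poly b_nonzero hf(1) i(2)) simp_all
    fix z assume z: "z \<in> good - ?A"
    hence nb: "poly b z \<noteq> 0" "poly b (\<mu> * z) \<noteq> 0" "poly b (poly p z) \<noteq> 0" "poly b (poly p (\<mu> * z)) \<noteq> 0"
      "poly b (poly p (poly p z)) \<noteq> 0" "poly b (poly p (poly p (\<mu> * z))) \<noteq> 0" "poly (coeff q i) (poly p z) \<noteq> 0"
      by (auto simp: poly_pcompose numeral_2_eq_2)
    have zW: "z \<in> good" using z by simp
    define u where "u = \<nu> ^ d * poly b (\<mu> * z) / poly b z"
    note f1 = fibre_rigidity_centred[OF zW hf(4)[OF zW] nb(1,2) hf(2) nb(3,4) hf(5)[OF zW], folded u_def]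
    define X where "X = poly b (poly p z) * poly (coeff q i) (poly p (\<mu> * z))"
    define X' where "X' = poly b (poly p (\<mu> * z)) * poly (coeff q i) (poly p z)"
    have "poly (coeff q i) (poly p (\<mu> * z)) * u ^ i =
        u ^ d * poly b (poly p (\<mu> * z)) / poly b (poly p z) * poly (coeff q i) (poly p z)"
      by (rule fibre_rigidity_centred(3)[OF good_forward[OF zW] good_forward[OF hf(4)[OF zW]] nb(3,4) f1(1) nb(5,6) f1(2)])
    hence e1: "X * u ^ i = X' * u ^ d" using nb(3) by (simp add: X_def X'_def field_simps)
    have e2: "X * (\<nu> ^ \<delta>) ^ i = X' * (\<nu> ^ \<delta>) ^ d"
      using rotations_coeff[OF rotations_power[OF h, of \<delta>], of "poly p z" i] hf(3)[of z] by (simp add: X_def X'_def mult_ac)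
    have X'0: "X' \<noteq> 0" using nb by (simp add: X'_def)
    have split: "x ^ d = x ^ i * x ^ (d - i)" for x :: complex using i(1) by (simp flip: power_add)
    have "X = X' * u ^ (d - i)" using e1 f1(1) unfolding split[of u] by (simp add: mult_ac)
    moreover have "X = X' * (\<nu> ^ \<delta>) ^ (d - i)" using e2 hf(2) unfolding split[of "\<nu> ^ \<delta>"] by (simp add: mult_ac)
    ultimately have "u ^ (d - i) = (\<nu> ^ \<delta>) ^ (d - i)" using X'0 by simp
    hence "(\<nu> ^ d * poly b (\<mu> * z)) ^ (d - i) = (\<nu> ^ \<delta>) ^ (d - i) * poly b z ^ (d - i)"
      using nb(1) by (simp add: u_def power_divide field_simps)
    thus "poly ?P z = poly ?R z" by (simp add: poly_pcompose power_mult_distrib power_mult mult_ac)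
  qed
  hence "poly ?P z = poly ?R z" by simp
  thus ?thesis by (simp add: poly_pcompose power_mult_distrib power_mult mult_ac)
qed

lemma base_monomial:
  assumes "infinite (fst ` rotations)"
  shows "p = monom 1 \<delta>"
proof -
  have "p = monom (lead_coeff p) \<delta>"
  proof (rule monom_if_roots_invariant[OF assms])
    fix \<mu> z assume "\<mu> \<in> fst ` rotations" "poly p z = 0"
    thus "poly p (\<mu> * z) = 0" using rotations_facts(3) by force
  qed
  thus ?thesis using monic(1) by simp
qed

text \<open>
  \<open>rotations_lead_coeff\<close> and then \<open>rotations_coeff\<close> show that the roots of \<open>b\<close> and of the other coefficients are
  invariant under infinitely many rotations, so all coefficients are monomials. The relations between \<open>\<mu>\<close> and \<open>\<nu>\<close>
  that remain are monomial ones; they hold for infinitely many \<open>\<mu>\<close>, so the exponents agree. The weights are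
  \<open>N = d - i0\<close> and \<open>k = m - l\<close>, where \<open>m\<close> and \<open>l\<close> are the exponents of the coefficients of degree \<open>i0\<close> and \<open>d\<close>.
\<close>

theorem infinite_base_symmetries:
  assumes inf: "infinite (fst ` rotations)" and i0: "i0 < d" "coeff q i0 \<noteq> 0"
  shows "\<And>i. coeff q i = monom (lead_coeff (coeff q i)) (degree (coeff q i))"
    "\<exists>N>0. \<exists>k. (\<forall>i. coeff q i \<noteq> 0 \<longrightarrow> N * int (degree (coeff q i)) + k * int i = k * int \<delta>) \<and>
      (\<forall>(\<mu>, \<nu>)\<in>rotations. \<nu> powi N = \<mu> powi k)"
proof -
  have bm: "b = monom (lead_coeff b) (degree b)"
  proof (rule monom_if_roots_invariant[OF inf])
    fix \<mu> z assume m: "\<mu> \<in> fst ` rotations" "poly b z = 0"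
    then obtain \<nu> where h: "(\<mu>, \<nu>) \<in> rotations" by auto
    have "(\<nu> ^ d * poly b (\<mu> * z)) ^ (d - i0) = 0"
      using rotations_lead_coeff[OF h _ i0(2), of z] i0(1) m(2) by (simp add: power_0_left)
    thus "poly b (\<mu> * z) = 0" using rotations_facts(2)[OF h] by simp
  qed
  hence bz: "poly b z = z ^ degree b" for z using monic(2) by (metis poly_monom mult_1)
  show cm: "coeff q i = monom (lead_coeff (coeff q i)) (degree (coeff q i))" for i
  proof (rule monom_if_roots_invariant[OF inf])
    fix \<mu> z assume m: "\<mu> \<in> fst ` rotations" "z \<noteq> 0" "poly (coeff q i) z = 0"
    then obtain \<nu> where h: "(\<mu>, \<nu>) \<in> rotations" by auto
    show "poly (coeff q i) (\<mu> * z) = 0"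
      using rotations_coeff[OF h, of z i] m(2,3) rotations_facts(2)[OF h] by (simp add: bz)
  qed
  define l where "l = int (degree b)"
  define m where "m i = int (degree (coeff q i))" for i
  have rel: "\<nu> powi int i * \<mu> powi m i = \<nu> powi int d * \<mu> powi l" if h: "(\<mu>, \<nu>) \<in> rotations" "coeff q i \<noteq> 0" for \<mu> \<nu> i
  proof -
    have cp: "poly (coeff q i) x = lead_coeff (coeff q i) * x ^ degree (coeff q i)" for x
      using cm[of i] by (metis poly_monom)
    have "lead_coeff (coeff q i) * (\<mu> ^ degree (coeff q i) * \<nu> ^ i) = lead_coeff (coeff q i) * (\<nu> ^ d * \<mu> ^ degree b)"
      using rotations_coeff[OF h(1), of 1 i] by (simp add: bz cp mult_ac)
    thus ?thesis using h(2) by (simp add: m_def l_def mult_ac)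
  qed
  define N where "N = int d - int i0"
  define k where "k = m i0 - l"
  have N0: "N > 0" using i0(1) by (simp add: N_def)
  have Nk: "\<nu> powi N = \<mu> powi k" if h: "(\<mu>, \<nu>) \<in> rotations" for \<mu> \<nu>
    using rel[OF h i0(2)] rotations_facts(1,2)[OF h] by (simp add: N_def k_def power_int_diff field_simps)
  have main: "N * l + k * int d = k * int \<delta>"
  proof -
    have "\<mu> powi (N * l + k * int d - k * int \<delta>) = 1" if "\<mu> \<in> fst ` rotations" for \<mu>
    proof -
      obtain \<nu> where h: "(\<mu>, \<nu>) \<in> rotations" using \<open>\<mu> \<in> fst ` rotations\<close> by auto
      note nz = rotations_facts(1,2)[OF h]
      have Nn: "N = int (d - i0)" using i0(1) by (simp add: N_def)
      have "(\<nu> ^ d * \<mu> ^ degree b) ^ (d - i0) = \<nu> ^ (\<delta> * (d - i0))"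
        using rotations_lead_coeff[OF h less_imp_le[OF i0(1)] i0(2), of 1] by (simp add: bz)
      hence "(\<nu> ^ (d - i0)) ^ d * \<mu> ^ (degree b * (d - i0)) = (\<nu> ^ (d - i0)) ^ \<delta>"
        by (simp add: power_mult_distrib mult_ac flip: power_mult)
      moreover have "\<nu> ^ (d - i0) = \<mu> powi k" using Nk[OF h] by (simp add: Nn)
      ultimately have "(\<mu> powi k) ^ d * \<mu> ^ (degree b * (d - i0)) = (\<mu> powi k) ^ \<delta>" by simp
      hence "\<mu> powi (k * int d) * \<mu> powi (l * N) = \<mu> powi (k * int \<delta>)"
        by (simp add: power_int_mult l_def Nn flip: power_int_of_nat)
      thus ?thesis using nz by (simp add: power_int_diff power_int_add field_simps)
    qed
    hence "N * l + k * int d - k * int \<delta> = 0"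
      by (intro infinite_powers_one[OF inf]) (use rotations_facts(1) in force)
    thus ?thesis by simp
  qed
  have "N * m i + k * int i = k * int \<delta>" if i: "coeff q i \<noteq> 0" for i
  proof -
    have "\<mu> powi (N * m i + k * int i - k * int \<delta>) = 1" if "\<mu> \<in> fst ` rotations" for \<mu>
    proof -
      obtain \<nu> where h: "(\<mu>, \<nu>) \<in> rotations" using \<open>\<mu> \<in> fst ` rotations\<close> by auto
      note nz = rotations_facts(1,2)[OF h]
      have "(\<nu> powi int i * \<mu> powi m i) powi N = (\<nu> powi int d * \<mu> powi l) powi N" using rel[OF h i] by simp
      hence "(\<nu> powi N) powi int i * \<mu> powi (N * m i) = (\<nu> powi N) powi int d * \<mu> powi (N * l)"
        by (simp only: power_int_mult_distrib mult_ac flip: power_int_mult)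
      hence "\<mu> powi (k * int i) * \<mu> powi (N * m i) = \<mu> powi (k * int d) * \<mu> powi (N * l)"
        unfolding Nk[OF h] power_int_mult[symmetric] .
      hence "\<mu> powi (k * int i + N * m i) = \<mu> powi (k * int d + N * l)" using nz by (simp add: power_int_add)
      also have "k * int d + N * l = k * int \<delta>" using main by simp
      finally show ?thesis using nz by (simp add: power_int_diff add.commute)
    qed
    hence "N * m i + k * int i - k * int \<delta> = 0"
      by (intro infinite_powers_one[OF inf]) (use rotations_facts(1) in force)
    thus ?thesis by simp
  qed
  thus "\<exists>N>0. \<exists>k. (\<forall>i. coeff q i \<noteq> 0 \<longrightarrow> N * int (degree (coeff q i)) + k * int i = k * int \<delta>) \<and>
      (\<forall>(\<mu>, \<nu>)\<in>rotations. \<nu> powi N = \<mu> powi k)"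
    using N0 Nk unfolding m_def by blast
qed

end

section \<open>Maps with weighted homogeneous coefficients\<close>

lemma powi_surj:
  fixes x :: complex
  assumes "r \<noteq> 0" "x \<noteq> 0"
  shows "\<exists>y. y \<noteq> 0 \<and> y powi r = x \<and> (norm x = 1 \<longrightarrow> norm y = 1)"
proof -
  define n where "n = nat \<bar>r\<bar>"
  have n: "n \<ge> 1" using assms(1) by (simp add: n_def)
  obtain y where y: "y ^ n = x"
    using poly_surj[of "monom 1 n" x] n by (auto simp: degree_monom_eq poly_monom)
  have y0: "y \<noteq> 0" using y assms(2) n by (auto simp: power_0_left)
  have ny: "norm y = 1" if "norm x = 1"
  proof (rule power_eq_imp_eq_base)
    show "norm y ^ n = 1 ^ n" using that y by (metis norm_power power_one)
  qed (use n in auto)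
  show ?thesis
  proof (cases "r > 0")
    case True
    thus ?thesis using y y0 ny by (intro exI[of _ y]) (simp add: power_int_def n_def)
  next
    case False
    thus ?thesis using y y0 ny assms(1)
      by (intro exI[of _ "inverse y"]) (simp add: power_int_def n_def norm_inverse)
  qed
qed

lemma norm_powi_one: "norm (t::complex) = 1 \<Longrightarrow> norm (t powi k) = 1"
  by (simp add: norm_power_int)

lemma infinite_S1: "infinite S1"
proof -
  have "{0..1} \<subseteq> Re ` S1"
  proof
    fix x :: real assume "x \<in> {0..1}"
    hence "x\<^sup>2 \<le> 1" by (simp add: power_le_one)
    hence "Complex x (sqrt (1 - x\<^sup>2)) \<in> S1" by (simp add: cmod_def)
    hence "Re (Complex x (sqrt (1 - x\<^sup>2))) \<in> Re ` S1" by (rule imageI)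
    thus "x \<in> Re ` S1" by simp
  qed
  moreover have "infinite {0..1::real}" by (simp add: infinite_Icc)
  ultimately show ?thesis by (meson finite_imageI finite_subset)
qed

lemma powi_one_on_circle:
  assumes "\<And>t. norm t = 1 \<Longrightarrow> (t::complex) powi n = 1"
  shows "n = 0"
  by (rule infinite_powers_one[OF infinite_S1]) (use assms in auto)

lemma filled_julia_monom:
  assumes "n \<ge> 2"
  shows "filled_julia (monom 1 n) = cball 0 1" "julia (monom 1 n) = S1"
proof -
  have orb: "(poly (monom 1 n) ^^ k) z = z ^ (n ^ k)" for k and z :: complex
    by (induction k) (simp_all add: poly_monom mult.commute flip: power_mult)
  show 1: "filled_julia (monom 1 n) = cball 0 1"
  proof (intro equalityI subsetI)
    fix z :: complex assume "z \<in> cball 0 1"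
    hence "norm ((poly (monom 1 n) ^^ k) z) \<le> 1" for k
      by (simp add: orb norm_power power_le_one)
    thus "z \<in> filled_julia (monom 1 n)" by (rule filled_juliaI)
  next
    fix z :: complex assume "z \<in> filled_julia (monom 1 n)"
    then obtain B where B: "\<And>k. norm ((poly (monom 1 n) ^^ k) z) \<le> B" using filled_juliaD by blast
    show "z \<in> cball 0 1"
    proof (rule ccontr)
      assume "z \<notin> cball 0 1"
      hence z: "norm z > 1" by simp
      then obtain k where k: "B < norm z ^ k" using real_arch_pow by blast
      have "k < 2 ^ k" by simp
      also have "(2::nat) ^ k \<le> n ^ k" using assms by (intro power_mono) auto
      finally have "norm z ^ k \<le> norm z ^ (n ^ k)" using z by (intro power_increasing) auto
      thus False using B[of k] k by (simp add: orb norm_power)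
    qed
  qed
  show "julia (monom 1 n) = S1" unfolding julia_def 1 by (rule frontier_cball)
qed

text \<open>
  \<open>P\<close> maps the infinite set \<open>julia P\<close> into the circle, so \<open>|P| = 1\<close> on the circle and \<open>P\<close> is a monomial.
\<close>

lemma julia_subset_circle:
  assumes "degree P \<ge> 2" "julia P \<subseteq> S1"
  shows "julia P = S1"
proof -
  note jf = julia_facts[OF assms(1)]
  have on: "norm (poly P z) = 1" if "z \<in> julia P" for z
    using jf(3) assms(2) that by (metis mem_sphere_0 subsetD vimageD)
  note m = monom_if_norm_constant_on_circle[OF jf(2) assms(2) on]
  define c where "c = lead_coeff P"
  have c: "norm c = 1" "P = monom c (degree P)" using m by (simp_all add: c_def)
  have "norm ((poly P ^^ k) z) = norm ((poly (monom 1 (degree P)) ^^ k) z)" for k z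
  proof (induction k)
    case (Suc k)
    have "norm (poly P x) = norm x ^ degree P" for x
      by (subst c(2)) (simp add: poly_monom norm_mult norm_power c(1))
    thus ?case using Suc by (simp add: poly_monom norm_power)
  qed simp
  hence "filled_julia P = filled_julia (monom 1 (degree P))"
    unfolding filled_julia_def bounded_iff by force
  thus ?thesis using filled_julia_monom[OF assms(1)] by (simp add: julia_def)
qed

context skew_normal
begin

text \<open>
  When \<open>z\<close> has weight \<open>r\<close> and \<open>w\<close> has weight \<open>s\<close>, every term of \<open>q\<close> has weight \<open>s \<delta>\<close>; so
  \<open>q(t\<^sup>r z, t\<^sup>s w) = t\<^bsup>s\<delta>\<^esup> q(z, w)\<close>. The weights \<open>1\<close> and \<open>0\<close> characterise maps that do not depend on \<open>z\<close>.
\<close>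

definition weighted :: "int \<Rightarrow> int \<Rightarrow> bool" where
  "weighted r s \<longleftrightarrow> (\<forall>i. coeff q i \<noteq> 0 \<longrightarrow>
     coeff q i = monom (lead_coeff (coeff q i)) (degree (coeff q i)) \<and>
     r * int (degree (coeff q i)) + s * int i = s * int \<delta>)"

lemma weightedD:
  assumes "weighted r s"
  shows "poly (coeff q i) x = lead_coeff (coeff q i) * x ^ degree (coeff q i)"
    "coeff q i \<noteq> 0 \<Longrightarrow> r * int (degree (coeff q i)) + s * int i = s * int \<delta>"
proof -
  have "coeff q i = monom (lead_coeff (coeff q i)) (degree (coeff q i))"
    using assms unfolding weighted_def by (cases "coeff q i = 0") auto
  thus "poly (coeff q i) x = lead_coeff (coeff q i) * x ^ degree (coeff q i)" by (metis poly_monom)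
qed (use assms in \<open>simp add: weighted_def\<close>)

lemma weighted_b:
  assumes "weighted r s"
  shows "b = monom 1 (degree b)" "r * int (degree b) + s * int d = s * int \<delta>"
  using assms b_nonzero monic(2) unfolding weighted_def by metis+

lemma exists_lower_coeff:
  assumes "q \<noteq> monom b d"
  shows "\<exists>i<d. coeff q i \<noteq> 0"
proof (rule ccontr)
  assume "\<not> ?thesis"
  hence "coeff q i = coeff (monom b d) i" for i by (cases i d rule: linorder_cases) (auto simp: coeff_eq_0)
  thus False using assms by (simp add: poly_eq_iff)
qed

lemma weighted_semiconj:
  assumes "weighted r s" "z \<noteq> 0"
  shows "poly (fiber q (z powi r)) (z powi s * w) = (z ^ \<delta>) powi s * poly (fiber q 1) w"
proof -
  have "poly (coeff q i) (z powi r) * (z powi s * w) ^ i = (z ^ \<delta>) powi s * (poly (coeff q i) 1 * w ^ i)" for i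
  proof (cases "coeff q i = 0")
    case False
    have "(z powi r) ^ degree (coeff q i) * (z powi s) ^ i = z powi (r * int (degree (coeff q i)) + s * int i)"
      using assms(2) by (simp add: power_int_add power_int_mult)
    also have "\<dots> = (z ^ \<delta>) powi s"
      unfolding weightedD(2)[OF assms(1) False] by (simp add: mult.commute[of s] power_int_mult)
    finally show ?thesis unfolding weightedD(1)[OF assms(1)] by (simp add: power_mult_distrib mult_ac)
  qed simp
  thus ?thesis unfolding poly_fiber by (simp add: sum_distrib_left)
qed

text \<open>
  The semiconjugacy compares \<open>b\<^sub>i(z\<^sup>r)\<close> with a power of \<open>z\<close>, which makes \<open>b\<^sub>i\<close> a monomial since \<open>z\<^sup>r\<close> takes every
  nonzero value.
\<close>

lemma map_iv_iff:
  "map_iv p q r s \<longleftrightarrow> p = monom 1 \<delta> \<and> q \<noteq> monom b d \<and> r \<noteq> 0 \<and> s \<noteq> 0 \<and> coprime r s \<and> weighted r s"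
proof (intro iffI conjI)
  assume m: "map_iv p q r s"
  show a: "p = monom 1 \<delta>" "q \<noteq> monom b d" "r \<noteq> 0" "s \<noteq> 0" "coprime r s" using m by (simp_all add: map_iv_def)
  have sc: "poly (fiber q (z powi r)) (z powi s * w) = (z ^ \<delta>) powi s * poly (fiber q 1) w" if "z \<noteq> 0" for z w
    using m that unfolding map_iv_def semiconj_by_def skew_def Let_def by auto
  have co: "poly (coeff q i) (z powi r) * z powi (s * int i) = z powi (s * int \<delta>) * poly (coeff q i) 1" if z: "z \<noteq> 0" for z i
  proof -
    have "pcompose (fiber q (z powi r)) [:0, z powi s:] = smult ((z ^ \<delta>) powi s) (fiber q 1)"
      by (rule poly_eq_on_infinite[of UNIV])
        (use sc[OF z] infinite_UNIV_char_0 in \<open>simp_all add: poly_pcompose mult.commute\<close>)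
    hence "coeff (pcompose (fiber q (z powi r)) [:0, z powi s:]) i = (z ^ \<delta>) powi s * poly (coeff q i) 1"
      by (simp add: coeff_fiber)
    moreover have "(z ^ \<delta>) powi s = z powi (s * int \<delta>)" by (simp add: mult.commute[of s] power_int_mult)
    ultimately show ?thesis by (simp add: coeff_pcompose_linear coeff_fiber power_int_mult mult.commute)
  qed
  show "weighted r s" unfolding weighted_def
  proof (intro allI impI)
    fix i assume i: "coeff q i \<noteq> 0"
    let ?h = "coeff q i"
    have h1: "poly ?h 1 \<noteq> 0"
    proof
      assume 0: "poly ?h 1 = 0"
      have "?h = 0"
      proof (rule poly_eq_on_infinite[of "UNIV - {0}"])
        show "infinite (UNIV - {0::complex})" using infinite_UNIV_char_0 by simp
        fix x :: complex assume "x \<in> UNIV - {0}"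
        then obtain y where y: "y \<noteq> 0" "y powi r = x" using powi_surj[OF a(3), of x] by auto
        thus "poly ?h x = poly 0 x" using co[OF y(1), of i] 0 by simp
      qed
      thus False using i by simp
    qed
    have m: "?h = monom (lead_coeff ?h) (degree ?h)"
    proof (rule monom_if_no_nonzero_root[OF i], rule ccontr)
      fix x assume x: "poly ?h x = 0" "x \<noteq> 0"
      then obtain y where y: "y \<noteq> 0" "y powi r = x" using powi_surj[OF a(3), of x] by auto
      thus False using co[OF y(1), of i] x h1 by simp
    qed
    hence hx: "poly ?h x = lead_coeff ?h * x ^ degree ?h" for x by (metis poly_monom)
    have zz: "z powi (r * int (degree ?h) + s * int i - s * int \<delta>) = 1" if z: "z \<noteq> 0" for z :: complex
    proof -
      have "z powi (r * int (degree ?h)) * z powi (s * int i) = z powi (s * int \<delta>)"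
        using co[OF z, of i] i unfolding hx by (simp add: power_int_mult)
      thus ?thesis using z by (simp add: power_int_add power_int_diff)
    qed
    have "r * int (degree ?h) + s * int i - s * int \<delta> = 0"
      by (rule powi_one_on_circle, rule zz) auto
    thus "?h = monom (lead_coeff ?h) (degree ?h) \<and> r * int (degree ?h) + s * int i = s * int \<delta>" using m by simp
  qed
next
  assume m: "p = monom 1 \<delta> \<and> q \<noteq> monom b d \<and> r \<noteq> 0 \<and> s \<noteq> 0 \<and> coprime r s \<and> weighted r s"
  have pz: "poly p x = x ^ \<delta>" for x using m by (metis poly_monom mult_1)
  show "map_iv p q r s" unfolding map_iv_def semiconj_by_def skew_def Let_def
    using m weighted_semiconj[of r s] by (auto simp: pz power_int_power' power_int_power mult.commute)
qed

lemma weights_of_map_iv: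
  assumes "map_iv p q r s"
  shows "degree b = 0 \<Longrightarrow> \<delta> = d \<and> real_of_int s / real_of_int r > 0"
    "degree b \<noteq> 0 \<Longrightarrow> \<delta> \<noteq> d \<and> real_of_int s / real_of_int r = real (degree b) / (real \<delta> - real d)"
proof -
  have a: "q \<noteq> monom b d" "r \<noteq> 0" "s \<noteq> 0" and w: "weighted r s"
    using assms by (simp_all add: map_iv_iff)
  note wb = weighted_b(2)[OF w]
  {
    assume l: "degree b = 0"
    have \<delta>d: "\<delta> = d" using wb l a(3) by simp
    obtain i where i: "i < d" "coeff q i \<noteq> 0" using exists_lower_coeff[OF a(1)] by blast
    let ?m = "degree (coeff q i)"
    have "r * int ?m + s * int i = s * int d" using weightedD(2)[OF w i(2)] \<delta>d by simp
    hence e: "r * int ?m = s * (int d - int i)" by (simp add: algebra_simps)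
    hence "real_of_int (r * int ?m) = real_of_int (s * (int d - int i))" by simp
    hence e': "real_of_int s / real_of_int r = real ?m / (real d - real i)"
      using a(2) i(1) by (simp add: field_simps)
    have "?m \<noteq> 0"
    proof
      assume "?m = 0"
      hence "s * (int d - int i) = 0" using e by simp
      thus False using a(3) i(1) by simp
    qed
    hence "real ?m / (real d - real i) > 0" using i(1) by simp
    thus "\<delta> = d \<and> real_of_int s / real_of_int r > 0" using \<delta>d e' by simp
  }
  {
    assume l: "degree b \<noteq> 0"
    have e: "r * int (degree b) = s * (int \<delta> - int d)" using wb by (simp add: algebra_simps)
    have \<delta>d: "\<delta> \<noteq> d" using e l a(2) by auto
    have "real_of_int (r * int (degree b)) = real_of_int (s * (int \<delta> - int d))" using e by simp
    thus "\<delta> \<noteq> d \<and> real_of_int s / real_of_int r = real (degree b) / (real \<delta> - real d)"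
      using a(2) \<delta>d by (simp add: field_simps)
  }
qed

lemma map_ii_iff:
  "(\<exists>Q. map_ii p q Q) \<longleftrightarrow> p = monom 1 \<delta> \<and> q \<noteq> monom b d \<and> weighted 1 0"
proof (intro iffI conjI)
  assume "\<exists>Q. map_ii p q Q"
  then obtain Q where m: "map_ii p q Q" by blast
  hence pQ: "p = monom 1 \<delta>" "q = map_poly (\<lambda>c. [:c:]) Q" "Q \<noteq> monom 1 d"
    unfolding map_ii_def by blast+
  show "p = monom 1 \<delta>" by fact
  have cq: "coeff q i = [:coeff Q i:]" for i unfolding pQ(2) by (simp add: coeff_map_poly)
  show "weighted 1 0" unfolding weighted_def by (simp add: cq monom_0)
  show "q \<noteq> monom b d"
  proof
    assume e: "q = monom b d"
    have "b = [:coeff Q d:]" by (simp add: cq)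
    moreover have "lead_coeff b = 1" by (rule monic(2))
    ultimately have "coeff Q d = 1" by simp
    moreover have "coeff Q i = 0" if "i \<noteq> d" for i
    proof -
      have "[:coeff Q i:] = coeff (monom b d) i" using cq e by metis
      thus ?thesis using that by simp
    qed
    ultimately have "Q = monom 1 d" by (intro poly_eqI) auto
    thus False using pQ(3) by simp
  qed
next
  assume m: "p = monom 1 \<delta> \<and> q \<noteq> monom b d \<and> weighted 1 0"
  have cq: "coeff q i = [:poly (coeff q i) 1:]" for i
  proof (cases "coeff q i = 0")
    case False
    have "degree (coeff q i) = 0" using weightedD(2)[of 1 0 i] m False by simp
    then obtain c where "coeff q i = [:c:]" by (rule degree_eq_zeroE)
    thus ?thesis by simp
  qed simp
  let ?Q = "fiber q 1"
  have q: "q = map_poly (\<lambda>c. [:c:]) ?Q"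
    by (rule poly_eqI) (subst cq, simp add: coeff_map_poly coeff_fiber)
  have "?Q \<noteq> monom 1 d"
  proof
    assume Q: "?Q = monom 1 d"
    have "q = monom [:1:] d" by (subst q, subst Q) (simp add: map_poly_monom)
    moreover from this have "b = [:1:]" by (metis lead_coeff_monom)
    ultimately show False using m by simp
  qed
  thus "\<exists>Q. map_ii p q Q" using m q by (intro exI[of _ ?Q]) (simp add: map_ii_def)
qed

lemma map_ii_fiber:
  assumes "map_ii p q R"
  shows "fiber q z = R" "degree R = d" "lead_coeff R = 1" "coeff R (d - 1) = 0"
proof -
  have q: "q = map_poly (\<lambda>c. [:c:]) R" using assms by (simp add: map_ii_def)
  show "fiber q z = R" unfolding q by (rule fiber_const)
  have cq: "coeff q i = [:coeff R i:]" for i unfolding q by (simp add: coeff_map_poly)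
  show dQ: "degree R = d" unfolding q by (rule degree_map_poly[symmetric]) simp
  show "lead_coeff R = 1" using monic(2) cq[of d] by (simp add: dQ)
  have "[:coeff R (d - 1):] = 0" using monic(4) cq[of "d - 1"] by metis
  thus "coeff R (d - 1) = 0" by simp
qed

section \<open>The group of rotations that preserve the Julia set\<close>

text \<open>
  A pair with these properties preserves the growth of all orbits, and therefore the Green functions.
\<close>

lemma rotations_intro:
  assumes n: "norm \<mu> = 1" "norm \<nu> = 1" and pm: "\<And>z. poly p (\<mu> * z) = \<mu> ^ \<delta> * poly p z"
    and Qm: "\<And>z k w. z \<in> filled_julia p \<Longrightarrow> norm (Q k (\<mu> * z) (\<nu> * w)) = norm (Q k z w)"
  shows "(\<mu>, \<nu>) \<in> rotations"
proof -
  have nz: "\<mu> \<noteq> 0" "\<nu> \<noteq> 0" using n by auto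
  have "julia p = (\<lambda>z. \<mu> * z) ` julia p" using rotation_preserves_julia(2)[OF n(1) pm] by simp
  hence jul: "\<mu> * z \<in> julia p \<longleftrightarrow> z \<in> julia p" for z
    using nz(1) by (metis (no_types, lifting) image_iff mult_left_cancel)
  have "fib (\<mu> * z) = (\<lambda>w. \<nu> * w) ` fib z" for z
  proof (cases "z \<in> julia p")
    case True
    have gr: "green p q (\<mu> * z) (\<nu> * w) = green p q z w" for w
      unfolding green_def using Qm[OF in_filled[OF True]] by simp
    have "(\<lambda>w. \<nu> * w) ` K z = K (\<mu> * z)"
      by (rule scaling_image_eqI[OF nz(2)]) (simp add: fiber_filled_julia_def gr)
    hence "E (\<mu> * z) = (\<lambda>w. \<nu> * w) ` E z" using frontier_scaling[OF nz(2)] by metis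
    thus ?thesis using True jul by (simp add: fib_eq)
  next
    case False
    thus ?thesis using jul by (simp add: fib_eq)
  qed
  thus ?thesis unfolding rotations_iff using n by blast
qed

lemma rotations_mult:
  assumes "(\<mu>, \<nu>) \<in> rotations" "(\<mu>', \<nu>') \<in> rotations"
  shows "(\<mu> * \<mu>', \<nu> * \<nu>') \<in> rotations"
proof -
  have "fib (\<mu> * (\<mu>' * z)) = (\<lambda>w. \<nu> * \<nu>' * w) ` fib z" for z
    unfolding rotations_fib[OF assms(1)] rotations_fib[OF assms(2)] by (simp add: image_image mult.assoc)
  thus ?thesis unfolding rotations_iff using rotations_norm[OF assms(1)] rotations_norm[OF assms(2)]
    by (simp add: norm_mult mult.assoc)
qed

lemma rotations_one: "(1, 1) \<in> rotations"
  unfolding rotations_iff by simp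

lemma rotations_inverse:
  assumes "(\<mu>, \<nu>) \<in> rotations"
  shows "(inverse \<mu>, inverse \<nu>) \<in> rotations"
proof -
  note nz = rotations_facts(1,2)[OF assms]
  have "fib (inverse \<mu> * z) = (\<lambda>w. inverse \<nu> * w) ` fib z" for z
  proof -
    have "fib z = (\<lambda>w. \<nu> * w) ` fib (inverse \<mu> * z)"
      using rotations_fib[OF assms, of "inverse \<mu> * z"] nz by (simp add: field_simps)
    thus ?thesis using nz by (simp add: image_image field_simps)
  qed
  thus ?thesis unfolding rotations_iff using rotations_norm[OF assms] by (simp add: norm_inverse)
qed

lemma infinite_fst_rotations:
  assumes "r \<noteq> 0" "\<And>t. norm t = 1 \<Longrightarrow> (t powi r, t powi s) \<in> rotations"
  shows "infinite (fst ` rotations)"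
proof -
  have "S1 \<subseteq> fst ` rotations"
  proof
    fix x :: complex assume x: "x \<in> S1"
    hence "x \<noteq> 0" "norm x = 1" by auto
    then obtain t where "t powi r = x" "norm t = 1" using powi_surj[OF assms(1)] by blast
    thus "x \<in> fst ` rotations" using assms(2)[of t] by force
  qed
  thus ?thesis using infinite_S1 finite_subset by blast
qed

text \<open>
  The relation \<open>\<nu>\<^sup>N = \<mu>\<^sup>k\<close> of \<open>infinite_base_symmetries\<close>, on the pairs \<open>(t\<^sup>r, t\<^sup>s)\<close>, forces \<open>(r, s)\<close> to be
  proportional to \<open>(N, k)\<close>.
\<close>

lemma weighted_of_rotations:
  assumes "r \<noteq> 0" "\<And>t. norm t = 1 \<Longrightarrow> (t powi r, t powi s) \<in> rotations" "q \<noteq> monom b d"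
  shows "p = monom 1 \<delta>" "weighted r s"
proof -
  note inf = infinite_fst_rotations[OF assms(1,2)]
  obtain i0 where i0: "i0 < d" "coeff q i0 \<noteq> 0" using exists_lower_coeff[OF assms(3)] by blast
  show "p = monom 1 \<delta>" by (rule base_monomial[OF inf])
  note cm = infinite_base_symmetries(1)[OF inf i0]
  obtain N k where N: "N > 0" "\<And>i. coeff q i \<noteq> 0 \<Longrightarrow> N * int (degree (coeff q i)) + k * int i = k * int \<delta>"
    "\<And>\<mu> \<nu>. (\<mu>, \<nu>) \<in> rotations \<Longrightarrow> \<nu> powi N = \<mu> powi k"
    using infinite_base_symmetries(2)[OF inf i0] by blast
  have "t powi (s * N - r * k) = 1" if t: "norm t = 1" for t :: complex
  proof -
    have t0: "t \<noteq> 0" using t by auto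
    have "t powi (s * N) = t powi (r * k)" using N(3)[OF assms(2)[OF t]] by (simp add: power_int_mult)
    thus ?thesis using t0 by (simp add: power_int_diff)
  qed
  hence "s * N - r * k = 0" by (rule powi_one_on_circle)
  hence sN: "s * N = r * k" by simp
  show "weighted r s" unfolding weighted_def
  proof (intro allI impI conjI cm)
    fix i assume i: "coeff q i \<noteq> 0"
    let ?m = "int (degree (coeff q i))"
    have "N * (r * ?m + s * int i) = r * (N * ?m) + (s * N) * int i" by (simp add: algebra_simps)
    also have "\<dots> = r * (N * ?m + k * int i)" unfolding sN by (simp add: algebra_simps)
    also have "\<dots> = (r * k) * int \<delta>" unfolding N(2)[OF i] by simp
    also have "\<dots> = N * (s * int \<delta>)" unfolding sN[symmetric] by simp
    finally show "r * ?m + s * int i = s * int \<delta>" using N(1) by simp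
  qed
qed

text \<open>
  A single \<open>\<mu>\<close> admits only finitely many \<open>\<nu>\<close>, because \<open>rotations_coeff\<close> is a nontrivial polynomial equation for
  \<open>\<nu>\<close> when some lower coefficient does not vanish.
\<close>

lemma infinite_fst_rotations_of_infinite:
  assumes "infinite rotations" "q \<noteq> monom b d"
  shows "infinite (fst ` rotations)"
proof
  assume fin: "finite (fst ` rotations)"
  obtain i where i: "i < d" "coeff q i \<noteq> 0" using exists_lower_coeff[OF assms(2)] by blast
  have "finite {\<nu>. (\<mu>, \<nu>) \<in> rotations}" if \<mu>: "\<mu> \<in> fst ` rotations" for \<mu>
  proof -
    have \<mu>0: "\<mu> \<noteq> 0" using \<mu> rotations_facts(1) by force
    have fin: "finite ({z. poly b (\<mu> * z) = 0} \<union> {z. poly (coeff q i) (1 * z) = 0})"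
      by (intro finite_UnI finite_bad b_nonzero \<mu>0 i(2)) simp
    obtain z where "z \<notin> {z. poly b (\<mu> * z) = 0} \<union> {z. poly (coeff q i) (1 * z) = 0}"
      using ex_new_if_finite[OF infinite_UNIV_char_0 fin] by blast
    hence z: "poly b (\<mu> * z) \<noteq> 0" "poly (coeff q i) z \<noteq> 0" by simp_all
    let ?X = "poly b z * poly (coeff q i) (\<mu> * z)" and ?X' = "poly b (\<mu> * z) * poly (coeff q i) z"
    let ?h = "monom ?X' d - monom ?X i"
    have "coeff ?h d \<noteq> 0" using z i(1) by simp
    hence "?h \<noteq> 0" by force
    hence "finite {\<nu>. poly ?h \<nu> = 0}" by (rule poly_roots_finite)
    moreover have "{\<nu>. (\<mu>, \<nu>) \<in> rotations} \<subseteq> {\<nu>. poly ?h \<nu> = 0}"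
      using rotations_coeff[of \<mu> _ z i] by (auto simp: poly_monom mult_ac)
    ultimately show ?thesis by (rule finite_subset[rotated])
  qed
  hence "finite (SIGMA \<mu>:fst ` rotations. {\<nu>. (\<mu>, \<nu>) \<in> rotations})" using fin by (intro finite_SigmaI)
  moreover have "rotations \<subseteq> (SIGMA \<mu>:fst ` rotations. {\<nu>. (\<mu>, \<nu>) \<in> rotations})" by force
  ultimately show False using assms(1) finite_subset by blast
qed

lemma classification:
  assumes "infinite rotations" "q \<noteq> monom b d"
  shows "(\<exists>Q. map_ii p q Q) \<or> (\<exists>r s. map_iv p q r s)"
proof -
  note inf = infinite_fst_rotations_of_infinite[OF assms]
  obtain i0 where i0: "i0 < d" "coeff q i0 \<noteq> 0" using exists_lower_coeff[OF assms(2)] by blast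
  note pm = base_monomial[OF inf]
  note cm = infinite_base_symmetries(1)[OF inf i0]
  obtain N k where N: "N > 0" "\<And>i. coeff q i \<noteq> 0 \<Longrightarrow> N * int (degree (coeff q i)) + k * int i = k * int \<delta>"
    using infinite_base_symmetries(2)[OF inf i0] by blast
  show ?thesis
  proof (cases "k = 0")
    case True
    have "weighted 1 0" unfolding weighted_def
    proof (intro allI impI conjI cm)
      fix i assume "coeff q i \<noteq> 0"
      from N(2)[OF this] show "1 * int (degree (coeff q i)) + 0 * int i = 0 * int \<delta>"
        using N(1) True by simp
    qed
    thus ?thesis using map_ii_iff pm assms(2) by blast
  next
    case False
    define g where "g = gcd N k"
    define r where "r = N div g"
    define s where "s = k div g"
    have g: "N = g * r" "k = g * s" "g \<noteq> 0" using False by (simp_all add: g_def r_def s_def)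
    have "coprime r s" unfolding r_def s_def g_def by (rule div_gcd_coprime) (use False in simp)
    moreover have "r \<noteq> 0" "s \<noteq> 0" using g N(1) False by auto
    moreover have "weighted r s" unfolding weighted_def
    proof (intro allI impI conjI cm)
      fix i assume i: "coeff q i \<noteq> 0"
      have "g * (r * int (degree (coeff q i)) + s * int i) = g * (s * int \<delta>)"
        using N(2)[OF i] unfolding g(1,2) by (simp add: algebra_simps)
      thus "r * int (degree (coeff q i)) + s * int i = s * int \<delta>" using g(3) by simp
    qed
    ultimately have "map_iv p q r s" using map_iv_iff pm assms(2) by blast
    thus ?thesis by blast
  qed
qed

text \<open>
  Under the condition on \<open>(\<mu>, \<nu>)\<close>, the map \<open>f\<close> carries the rotation \<open>(\<mu>, \<nu>)\<close> to \<open>(\<mu>\<^sup>\<delta>, \<nu>\<^sup>d \<mu>\<^sup>l)\<close>. The weight relation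
  is what makes the new pair satisfy the condition again.
\<close>

lemma rotations_weighted:
  assumes pm: "p = monom 1 \<delta>" and w: "weighted r s" and r: "r \<noteq> 0"
  shows "(\<mu>, \<nu>) \<in> rotations \<longleftrightarrow> norm \<mu> = 1 \<and> norm \<nu> = 1 \<and>
    (\<forall>i. coeff q i \<noteq> 0 \<longrightarrow> \<nu> ^ i * \<mu> ^ degree (coeff q i) = \<nu> ^ d * \<mu> ^ degree b)"
proof -
  let ?m = "\<lambda>i. degree (coeff q i)"
  define C where "C \<mu> \<nu> \<longleftrightarrow> (\<forall>i. coeff q i \<noteq> 0 \<longrightarrow> \<nu> ^ i * \<mu> ^ ?m i = \<nu> ^ d * \<mu> ^ degree b)" for \<mu> \<nu> :: complex
  have pz: "poly p x = x ^ \<delta>" for x using pm by (metis poly_monom mult_1)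
  have bz: "poly b x = x ^ degree b" for x using weighted_b(1)[OF w] by (metis poly_monom mult_1)
  have fw: "poly (fiber q (\<mu> * z)) (\<nu> * w) = \<nu> ^ d * \<mu> ^ degree b * poly (fiber q z) w" if "C \<mu> \<nu>" for \<mu> \<nu> z w
  proof -
    have "poly (coeff q i) (\<mu> * z) * (\<nu> * w) ^ i = \<nu> ^ d * \<mu> ^ degree b * (poly (coeff q i) z * w ^ i)" for i
    proof (cases "coeff q i = 0")
      case False
      have "poly (coeff q i) (\<mu> * z) * (\<nu> * w) ^ i = (\<nu> ^ i * \<mu> ^ ?m i) * (poly (coeff q i) z * w ^ i)"
        unfolding weightedD(1)[OF assms(2)] by (simp add: power_mult_distrib mult_ac)
      thus ?thesis using that False unfolding C_def by simp
    qed simp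
    thus ?thesis unfolding poly_fiber by (simp add: sum_distrib_left)
  qed
  have Cn: "C (\<mu> ^ \<delta>) (\<nu> ^ d * \<mu> ^ degree b)" if c: "C \<mu> \<nu>" and nz: "\<mu> \<noteq> 0" "\<nu> \<noteq> 0" for \<mu> \<nu>
    unfolding C_def
  proof (intro allI impI)
    fix i assume i: "coeff q i \<noteq> 0"
    define l where "l = int (degree b)"
    define m where "m = int (?m i)"
    have e1: "r * m + s * int i = s * int \<delta>" using weightedD(2)[OF w i] by (simp add: m_def)
    have e2: "r * l + s * int d = s * int \<delta>" using weighted_b(2)[OF w] by (simp add: l_def)
    have e3: "r * (m - l) = s * (int d - int i)" using e1 e2 by (simp add: algebra_simps)
    have "r * ((int \<delta> - int d) * (m - l)) = (int \<delta> - int d) * (r * (m - l))" by simp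
    also have "\<dots> = (int \<delta> - int d) * (s * (int d - int i))" unfolding e3 ..
    also have "\<dots> = (s * (int \<delta> - int d)) * (int d - int i)" by simp
    also have "s * (int \<delta> - int d) = r * l" using e2 by (simp add: algebra_simps)
    finally have key: "(int \<delta> - int d) * (m - l) = l * (int d - int i)" using r by simp
    have x: "\<nu> powi int i * \<mu> powi m = \<nu> powi int d * \<mu> powi l"
      using c i unfolding C_def by (simp add: m_def l_def)
    define \<kappa> where "\<kappa> = \<nu> ^ d * \<mu> ^ degree b"
    have \<kappa>: "\<kappa> = \<nu> powi int d * \<mu> powi l" by (simp add: \<kappa>_def l_def)
    have x': "\<nu> powi (int d - int i) = \<mu> powi (m - l)" using x nz by (simp add: power_int_diff field_simps)
    have "\<kappa> powi (int d - int i) = (\<nu> powi (int d - int i)) powi int d * \<mu> powi (l * (int d - int i))"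
      unfolding \<kappa> power_int_mult_distrib power_int_mult[symmetric] by (simp add: mult.commute)
    also have "\<dots> = \<mu> powi ((m - l) * int d + l * (int d - int i))"
      unfolding x' using nz by (simp add: power_int_add power_int_mult)
    also have "(m - l) * int d + l * (int d - int i) = (m - l) * int \<delta>" using key by (simp add: algebra_simps)
    finally have "\<kappa> powi (int d - int i) = (\<mu> ^ \<delta>) powi (m - l)"
      by (simp add: mult.commute[of _ "int \<delta>"] power_int_mult)
    moreover have "\<kappa> \<noteq> 0" using nz by (simp add: \<kappa>_def)
    ultimately have "\<kappa> powi int i * (\<mu> ^ \<delta>) powi m = \<kappa> powi int d * (\<mu> ^ \<delta>) powi l"
      using nz by (simp add: power_int_diff field_simps)
    thus "(\<nu> ^ d * \<mu> ^ degree b) ^ i * (\<mu> ^ \<delta>) ^ ?m i =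
        (\<nu> ^ d * \<mu> ^ degree b) ^ d * (\<mu> ^ \<delta>) ^ degree b" by (simp add: \<kappa>_def m_def l_def)
  qed
  have Qn: "norm (Q k (\<mu> * z) (\<nu> * w)) = norm (Q k z w)" if "C \<mu> \<nu>" "norm \<mu> = 1" "norm \<nu> = 1" for k \<mu> \<nu> z w
    using that
  proof (induction k arbitrary: \<mu> \<nu> z w)
    case (Suc k)
    have nz: "\<mu> \<noteq> 0" "\<nu> \<noteq> 0" using Suc.prems by auto
    have "norm (Q k (\<mu> ^ \<delta> * poly p z) (\<nu> ^ d * \<mu> ^ degree b * poly (fiber q z) w)) = norm (Q k (poly p z) (poly (fiber q z) w))"
      by (rule Suc.IH[OF Cn[OF Suc.prems(1) nz]]) (simp_all add: norm_mult norm_power Suc.prems)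
    thus ?case unfolding fiber_iter_Suc' fw[OF Suc.prems(1)] by (simp add: pz power_mult_distrib)
  qed (simp add: norm_mult)
  show ?thesis unfolding C_def[symmetric]
  proof (intro iffI conjI)
    assume h: "(\<mu>, \<nu>) \<in> rotations"
    show "norm \<mu> = 1" "norm \<nu> = 1" using rotations_norm[OF h] by auto
    show "C \<mu> \<nu>" unfolding C_def
    proof (intro allI impI)
      fix i assume i: "coeff q i \<noteq> 0"
      have "lead_coeff (coeff q i) * (\<nu> ^ i * \<mu> ^ ?m i) = lead_coeff (coeff q i) * (\<nu> ^ d * \<mu> ^ degree b)"
        using rotations_coeff[OF h, of 1 i] b_nonzero by (simp add: bz weightedD(1)[OF w] mult_ac)
      moreover have "lead_coeff (coeff q i) \<noteq> 0" using i by simp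
      ultimately show "\<nu> ^ i * \<mu> ^ ?m i = \<nu> ^ d * \<mu> ^ degree b" using mult_left_cancel by blast
    qed
  next
    assume c: "norm \<mu> = 1 \<and> norm \<nu> = 1 \<and> C \<mu> \<nu>"
    thus "(\<mu>, \<nu>) \<in> rotations" by (intro rotations_intro Qn) (auto simp: pz power_mult_distrib)
  qed
qed

lemma powi_Gcd:
  fixes x :: complex and A :: "int set"
  assumes "finite A" "x \<noteq> 0"
  shows "x powi (Gcd A) = 1 \<longleftrightarrow> (\<forall>a\<in>A. x powi a = 1)"
  using assms(1)
proof (induction A rule: finite_induct)
  case (insert a A)
  have "x powi (gcd u v) = 1 \<longleftrightarrow> x powi u = 1 \<and> x powi v = 1" for u v
  proof (intro iffI conjI)
    assume g: "x powi (gcd u v) = 1"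
    have "x powi (gcd u v * c) = 1" for c using g by (simp add: power_int_mult)
    thus "x powi u = 1" "x powi v = 1" by (metis dvd_def gcd_dvd1, metis dvd_def gcd_dvd2)
  next
    assume uv: "x powi u = 1 \<and> x powi v = 1"
    obtain a b where "gcd u v = u * a + v * b" by (metis bezout_int mult.commute)
    thus "x powi (gcd u v) = 1" using uv assms(2) by (simp add: power_int_add power_int_mult)
  qed
  thus ?case using insert by simp
qed simp

text \<open>
  Since \<open>r\<close> and \<open>s\<close> are coprime, the exponents in \<open>rotations_weighted\<close> are \<open>d - i = r a\<^sub>i\<close> and \<open>m\<^sub>i - l = s a\<^sub>i\<close>. The
  conditions say that \<open>\<mu>\<^sup>s / \<nu>\<^sup>r\<close> has all \<open>a\<^sub>i\<close>-th powers equal to \<open>1\<close>, and the greatest common divisor of the \<open>a\<^sub>i\<close> is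
  the required integer.
\<close>

lemma map_iv_group:
  assumes "map_iv p q r s"
  shows "\<exists>a::int. a \<noteq> 0 \<and> rotations = {(\<mu>, \<nu>) \<in> S1 \<times> S1. \<mu> powi (a * s) = \<nu> powi (a * r)}"
proof -
  have m: "p = monom 1 \<delta>" "q \<noteq> monom b d" "r \<noteq> 0" "s \<noteq> 0" "coprime r s" and w: "weighted r s"
    using assms by (simp_all add: map_iv_iff)
  let ?I = "{i. coeff q i \<noteq> 0}"
  let ?m = "\<lambda>i. int (degree (coeff q i))" and ?l = "int (degree b)"
  have finI: "finite ?I" by (rule finite_subset[of _ "{..d}"]) (auto intro: le_degree)
  have "\<exists>a. int d - int i = r * a \<and> ?m i - ?l = s * a" if i: "i \<in> ?I" for i
  proof -
    have e: "r * (?m i - ?l) = s * (int d - int i)"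
      using weightedD(2)[OF w, of i] weighted_b(2)[OF w] i by (simp add: algebra_simps)
    hence "r dvd s * (int d - int i)" by (metis dvd_triv_left)
    hence "r dvd int d - int i" using m(5) by (simp add: coprime_dvd_mult_right_iff)
    then obtain a where a: "int d - int i = r * a" by blast
    hence "?m i - ?l = s * a" using e m(3) by simp
    thus ?thesis using a by blast
  qed
  then obtain a where a: "\<And>i. i \<in> ?I \<Longrightarrow> int d - int i = r * a i" "\<And>i. i \<in> ?I \<Longrightarrow> ?m i - ?l = s * a i" by metis
  define g where "g = Gcd (a ` ?I)"
  obtain i where i: "i < d" "i \<in> ?I" using exists_lower_coeff[OF m(2)] by blast
  have "a i \<noteq> 0" using a(1)[OF i(2)] i(1) by auto
  have g0: "g \<noteq> 0"
  proof
    assume "g = 0"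
    hence "a ` ?I \<subseteq> {0}" unfolding g_def by (simp only: Gcd_0_iff)
    thus False using i(2) \<open>a i \<noteq> 0\<close> by blast
  qed
  have "(\<mu>, \<nu>) \<in> rotations \<longleftrightarrow> \<mu> powi (g * s) = \<nu> powi (g * r)" if n: "norm \<mu> = 1" "norm \<nu> = 1" for \<mu> \<nu>
  proof -
    have nz: "\<mu> \<noteq> 0" "\<nu> \<noteq> 0" using n by auto
    define x where "x = \<mu> powi s / \<nu> powi r"
    have x0: "x \<noteq> 0" using nz by (simp add: x_def)
    have xk: "x powi k = 1 \<longleftrightarrow> \<mu> powi (k * s) = \<nu> powi (k * r)" for k
      using nz by (simp add: x_def power_int_divide_distrib mult.commute[of k] power_int_mult)
    have "\<nu> ^ j * \<mu> ^ degree (coeff q j) = \<nu> ^ d * \<mu> ^ degree b \<longleftrightarrow> x powi (a j) = 1" if j: "j \<in> ?I" for j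
    proof -
      have "\<nu> ^ j * \<mu> ^ degree (coeff q j) = \<nu> ^ d * \<mu> ^ degree b \<longleftrightarrow>
          \<nu> powi int j * \<mu> powi ?m j = \<nu> powi int d * \<mu> powi ?l" by simp
      also have "\<dots> \<longleftrightarrow> \<mu> powi (?m j - ?l) = \<nu> powi (int d - int j)"
        using nz by (simp add: power_int_diff field_simps)
      also have "\<dots> \<longleftrightarrow> x powi (a j) = 1" unfolding a(1)[OF j] a(2)[OF j] xk by (simp add: mult.commute)
      finally show ?thesis .
    qed
    hence "(\<mu>, \<nu>) \<in> rotations \<longleftrightarrow> (\<forall>j\<in>?I. x powi (a j) = 1)"
      unfolding rotations_weighted[OF m(1) w m(3)] using n by simp
    also have "\<dots> \<longleftrightarrow> x powi g = 1" unfolding g_def using powi_Gcd[OF finite_imageI[OF finI] x0, of a] by simp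
    finally show ?thesis unfolding xk .
  qed
  hence "rotations = {(\<mu>, \<nu>) \<in> S1 \<times> S1. \<mu> powi (g * s) = \<nu> powi (g * r)}" using rotations_subset by force
  thus ?thesis using g0 by blast
qed

end

section \<open>Maps that are powers in the fibres\<close>

context skew_map
begin

lemma power_map_coeff:
  assumes "q = monom b d" "i \<noteq> d"
  shows "coeff q i = 0"
proof -
  have "coeff q i = coeff (monom b d) i" using assms(1) by simp
  thus ?thesis using assms(2) by simp
qed

lemma power_map_fiber:
  assumes "q = monom b d"
  shows "poly (fiber q z) w = poly b z * w ^ d"
proof -
  have "poly (fiber q z) w = (\<Sum>i\<in>{d}. poly (coeff q i) z * w ^ i)"
    unfolding poly_fiber
  proof (rule sum.mono_neutral_right)
    show "\<forall>i\<in>{..d} - {d}. poly (coeff q i) z * w ^ i = 0" using power_map_coeff[OF assms] by simp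
  qed auto
  thus ?thesis by simp
qed

lemma power_map_zero_orbit:
  assumes "q = monom b d"
  shows "Q n z 0 = 0"
  by (induction n) (use deg_q in \<open>simp_all add: fiber_iter_Suc power_map_fiber[OF assms]\<close>)

lemma power_map_ln_orbit:
  assumes "q = monom b d" "\<And>k. poly b (orb k z) \<noteq> 0" "w \<noteq> 0"
  shows "Q n z w \<noteq> 0 \<and>
    ln (norm (Q n z w)) = real d ^ n * (ln (norm w) + (\<Sum>k<n. ln (norm (poly b (orb k z))) / real d ^ Suc k))"
proof (induction n)
  case (Suc n)
  have nz: "Q n z w \<noteq> 0" using Suc by simp
  have "ln (norm (Q (Suc n) z w)) = ln (norm (poly b (orb n z))) + real d * ln (norm (Q n z w))"
    unfolding fiber_iter_Suc power_map_fiber[OF assms(1)] norm_mult norm_power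
    using nz assms(2)[of n] by (subst ln_mult_pos) (simp_all add: ln_realpow)
  also have "\<dots> = real d ^ Suc n * (ln (norm w) + (\<Sum>k<Suc n. ln (norm (poly b (orb k z))) / real d ^ Suc k))"
    using Suc deg_q by (simp add: field_simps)
  finally show ?case using nz assms(2)[of n] by (simp add: fiber_iter_Suc power_map_fiber[OF assms(1)])
qed (use assms(3) in simp)

lemma green_eq_of_LIMSEQ:
  assumes "(\<lambda>n. ln (max 1 (norm (Q n z w))) / real d ^ n) \<longlonglongrightarrow> g"
  shows "green p q z w = g"
  using limI[OF assms] by (simp add: green_def)

lemma Phi_eq:
  assumes "(\<lambda>n. \<Sum>k<n. ereal (1 / real d ^ (k + 1)) * elog (norm (poly b (orb k z)))) \<longlonglongrightarrow> x"
  shows "Phi p q z = x"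
  using assms unfolding Phi_def sums_def[symmetric] by (rule sums_unique[symmetric])

text \<open>
  Here \<open>log |Q\<^sup>n\<^sub>z(w)| / d\<^sup>n\<close> is \<open>log |w|\<close> plus the partial sum of \<open>\<Phi>(z)\<close>. So the Green function is the positive
  part of \<open>log |w| + \<Phi>(z)\<close>, which is zero for \<open>\<Phi>(z) = -\<infinity>\<close>. The partial sums converge in the extended sense
  because their terms are bounded above by those of a geometric series.
\<close>

lemma power_map_E:
  assumes q: "q = monom b d" and z: "z \<in> filled_julia p"
  shows "(E z = {} \<or> (\<exists>\<rho>>0. E z = sphere 0 \<rho>)) \<and> E z = {w. elog (norm w) = - Phi p q z}"
proof -
  let ?f = "\<lambda>k. ereal (1 / real d ^ (k + 1)) * elog (norm (poly b (orb k z)))"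
  have d0: "real d > 0" using deg_q by simp
  have infinite_case: ?thesis if "\<And>w. green p q z w = 0" "Phi p q z = -\<infinity>"
  proof -
    have "K z = UNIV" using that(1) by (simp add: fiber_filled_julia_def)
    thus ?thesis using that(2) by (simp add: elog_def)
  qed
  show ?thesis
  proof (cases "\<exists>k. poly b (orb k z) = 0")
    case True
    then obtain k where k: "poly b (orb k z) = 0" by blast
    have Q0: "Q (Suc k + j) z w = 0" for j w
    proof (induction j)
      case 0
      show ?case by (simp add: fiber_iter_Suc power_map_fiber[OF q] k)
    next
      case (Suc j)
      have "Q (Suc (Suc k + j)) z w = 0" unfolding fiber_iter_Suc Suc power_map_fiber[OF q] using deg_q by simp
      thus ?case by simp
    qed
    show ?thesis
    proof (rule infinite_case)
      fix w
      show "green p q z w = 0"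
      proof (rule green_eq_of_LIMSEQ, rule tendsto_eventually, rule eventually_sequentiallyI)
        fix n assume "n \<ge> Suc k"
        then obtain j where "n = Suc k + j" using le_Suc_ex by blast
        thus "ln (max 1 (norm (Q n z w))) / real d ^ n = 0" using Q0 by simp
      qed
      show "Phi p q z = -\<infinity>"
      proof (rule Phi_eq, rule tendsto_eventually, rule eventually_sequentiallyI)
        fix n assume n: "n \<ge> Suc k"
        have pos: "0 < 1 / real d ^ (i + 1)" for i using d0 by simp
        have minf: "ereal c * -\<infinity> = -\<infinity>" if "0 < c" for c using that by simp
        have zer: "?f i = -\<infinity>" if "poly b (orb i z) = 0" for i
          by (simp only: elog_def that norm_zero if_True simp_thms minf[OF pos])
        have fin: "?f i \<noteq> \<infinity>" for i
        proof (cases "poly b (orb i z) = 0")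
          case True
          show ?thesis unfolding zer[OF True] by simp
        qed (simp add: elog_def)
        have "?f k = -\<infinity>" by (rule zer[OF k])
        moreover have "(\<Sum>i\<in>{..<n} - {k}. ?f i) \<noteq> \<infinity>" using fin by (simp add: sum_Pinfty)
        moreover have "x + y = -\<infinity>" if "x = -\<infinity>" "y \<noteq> \<infinity>" for x y :: ereal
          using that by (cases y) auto
        ultimately have "?f k + (\<Sum>i\<in>{..<n} - {k}. ?f i) = -\<infinity>" by blast
        thus "(\<Sum>i<n. ?f i) = -\<infinity>" using n by (subst sum.remove[of _ k]) auto
      qed
    qed
  next
    case False
    hence nz: "\<And>k. poly b (orb k z) \<noteq> 0" by blast
    define a where "a k = ln (norm (poly b (orb k z))) / real d ^ Suc k" for k
    define s where "s n = (\<Sum>k<n. a k)" for n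
    have fs: "(\<Sum>k<n. ?f k) = ereal (s n)" for n
    proof -
      have "?f k = ereal (a k)" for k using nz[of k] by (simp add: elog_def a_def)
      thus ?thesis by (simp add: s_def sum_ereal)
    qed
    have maxmult: "max 0 (c * x) = c * max 0 x" if "c > 0" for c x :: real
      using that by (auto simp: max_def zero_le_mult_iff)
    have lnmax: "ln (max 1 x) = max 0 (ln x)" if "x > 0" for x :: real
      using that by (cases "x \<ge> 1") (auto simp: max_def)
    have gs: "ln (max 1 (norm (Q n z w))) / real d ^ n = max 0 (ln (norm w) + s n)" if "w \<noteq> 0" for n w
    proof -
      note l = power_map_ln_orbit[OF q nz that, of n]
      have "ln (max 1 (norm (Q n z w))) = max 0 (ln (norm (Q n z w)))"
        using l lnmax by simp
      also have "\<dots> = max 0 (real d ^ n * (ln (norm w) + s n))" using l by (simp add: s_def a_def)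
      also have "\<dots> = real d ^ n * max 0 (ln (norm w) + s n)"
        by (rule maxmult[OF zero_less_power[OF d0]])
      finally show ?thesis using d0 by simp
    qed
    have g0: "green p q z 0 = 0" by (rule green_eq_of_LIMSEQ) (simp add: power_map_zero_orbit[OF q])
    obtain M where M: "M \<ge> 1" "\<And>n i. norm (poly (coeff q i) (orb n z)) \<le> M"
      using orbit_coeff_bound[OF z] by metis
    define e where "e k = ln M / real d ^ Suc k - a k" for k
    have e0: "e k \<ge> 0" for k
    proof -
      have "ln (norm (poly b (orb k z))) \<le> ln M" using M nz[of k] by (intro ln_mono) auto
      thus ?thesis unfolding e_def a_def using d0 by (simp add: divide_right_mono)
    qed
    have smM: "summable (\<lambda>k. ln M / real d ^ Suc k)"
      using summable_const_over_power[OF deg_q, of "ln M / real d"] by simp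
    show ?thesis
    proof (cases "summable e")
      case True
      have "summable (\<lambda>k. ln M / real d ^ Suc k - e k)" by (rule summable_diff[OF smM True])
      hence "summable a" by (simp add: e_def)
      hence sl: "s \<longlonglongrightarrow> suminf a" unfolding s_def by (rule summable_LIMSEQ)
      have Phi: "Phi p q z = ereal (suminf a)"
        by (rule Phi_eq) (unfold fs, rule tendsto_ereal[OF sl])
      have gw: "green p q z w = max 0 (ln (norm w) + suminf a)" if "w \<noteq> 0" for w
        by (rule green_eq_of_LIMSEQ) (unfold gs[OF that], intro tendsto_intros sl)
      have le: "ln (norm w) + suminf a \<le> 0 \<longleftrightarrow> norm w \<le> exp (- suminf a)"
        and eq: "ln (norm w) = - suminf a \<longleftrightarrow> norm w = exp (- suminf a)" if "w \<noteq> 0" for w :: complex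
      proof -
        have "norm w \<le> exp (- suminf a) \<longleftrightarrow> ln (norm w) \<le> - suminf a"
          using that by (metis exp_gt_zero ln_exp ln_le_cancel_iff zero_less_norm_iff)
        thus "ln (norm w) + suminf a \<le> 0 \<longleftrightarrow> norm w \<le> exp (- suminf a)" by linarith
        show "ln (norm w) = - suminf a \<longleftrightarrow> norm w = exp (- suminf a)"
          using that by (metis exp_ln ln_exp zero_less_norm_iff)
      qed
      have Kz: "K z = cball 0 (exp (- suminf a))"
      proof (rule Set.set_eqI)
        fix w
        show "w \<in> K z \<longleftrightarrow> w \<in> cball 0 (exp (- suminf a))"
        proof (cases "w = 0")
          case True
          thus ?thesis using g0 by (simp add: fiber_filled_julia_def)
        next
          case False
          thus ?thesis using gw[OF False] le[OF False] by (auto simp: fiber_filled_julia_def max_def)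
        qed
      qed
      hence Ez: "E z = sphere 0 (exp (- suminf a))" by (simp add: frontier_cball)
      moreover have "sphere 0 (exp (- suminf a)) = {w::complex. elog (norm w) = - Phi p q z}"
        unfolding Phi using eq by (auto simp: elog_def)
      moreover have "\<exists>\<rho>>0. E z = sphere 0 \<rho>" unfolding Ez by (intro exI[of _ "exp (- suminf a)"]) simp
      ultimately show ?thesis by simp
    next
      case False
      \<comment> \<open>the nonnegative differences \<open>e\<close> have an infinite sum, so the partial sums of \<open>\<Phi>\<close> tend to \<open>-\<infinity>\<close>\<close>
      have bot: "\<forall>\<^sub>F n in sequentially. s n < Z" for Z
      proof -
        define T where "T = (\<Sum>k. ln M / real d ^ Suc k)"
        have "\<exists>N. (\<Sum>k<N. e k) > T - Z"
        proof (rule ccontr)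
          assume "\<not> ?thesis"
          hence "\<And>N. (\<Sum>k<N. e k) \<le> T - Z" by (auto simp: not_less)
          hence "summable e" by (intro summableI_nonneg_bounded[OF e0])
          thus False using False by simp
        qed
        then obtain N where N: "(\<Sum>k<N. e k) > T - Z" by blast
        have "s n < Z" if n: "n \<ge> N" for n
        proof -
          have "(\<Sum>k<N. e k) \<le> (\<Sum>k<n. e k)" using n e0 by (intro sum_mono2) auto
          moreover have "(\<Sum>k<n. e k) = (\<Sum>k<n. ln M / real d ^ Suc k) - s n"
            unfolding e_def s_def by (simp add: sum_subtractf)
          moreover have "(\<Sum>k<n. ln M / real d ^ Suc k) \<le> T"
            unfolding T_def using M(1) by (intro sum_le_suminf smM) auto
          ultimately show ?thesis using N by linarith
        qed
        thus ?thesis unfolding eventually_sequentially by blast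
      qed
      show ?thesis
      proof (rule infinite_case)
        fix w
        show "green p q z w = 0"
        proof (cases "w = 0")
          case False
          show ?thesis
          proof (rule green_eq_of_LIMSEQ, rule tendsto_eventually)
            show "\<forall>\<^sub>F n in sequentially. ln (max 1 (norm (Q n z w))) / real d ^ n = 0"
              using bot[of "- ln (norm w)"]
            proof eventually_elim
              case (elim n)
              thus ?case unfolding gs[OF False] by simp
            qed
          qed
        qed (use g0 in simp)
        have "(\<lambda>n. ereal (s n)) \<longlonglongrightarrow> -\<infinity>" unfolding tendsto_MInfty using bot by simp
        thus "Phi p q z = -\<infinity>" by (intro Phi_eq) (unfold fs)
      qed
    qed
  qed
qed

end

section \<open>The four classes\<close>

lemma rotate_sphere:
  assumes "norm (\<nu>::complex) = 1"
  shows "(\<lambda>w. \<nu> * w) ` sphere 0 \<rho> = sphere 0 \<rho>"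
  by (rule scaling_image_eqI) (use assms in \<open>auto simp: norm_mult\<close>)

lemma subgroup_circleI:
  assumes "A \<subseteq> S1" "1 \<in> A" "\<And>x y. x \<in> A \<Longrightarrow> y \<in> A \<Longrightarrow> x * y \<in> A" "\<And>x. x \<in> A \<Longrightarrow> inverse x \<in> A"
  shows "subgroup A circle_group"
proof
  show "inv\<^bsub>circle_group\<^esub> x \<in> A" if x: "x \<in> A" for x
  proof -
    have x1: "x \<noteq> 0" "norm x = 1" using assms(1) x by auto
    have "inv\<^bsub>circle_group\<^esub> x = inverse x"
      unfolding m_inv_def circle_group_def using x1
      by (intro the_equality) (auto simp: norm_inverse norm_divide inverse_eq_divide field_simps)
    thus ?thesis using assms(4)[OF x] by simp
  qed
qed (use assms in \<open>auto simp: circle_group_def\<close>)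

lemma subgroup_circleD:
  assumes "subgroup A circle_group"
  shows "A \<subseteq> S1" "1 \<in> A"
  using subgroup.subset[OF assms] subgroup.one_closed[OF assms] by (simp_all add: circle_group_def)

context skew_normal
begin

lemma julia_circle:
  assumes "p = monom 1 \<delta>"
  shows "julia p = S1"
  using filled_julia_monom(2)[OF deg_p] assms by metis

text \<open>
  For \<open>\<mu> = 1\<close>, \<open>rotations_coeff\<close> reduces to \<open>\<nu>\<^sup>i = \<nu>\<^sup>d\<close> whenever the coefficient of degree \<open>i\<close> is nonzero.
\<close>

lemma power_map_iff: "q = monom b d \<longleftrightarrow> (\<forall>\<nu>. norm \<nu> = 1 \<longrightarrow> (1, \<nu>) \<in> rotations)"
proof (intro iffI allI impI)
  fix \<nu> :: complex assume q: "q = monom b d" and n: "norm \<nu> = 1"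
  have "norm (Q k z (\<nu> * w)) = norm (Q k z w)" for k z w
    by (induction k) (simp_all add: n fiber_iter_Suc power_map_fiber[OF q] norm_mult norm_power)
  thus "(1, \<nu>) \<in> rotations" by (intro rotations_intro) (simp_all add: n)
next
  assume a: "\<forall>\<nu>. norm \<nu> = 1 \<longrightarrow> (1, \<nu>) \<in> rotations"
  show "q = monom b d"
  proof (rule ccontr)
    assume "q \<noteq> monom b d"
    then obtain i where i: "i < d" "coeff q i \<noteq> 0" using exists_lower_coeff by blast
    have "b * coeff q i \<noteq> 0" using b_nonzero i(2) by simp
    then obtain z where z: "poly b z * poly (coeff q i) z \<noteq> 0" using poly_all_0_iff_0 by (metis poly_mult)
    have "\<nu> powi (int d - int i) = 1" if n: "norm \<nu> = 1" for \<nu> :: complex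
    proof -
      have h: "(1, \<nu>) \<in> rotations" using a n by blast
      have "(poly b z * poly (coeff q i) z) * \<nu> ^ i = (poly b z * poly (coeff q i) z) * \<nu> ^ d"
        using rotations_coeff[OF h, of z i] by (simp add: mult_ac)
      hence "\<nu> ^ i = \<nu> ^ d" using z mult_left_cancel by blast
      thus ?thesis using rotations_facts(2)[OF h] by (simp add: power_int_diff)
    qed
    hence "int d - int i = 0" by (rule powi_one_on_circle)
    thus False using i(1) by simp
  qed
qed

text \<open>
  Choose a good point \<open>z0\<close> that is no root of \<open>b\<close>. The circles over all points \<open>\<mu> z0\<close>, with \<open>\<mu>\<close> from the group,
  have the same radius, and so have the circles over their images. Hence \<open>|b|\<close> is constant on an
  infinite subset of the unit circle.
\<close>

lemma power_map_infinite:
  assumes q: "q = monom b d" and inf: "infinite (fst ` rotations)"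
  shows "map_i p q"
proof -
  note pm = base_monomial[OF inf]
  have jS: "julia p = S1" by (rule julia_circle[OF pm])
  have "infinite (good - {z. poly b z = 0})" by (intro good_generic poly_roots_finite b_nonzero)
  then obtain z0 where z0: "z0 \<in> good" "poly b z0 \<noteq> 0"
    by (metis (mono_tags, lifting) DiffE finite.emptyI equals0I mem_Collect_eq)
  have sph: "\<exists>\<rho>>0. E z = sphere 0 \<rho>" if "z \<in> good" for z
    using power_map_E[OF q in_filled[OF good_julia[OF that]]] that by (auto simp: good_def)
  obtain \<rho> where \<rho>: "\<rho> > 0" "E z0 = sphere 0 \<rho>" using sph[OF z0(1)] by blast
  obtain \<rho>' where \<rho>': "\<rho>' > 0" "E (poly p z0) = sphere 0 \<rho>'" using sph[OF good_forward[OF z0(1)]] by blast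
  let ?M = "(\<lambda>\<mu>. \<mu> * z0) ` fst ` rotations"
  have z0n: "norm z0 = 1" using good_julia[OF z0(1)] jS by simp
  have "z0 \<noteq> 0" using z0n by auto
  hence "inj_on (\<lambda>\<mu>. \<mu> * z0) (fst ` rotations)" by (intro inj_onI) simp
  hence "infinite ?M" using inf by (subst finite_image_iff)
  moreover have "?M \<subseteq> S1" using rotations_norm z0n by (force simp: norm_mult)
  moreover have "norm (poly b x) = \<rho>' / \<rho> ^ d" if x: "x \<in> ?M" for x
  proof -
    obtain \<mu> \<nu> where h: "(\<mu>, \<nu>) \<in> rotations" "x = \<mu> * z0" using x by auto
    have xW: "x \<in> good" using rotations_facts(4)[OF h(1) z0(1)] h(2) by simp
    have Ex: "E x = sphere 0 \<rho>"
      using rotations_facts(5)[OF h(1) z0(1)] \<rho>(2) rotate_sphere[OF rotations_norm(2)[OF h(1)]] h(2) by simp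
    have "poly p x = \<mu> ^ \<delta> * poly p z0" unfolding h(2) by (rule rotations_facts(3)[OF h(1)])
    hence Epx: "E (poly p x) = sphere 0 \<rho>'"
      using rotations_facts(5)[OF rotations_power[OF h(1)] good_forward[OF z0(1)], of \<delta>] \<rho>'(2)
        rotate_sphere[OF rotations_norm(2)[OF rotations_power[OF h(1), of \<delta>]]] by simp
    have "complex_of_real \<rho> \<in> E x" unfolding Ex using \<rho>(1) by simp
    hence "poly (fiber q x) (complex_of_real \<rho>) \<in> sphere 0 \<rho>'" using good_E[OF xW] Epx by auto
    hence "norm (poly b x) * \<rho> ^ d = \<rho>'"
      using \<rho>(1) by (simp add: power_map_fiber[OF q] norm_mult norm_power)
    thus ?thesis using \<rho>(1) by (simp add: field_simps)
  qed
  moreover have "\<rho>' / \<rho> ^ d \<noteq> 0" using \<rho>(1) \<rho>'(1) by simp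
  ultimately have "b = monom (lead_coeff b) (degree b)" by (intro monom_if_norm_constant_on_circle(1))
  hence "b = monom 1 (degree b)" using monic(2) by simp
  thus "map_i p q" using pm q unfolding map_i_def by metis
qed

lemma map_i_power_map:
  assumes "map_i p q"
  shows "p = monom 1 \<delta>" "b = monom 1 (degree b)" "q = monom b d"
proof -
  have a: "p = monom 1 \<delta>" "q = monom (monom 1 (degree b)) d" using assms unfolding map_i_def by blast+
  show "p = monom 1 \<delta>" by fact
  have "coeff q d = coeff (monom (monom 1 (degree b)) d) d" using a(2) by simp
  thus b: "b = monom 1 (degree b)" by simp
  show "q = monom b d" using a(2) b by simp
qed

lemma power_map_cases:
  assumes "q = monom b d"
  shows "map_iii p q \<longleftrightarrow> \<not> map_i p q"
  using map_i_power_map assms unfolding map_iii_def map_i_def by metis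

lemma map_iii_power_map: "map_iii p q \<Longrightarrow> q = monom b d"
  by (simp add: map_iii_def)

lemma fib_of_Sigma:
  assumes "skew_julia p q = Sigma A B"
  shows "fib z = (if z \<in> A then B z else {})"
  unfolding assms by auto

lemma Sigma_of_E:
  assumes "julia p = A" "\<And>z. z \<in> A \<Longrightarrow> E z = B z"
  shows "skew_julia p q = Sigma A B"
  unfolding skew_julia_def assms(1) using assms(2) by (intro Sigma_cong) auto

lemma rotations_of_product:
  assumes "\<And>z. fib z = (if z \<in> S1 then J else {})" "J \<noteq> {}"
  shows "rotations = S1 \<times> {\<nu> \<in> S1. (\<lambda>w. \<nu> * w) ` J = J}"
proof (rule Set.set_eqI)
  fix x :: "complex \<times> complex"
  obtain \<mu> \<nu> where x: "x = (\<mu>, \<nu>)" by (cases x)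
  show "x \<in> rotations \<longleftrightarrow> x \<in> S1 \<times> {\<nu> \<in> S1. (\<lambda>w. \<nu> * w) ` J = J}"
  proof
    assume "x \<in> rotations"
    hence h: "(\<mu>, \<nu>) \<in> rotations" by (simp add: x)
    have "fib (\<mu> * 1) = (\<lambda>w. \<nu> * w) ` fib 1" by (rule rotations_fib[OF h])
    hence "(\<lambda>w. \<nu> * w) ` J = J" unfolding assms(1) using rotations_norm[OF h] by simp
    thus "x \<in> S1 \<times> {\<nu> \<in> S1. (\<lambda>w. \<nu> * w) ` J = J}" using rotations_norm[OF h] by (simp add: x)
  next
    assume r: "x \<in> S1 \<times> {\<nu> \<in> S1. (\<lambda>w. \<nu> * w) ` J = J}"
    hence n: "norm \<mu> = 1" "norm \<nu> = 1" "(\<lambda>w. \<nu> * w) ` J = J" by (simp_all add: x)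
    have "fib (\<mu> * z) = (\<lambda>w. \<nu> * w) ` fib z" for z
      unfolding assms(1) using n by (simp add: norm_mult)
    thus "x \<in> rotations" unfolding x rotations_iff using n by blast
  qed
qed

lemma rotations_of_torus:
  assumes "\<And>z. fib z = (if z \<in> S1 then S1 else {})"
  shows "rotations = S1 \<times> S1"
proof -
  have "S1 \<noteq> {}" using infinite_S1 by force
  moreover have "{\<nu> \<in> S1. (\<lambda>w. \<nu> * w) ` S1 = S1} = S1"
    by (intro equalityI subsetI) (simp_all add: rotate_sphere)
  ultimately show ?thesis using rotations_of_product[OF assms] by simp
qed

lemma map_i_of_full_group:
  assumes "rotations = S1 \<times> S1"
  shows "map_i p q"
proof (rule power_map_infinite)
  show "q = monom b d" unfolding power_map_iff using assms by simp
  have "S1 \<noteq> {}" using infinite_S1 by force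
  thus "infinite (fst ` rotations)" using infinite_S1 assms by simp
qed

lemma skew_julia_map_i:
  assumes "map_i p q"
  shows "skew_julia p q = S1 \<times> S1"
proof (rule Sigma_of_E)
  note m = map_i_power_map[OF assms]
  show jS: "julia p = S1" by (rule julia_circle[OF m(1)])
  fix z :: complex assume "z \<in> S1"
  hence z: "z \<in> julia p" by (simp add: jS)
  have orb: "orb k z \<in> S1" for k
    by (induction k) (use z julia_p_shift jS in auto)
  have "norm (poly b (orb k z)) = 1" for k
    using orb[of k] by (subst m(2)) (simp add: poly_monom norm_power)
  hence "Phi p q z = 0" by (simp add: Phi_def elog_def flip: zero_ereal_def)
  thus "E z = S1" using power_map_E[OF m(3) in_filled[OF z]] by (auto simp: elog_def zero_ereal_def)
qed

lemma rotations_map_i: "map_i p q \<Longrightarrow> rotations = S1 \<times> S1"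
  by (rule rotations_of_torus) (simp only: fib_of_Sigma[OF skew_julia_map_i])

lemma map_i_of_torus:
  assumes "\<And>z. fib z = (if z \<in> S1 then S1 else {})"
  shows "map_i p q"
  by (rule map_i_of_full_group[OF rotations_of_torus[OF assms]])

lemma skew_julia_map_ii:
  assumes "map_ii p q R"
  shows "skew_julia p q = S1 \<times> julia R"
proof (rule Sigma_of_E)
  have "p = monom 1 \<delta>" using assms by (simp add: map_ii_def)
  thus jS: "julia p = S1" by (rule julia_circle)
  fix z :: complex assume "z \<in> S1"
  hence "K z = filled_julia R" using in_filled jS by (intro K_autonomous map_ii_fiber(1)[OF assms]) auto
  thus "E z = julia R" by (simp add: julia_def)
qed

lemma map_ii_not_circle:
  assumes "map_ii p q R"
  shows "julia R \<noteq> S1"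
proof
  assume "julia R = S1"
  hence "map_i p q" by (intro map_i_of_torus) (simp only: fib_of_Sigma[OF skew_julia_map_ii[OF assms]])
  thus False using map_i_power_map(3) map_ii_iff assms by blast
qed

lemma map_ii_group:
  assumes "map_ii p q R"
  defines "S \<equiv> {\<nu> \<in> S1. (\<lambda>w. \<nu> * w) ` julia R = julia R}"
  shows "rotations = S1 \<times> S" "finite S" "subgroup S circle_group" "rot ` S = julia_sym R"
proof -
  note R = map_ii_fiber(2-4)[OF assms(1)]
  have dR: "degree R \<ge> 2" using R deg_q by simp
  note jf = julia_facts[OF dR]
  have "julia R \<noteq> {}" using jf(2) by force
  thus "rotations = S1 \<times> S" unfolding S_def
    by (rule rotations_of_product[rotated]) (simp only: fib_of_Sigma[OF skew_julia_map_ii[OF assms(1)]])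
  have sub: "coeff R (degree R - 1) = 0" using R by simp
  have sym: "k = 0" "poly R (c * z) = c ^ degree R * poly R z"
    if "c \<noteq> 0" "(\<lambda>z. c * z + k) ` julia R = julia R" for c k z
    using centred_symmetry[OF refl dR sub jf(1,2,3) that] by auto
  show "finite S"
  proof (rule ccontr)
    assume inf: "infinite S"
    have "R = monom (lead_coeff R) (degree R)"
    proof (rule monom_if_roots_invariant[OF inf])
      fix \<nu> z assume "\<nu> \<in> S" "poly R z = 0"
      hence "\<nu> \<noteq> 0" "(\<lambda>z. \<nu> * z + 0) ` julia R = julia R" by (auto simp: S_def)
      from sym(2)[OF this, of z] show "poly R (\<nu> * z) = 0" using \<open>poly R z = 0\<close> by simp
    qed
    hence "R = monom 1 d" using R(1,2) by simp
    thus False using assms(1) by (simp add: map_ii_def)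
  qed
  show "subgroup S circle_group"
  proof (rule subgroup_circleI)
    show "S \<subseteq> S1" by (auto simp: S_def)
    show "1 \<in> S" by (simp add: S_def)
    show "x * y \<in> S" if "x \<in> S" "y \<in> S" for x y
    proof -
      have "(\<lambda>w. x * y * w) ` julia R = (\<lambda>w. x * w) ` (\<lambda>w. y * w) ` julia R" by (simp add: image_image mult.assoc)
      also have "\<dots> = julia R" using that by (simp add: S_def)
      finally show ?thesis using that by (simp add: S_def norm_mult)
    qed
    show "inverse x \<in> S" if x: "x \<in> S" for x
    proof -
      have x0: "x \<noteq> 0" "norm x = 1" using x by (auto simp: S_def)
      have "(\<lambda>w. inverse x * w) ` julia R = (\<lambda>w. inverse x * w) ` (\<lambda>w. x * w) ` julia R"
        using x by (simp add: S_def)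
      also have "\<dots> = julia R" using x0 by (simp add: image_image flip: mult.assoc)
      finally show ?thesis using x0 by (simp add: S_def norm_inverse)
    qed
  qed
  show "rot ` S = julia_sym R"
  proof (intro equalityI subsetI)
    fix \<sigma> assume "\<sigma> \<in> rot ` S"
    then obtain \<nu> where "\<nu> \<in> S" "\<sigma> = rot \<nu>" by blast
    thus "\<sigma> \<in> julia_sym R" unfolding julia_sym_def rot_def S_def
      by (intro CollectI exI[of _ \<nu>] exI[of _ 0]) simp
  next
    fix \<sigma> assume "\<sigma> \<in> julia_sym R"
    then obtain c k where c: "norm c = 1" "\<sigma> = (\<lambda>z. c * z + k)" "\<sigma> ` julia R = julia R"
      unfolding julia_sym_def by blast
    have "c \<noteq> 0" using c(1) by auto
    hence "k = 0" using sym(1) c(2,3) by blast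
    thus "\<sigma> \<in> rot ` S" using c by (intro image_eqI[of _ _ c]) (simp_all add: rot_def S_def)
  qed
qed

lemma skew_julia_power_map:
  assumes "q = monom b d"
  shows "skew_julia p q = (SIGMA z:julia p. {w::complex. elog (norm w) = - Phi p q z})"
    "\<forall>z\<in>julia p. {w::complex. elog (norm w) = - Phi p q z} = {} \<or> (\<exists>\<rho>>0. {w::complex. elog (norm w) = - Phi p q z} = sphere 0 \<rho>)"
proof -
  show "skew_julia p q = (SIGMA z:julia p. {w::complex. elog (norm w) = - Phi p q z})"
    using power_map_E[OF assms in_filled] by (intro Sigma_of_E) auto
  show "\<forall>z\<in>julia p. {w::complex. elog (norm w) = - Phi p q z} = {} \<or> (\<exists>\<rho>>0. {w::complex. elog (norm w) = - Phi p q z} = sphere 0 \<rho>)"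
  proof
    fix z assume "z \<in> julia p"
    from power_map_E[OF assms in_filled[OF this]]
    show "{w::complex. elog (norm w) = - Phi p q z} = {} \<or> (\<exists>\<rho>>0. {w::complex. elog (norm w) = - Phi p q z} = sphere 0 \<rho>)"
      by (elim conjE) simp
  qed
qed

text \<open>
  If the circles were the same over \<open>J\<^sub>p = S\<^sup>1\<close>, the group would contain all pairs \<open>(t, 1)\<close>, which leads to case (i).
\<close>

lemma map_iii_julia:
  assumes "map_iii p q"
  shows "julia_iii p q"
proof -
  note q = map_iii_power_map[OF assms]
  let ?C = "\<lambda>z. {w::complex. elog (norm w) = - Phi p q z}"
  have "julia p \<noteq> S1 \<or> \<not> (\<exists>A. \<forall>z\<in>julia p. ?C z = A)"
  proof (rule disjCI, rule notI)
    assume A: "\<not> \<not> (\<exists>A. \<forall>z\<in>julia p. ?C z = A)" and jS: "julia p = S1"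
    from A[unfolded not_not] obtain A where A: "\<forall>z\<in>julia p. ?C z = A" by (rule exE)
    have fz: "fib z = (if z \<in> S1 then A else {})" for z
      using A unfolding fib_of_Sigma[OF skew_julia_power_map(1)[OF q]] jS by simp
    have "(t powi 1, t powi 0) \<in> rotations" if "norm t = 1" for t
      unfolding rotations_iff fz using that by (simp add: norm_mult)
    from infinite_fst_rotations[OF one_neq_zero this] have "infinite (fst ` rotations)" .
    thus False using power_map_infinite[OF q] power_map_cases[OF q] assms by blast
  qed
  thus ?thesis unfolding julia_iii_def
    by (intro exI[of _ ?C] conjI skew_julia_power_map[OF q])
qed

lemma julia_iii_map:
  assumes "julia_iii p q"
  shows "map_iii p q"
proof -
  obtain C where C: "\<forall>z\<in>julia p. C z = {} \<or> (\<exists>\<rho>>0. C z = sphere 0 \<rho>)"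
    "skew_julia p q = (SIGMA z:julia p. C z)" "julia p \<noteq> S1 \<or> \<not> (\<exists>A. \<forall>z\<in>julia p. C z = A)"
    using assms unfolding julia_iii_def by (elim exE conjE)
  note fz = fib_of_Sigma[OF C(2)]
  have "(1, \<nu>) \<in> rotations" if n: "norm \<nu> = 1" for \<nu>
  proof -
    have "(\<lambda>w. \<nu> * w) ` fib z = fib z" for z
    proof (cases "z \<in> julia p")
      case True
      hence "C z = {} \<or> (\<exists>\<rho>>0. C z = sphere 0 \<rho>)" using C(1) by blast
      thus ?thesis unfolding fz using rotate_sphere[OF n] True by auto
    qed (simp add: fz)
    thus ?thesis unfolding rotations_iff using n by simp
  qed
  hence q: "q = monom b d" unfolding power_map_iff by blast
  have "\<not> map_i p q"
  proof
    assume m: "map_i p q"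
    have jS: "julia p = S1" by (rule julia_circle[OF map_i_power_map(1)[OF m]])
    have "C z = S1" if "z \<in> julia p" for z
      using fz[of z] fib_of_Sigma[OF skew_julia_map_i[OF m], of z] that jS by simp
    thus False using C(3) jS by blast
  qed
  thus ?thesis using power_map_cases[OF q] by simp
qed

lemma map_iii_group:
  assumes "map_iii p q"
  shows "rotations = fst ` rotations \<times> S1" "finite (fst ` rotations)" "subgroup (fst ` rotations) circle_group"
proof -
  note q = map_iii_power_map[OF assms]
  have pure: "(1, \<nu>) \<in> rotations" if "norm \<nu> = 1" for \<nu> using q power_map_iff that by blast
  show "rotations = fst ` rotations \<times> S1"
  proof (intro equalityI subsetI)
    fix x assume "x \<in> fst ` rotations \<times> S1"
    then obtain \<mu> \<nu> \<nu>' where x: "x = (\<mu>, \<nu>')" "(\<mu>, \<nu>) \<in> rotations" "norm \<nu>' = 1" by auto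
    have "(1 * \<mu>, (\<nu>' / \<nu>) * \<nu>) \<in> rotations"
      by (rule rotations_mult[OF pure x(2)]) (simp add: norm_divide x(3) rotations_norm[OF x(2)])
    moreover have "(\<nu>' / \<nu>) * \<nu> = \<nu>'" using rotations_facts(2)[OF x(2)] by simp
    ultimately show "x \<in> rotations" by (simp only: x(1) mult_1)
  qed (use rotations_subset in force)
  show "finite (fst ` rotations)" using power_map_infinite[OF q] power_map_cases[OF q] assms by blast
  show "subgroup (fst ` rotations) circle_group"
  proof (rule subgroup_circleI)
    show "fst ` rotations \<subseteq> S1" using rotations_subset by force
    show "1 \<in> fst ` rotations" using rotations_one by force
    show "x * y \<in> fst ` rotations" if "x \<in> fst ` rotations" "y \<in> fst ` rotations" for x y
      using that rotations_mult by force
    show "inverse x \<in> fst ` rotations" if "x \<in> fst ` rotations" for x using that rotations_inverse by force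
  qed
qed

lemma map_iv_degree:
  assumes "map_iv p q r s"
  shows "degree (fiber q 1) = d"
proof -
  have "weighted r s" using assms by (simp add: map_iv_iff)
  hence "poly b 1 = 1" using weighted_b(1) by (metis poly_monom mult_1 power_one)
  thus ?thesis by (intro degree_fiber(1)) simp
qed

lemma norm_one_of_powi:
  fixes t :: complex
  assumes "r \<noteq> 0" "norm (t powi r) = 1"
  shows "norm t = 1"
proof -
  have t0: "t \<noteq> 0" using assms by auto
  have "norm t powi r = 1" using assms(2) by (simp add: norm_power_int)
  hence "norm t powi \<bar>r\<bar> = 1" by (cases "r \<ge> 0") (simp_all add: power_int_minus)
  hence "norm t ^ nat \<bar>r\<bar> = 1 ^ nat \<bar>r\<bar>" by (simp add: power_int_def)
  thus ?thesis by (rule power_eq_imp_eq_base) (use assms(1) in auto)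
qed

text \<open>
  The semiconjugacy carries the orbit of \<open>w\<close> under \<open>q\<^sub>1\<close> to the orbit of \<open>t\<^sup>s w\<close> over \<open>t\<^sup>r\<close>, up to factors of
  absolute value \<open>1\<close>.
\<close>

lemma map_iv_fibre:
  assumes "map_iv p q r s" "norm t = 1"
  shows "E (t powi r) = (\<lambda>w. t powi s * w) ` julia (fiber q 1)"
proof -
  have m: "p = monom 1 \<delta>" "r \<noteq> 0" and w: "weighted r s" using assms by (simp_all add: map_iv_iff)
  have pz: "poly p x = x ^ \<delta>" for x using m(1) by (metis poly_monom mult_1)
  let ?P = "fiber q 1"
  have dP: "degree ?P = d" by (rule map_iv_degree[OF assms(1)])
  have Qn: "norm (Q n (t powi r) (t powi s * w)) = norm ((poly ?P ^^ n) w)" if "norm t = 1" for n t w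
    using that
  proof (induction n arbitrary: t w)
    case (Suc n)
    have t0: "t \<noteq> 0" using Suc.prems by auto
    have "poly p (t powi r) = (t ^ \<delta>) powi r" by (simp add: pz power_int_power power_int_power' mult.commute)
    moreover have "poly (fiber q (t powi r)) (t powi s * w) = (t ^ \<delta>) powi s * poly ?P w"
      by (rule weighted_semiconj[OF w t0])
    moreover have "norm (Q n ((t ^ \<delta>) powi r) ((t ^ \<delta>) powi s * poly ?P w)) = norm ((poly ?P ^^ n) (poly ?P w))"
      by (rule Suc.IH) (simp add: norm_power Suc.prems)
    ultimately show ?case unfolding fiber_iter_Suc' funpow_Suc_right o_apply by simp
  qed (simp add: norm_mult norm_powi_one)
  have t0: "t powi s \<noteq> 0" using assms(2) by auto
  have gr: "t powi s * w \<in> K (t powi r) \<longleftrightarrow> w \<in> filled_julia ?P" for w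
    unfolding fiber_filled_julia_def green_def julia_facts(5)[of ?P, unfolded dP, OF deg_q] mem_Collect_eq
      Qn[OF assms(2)] ..
  have "(\<lambda>w. t powi s * w) ` filled_julia ?P = K (t powi r)" by (rule scaling_image_eqI[OF t0 gr])
  thus ?thesis unfolding julia_def using frontier_scaling[OF t0] by metis
qed

lemma skew_julia_map_iv:
  assumes "map_iv p q r s"
  shows "skew_julia p q = (SIGMA z:S1. frac_pow_mult r s z (julia (fiber q 1)))"
proof (rule Sigma_of_E)
  have m: "p = monom 1 \<delta>" "r \<noteq> 0" using assms by (simp_all add: map_iv_iff)
  show "julia p = S1" by (rule julia_circle[OF m(1)])
  fix z :: complex assume z: "z \<in> S1"
  let ?J = "julia (fiber q 1)"
  have z': "z \<noteq> 0" "norm z = 1" using z by auto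
  obtain t0 where t0: "t0 powi r = z" "norm t0 = 1" using powi_surj[OF m(2) z'(1)] z'(2) by blast
  show "E z = frac_pow_mult r s z ?J"
  proof (intro equalityI subsetI)
    fix w assume "w \<in> E z"
    hence "w \<in> (\<lambda>w. t0 powi s * w) ` ?J" using map_iv_fibre[OF assms t0(2)] t0(1) by simp
    thus "w \<in> frac_pow_mult r s z ?J" using t0(1) unfolding frac_pow_mult_def by blast
  next
    fix w assume "w \<in> frac_pow_mult r s z ?J"
    then obtain t w' where t: "t powi r = z" "w' \<in> ?J" "w = t powi s * w'" unfolding frac_pow_mult_def by blast
    have "norm t = 1" by (rule norm_one_of_powi[OF m(2)]) (simp add: t(1) z'(2))
    hence "E z = (\<lambda>w. t powi s * w) ` ?J" using map_iv_fibre[OF assms] t(1) by blast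
    thus "w \<in> E z" using t(2,3) by blast
  qed
qed

lemma frac_pow_mult_rotate:
  assumes "t \<noteq> 0"
  shows "frac_pow_mult r s (t powi r * z) J = (\<lambda>w. t powi s * w) ` frac_pow_mult r s z J"
proof (intro equalityI subsetI)
  fix x assume "x \<in> frac_pow_mult r s (t powi r * z) J"
  then obtain y w where y: "y powi r = t powi r * z" "w \<in> J" "x = y powi s * w" unfolding frac_pow_mult_def by blast
  have "(y / t) powi r = z" using y(1) assms by (simp add: power_int_divide_distrib)
  hence "(y / t) powi s * w \<in> frac_pow_mult r s z J" using y(2) unfolding frac_pow_mult_def by blast
  moreover have "x = t powi s * ((y / t) powi s * w)" using y(3) assms by (simp add: power_int_divide_distrib)
  ultimately show "x \<in> (\<lambda>w. t powi s * w) ` frac_pow_mult r s z J" by (rule rev_image_eqI)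
next
  fix x assume "x \<in> (\<lambda>w. t powi s * w) ` frac_pow_mult r s z J"
  then obtain y w where y: "y powi r = z" "w \<in> J" "x = t powi s * (y powi s * w)" unfolding frac_pow_mult_def by blast
  have "(t * y) powi r = t powi r * z" "x = (t * y) powi s * w" using y by (simp_all add: power_int_mult_distrib)
  thus "x \<in> frac_pow_mult r s (t powi r * z) J" using y(2) unfolding frac_pow_mult_def by blast
qed

lemma map_iv_julia:
  assumes "map_iv p q r s"
  shows "julia_iv p q r s"
proof -
  have m: "q \<noteq> monom b d" "r \<noteq> 0" "s \<noteq> 0" "coprime r s" using assms by (simp_all add: map_iv_iff)
  let ?J = "julia (fiber q 1)"
  have J: "is_julia_set ?J" unfolding is_julia_set_def using map_iv_degree[OF assms] deg_q by metis
  have "?J \<noteq> S1"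
  proof
    assume J1: "?J = S1"
    have "fib z = (if z \<in> S1 then S1 else {})" for z
    proof -
      have "frac_pow_mult r s z S1 = S1" if z: "z \<in> S1"
      proof (intro equalityI subsetI)
        fix x assume "x \<in> frac_pow_mult r s z S1"
        then obtain t w where t: "t powi r = z" "w \<in> S1" "x = t powi s * w" unfolding frac_pow_mult_def by blast
        have "norm t = 1" by (rule norm_one_of_powi[OF m(2)]) (use t(1) z in simp)
        thus "x \<in> S1" using t by (simp add: norm_mult norm_powi_one)
      next
        fix x assume x: "x \<in> S1"
        have "z \<noteq> 0" "norm z = 1" using z by auto
        then obtain t where t: "t powi r = z" "norm t = 1" using powi_surj[OF m(2)] by blast
        have "t powi s \<noteq> 0" using t(2) by auto
        hence "x = t powi s * (x / t powi s)" "x / t powi s \<in> S1"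
          using x t(2) by (simp_all add: norm_divide norm_powi_one)
        thus "x \<in> frac_pow_mult r s z S1" using t(1) unfolding frac_pow_mult_def by blast
      qed
      thus ?thesis unfolding fib_of_Sigma[OF skew_julia_map_iv[OF assms]] J1 by simp
    qed
    hence "map_i p q" by (rule map_i_of_torus)
    thus False using map_i_power_map(3) m(1) by blast
  qed
  thus ?thesis unfolding julia_iv_def using m J skew_julia_map_iv[OF assms] by blast
qed

text \<open>
  The shape of \<open>J\<^sub>f\<close> shows that all pairs \<open>(t\<^sup>r, t\<^sup>s)\<close> are symmetries, and these determine the weights. If the lower
  coefficients vanished, \<open>f\<close> would be in case (i), and \<open>J\<close> would be contained in the unit circle and thus equal to
  it.
\<close>

lemma julia_iv_map:
  assumes "julia_iv p q r s"
  shows "map_iv p q r s"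
proof -
  obtain J where a: "r \<noteq> 0" "s \<noteq> 0" "coprime r s" and J: "is_julia_set J" "J \<noteq> S1"
    "skew_julia p q = (SIGMA z:S1. frac_pow_mult r s z J)"
    using assms unfolding julia_iv_def by blast
  obtain P where P: "degree P \<ge> 2" "J = julia P" using J(1) unfolding is_julia_set_def by blast
  note fz = fib_of_Sigma[OF J(3)]
  have tH: "(t powi r, t powi s) \<in> rotations" if t: "norm t = 1" for t
  proof -
    have "t \<noteq> 0" using t by auto
    hence "fib (t powi r * z) = (\<lambda>w. t powi s * w) ` fib z" for z
      unfolding fz using frac_pow_mult_rotate[of t r s z J] t by (simp add: norm_mult norm_powi_one)
    thus ?thesis unfolding rotations_iff using t by (simp add: norm_powi_one)
  qed
  have np: "q \<noteq> monom b d"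
  proof
    assume q: "q = monom b d"
    have m: "map_i p q" by (rule power_map_infinite[OF q infinite_fst_rotations[OF a(1) tH]])
    have "fib 1 = S1" using fib_of_Sigma[OF skew_julia_map_i[OF m], of 1] by simp
    moreover have "J \<subseteq> fib 1"
    proof
      fix w assume "w \<in> J"
      hence "1 powi s * w \<in> frac_pow_mult r s 1 J" unfolding frac_pow_mult_def
        by (intro CollectI exI[of _ 1] exI[of _ w]) simp
      thus "w \<in> fib 1" unfolding fz by simp
    qed
    ultimately have "J = S1" using julia_subset_circle[OF P(1)] P(2) by simp
    thus False using J(2) by simp
  qed
  show ?thesis unfolding map_iv_iff using weighted_of_rotations[OF a(1) tH np] np a by blast
qed

text \<open>
  As for \<open>julia_iv_map\<close>, with \<open>r = 1\<close> and \<open>s = 0\<close>.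
\<close>

lemma julia_ii_map:
  assumes "julia_ii p q"
  shows "\<exists>R. map_ii p q R"
proof -
  obtain J where J: "J \<noteq> S1" "skew_julia p q = S1 \<times> J" using assms unfolding julia_ii_def by blast
  note fz = fib_of_Sigma[OF J(2)]
  have tH: "(t powi 1, t powi 0) \<in> rotations" if "norm t = 1" for t
    unfolding rotations_iff fz using that by (simp add: norm_mult)
  have np: "q \<noteq> monom b d"
  proof
    assume q: "q = monom b d"
    have m: "map_i p q" by (rule power_map_infinite[OF q infinite_fst_rotations[OF one_neq_zero tH]])
    have "fib 1 = S1" using fib_of_Sigma[OF skew_julia_map_i[OF m], of 1] by simp
    moreover have "fib 1 = J" unfolding fz by simp
    ultimately show False using J(1) by simp
  qed
  show ?thesis unfolding map_ii_iff using weighted_of_rotations[OF one_neq_zero tH np] np by simp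
qed

lemma map_ii_julia:
  assumes "map_ii p q R"
  shows "julia_ii p q"
  unfolding julia_ii_def is_julia_set_def
  using skew_julia_map_ii[OF assms] map_ii_not_circle[OF assms] map_ii_fiber(2)[OF assms] deg_q by metis

lemma julia_i_map: "julia_i p q \<Longrightarrow> map_i p q"
  unfolding julia_i_def by (rule map_i_of_torus) (rule fib_of_Sigma)

lemma group_ii_map:
  assumes "subgroup S circle_group" "finite S" "rotations = S1 \<times> S"
  shows "\<exists>R. map_ii p q R"
proof -
  have tH: "(t powi 1, t powi 0) \<in> rotations" if "norm t = 1" for t
    using that subgroup_circleD(2)[OF assms(1)] by (simp add: assms(3))
  have np: "q \<noteq> monom b d"
  proof
    assume "q = monom b d"
    hence "S1 \<subseteq> S" using power_map_iff assms(3) by auto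
    thus False using assms(2) infinite_S1 finite_subset by blast
  qed
  show ?thesis unfolding map_ii_iff using weighted_of_rotations[OF one_neq_zero tH np] np by simp
qed

lemma group_iii_map:
  assumes "subgroup S circle_group" "finite S" "rotations = S \<times> S1"
  shows "map_iii p q"
proof -
  have q: "q = monom b d" unfolding power_map_iff using subgroup_circleD(2)[OF assms(1)] by (simp add: assms(3))
  have "\<not> map_i p q"
  proof
    assume "map_i p q"
    hence "S \<times> S1 = S1 \<times> S1" using rotations_map_i assms(3) by simp
    hence "S = S1" using infinite_S1 by (metis finite.emptyI times_eq_iff)
    thus False using assms(2) infinite_S1 by simp
  qed
  thus ?thesis using power_map_cases[OF q] by simp
qed

lemma group_iv_map:
  assumes "r \<noteq> 0" "s \<noteq> 0" "coprime r s" "a \<noteq> 0"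
    and rotations: "rotations = {(\<mu>, \<nu>) \<in> S1 \<times> S1. \<mu> powi (a * s) = \<nu> powi (a * r)}"
  shows "map_iv p q r s"
proof -
  have tH: "(t powi r, t powi s) \<in> rotations" if t: "norm t = 1" for t
    unfolding rotations using t by (simp add: norm_powi_one mult_ac flip: power_int_mult)
  have np: "q \<noteq> monom b d"
  proof
    assume "q = monom b d"
    hence "\<nu> powi (a * r) = 1" if "norm \<nu> = 1" for \<nu> :: complex
      using power_map_iff that unfolding rotations by auto
    hence "a * r = 0" by (rule powi_one_on_circle)
    thus False using assms(1,4) by simp
  qed
  show ?thesis unfolding map_iv_iff using weighted_of_rotations[OF assms(1) tH np] np assms by blast
qed

text \<open>
  For the second inclusion: if \<open>b\<^sub>d\<close> is homogeneous under \<open>\<mu>\<close>, then \<open>|b\<^sub>d|\<close> takes the same values along the orbits of \<open>z\<close> and \<open>\<mu>z\<close>, so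
  \<open>(\<mu>, 1)\<close> preserves the growth of all orbits.
\<close>

lemma group_iii_bounds:
  assumes q: "q = monom b d" and S: "rotations = S \<times> S1"
  shows "rot ` S \<subseteq> julia_sym p"
    "julia_sym p \<inter> {rot \<mu> |\<mu>. \<forall>z. poly b (\<mu> * z) = \<mu> ^ degree b * poly b z} \<subseteq> rot ` S"
proof -
  note jf = julia_facts[OF deg_p]
  show "rot ` S \<subseteq> julia_sym p"
  proof
    fix \<sigma> assume "\<sigma> \<in> rot ` S"
    then obtain \<mu> where \<mu>: "\<mu> \<in> S" "\<sigma> = rot \<mu>" by blast
    hence h: "(\<mu>, 1) \<in> rotations" unfolding S by simp
    have "(\<lambda>z. \<mu> * z) ` julia p = julia p"
      by (rule rotation_preserves_julia(2)[OF rotations_norm(1)[OF h] rotations_facts(3)[OF h]])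
    thus "\<sigma> \<in> julia_sym p" unfolding julia_sym_def \<mu>(2) rot_def using rotations_norm[OF h]
      by (intro CollectI exI[of _ \<mu>] exI[of _ 0]) simp
  qed
  show "julia_sym p \<inter> {rot \<mu> |\<mu>. \<forall>z. poly b (\<mu> * z) = \<mu> ^ degree b * poly b z} \<subseteq> rot ` S"
  proof
    fix \<sigma> assume "\<sigma> \<in> julia_sym p \<inter> {rot \<mu> |\<mu>. \<forall>z. poly b (\<mu> * z) = \<mu> ^ degree b * poly b z}"
    then obtain \<mu> c k where \<sigma>: "\<sigma> = rot \<mu>" "\<And>z. poly b (\<mu> * z) = \<mu> ^ degree b * poly b z"
      and c: "norm c = 1" "\<sigma> = (\<lambda>z. c * z + k)" "\<sigma> ` julia p = julia p"
      unfolding julia_sym_def by blast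
    have "c \<noteq> 0" using c(1) by auto
    note cs = centred_symmetry[OF refl deg_p monic(3) jf(1,2,3) this c(3)[unfolded c(2)]]
    have "\<sigma> 1 = \<mu>" using \<sigma>(1) by (simp add: rot_def)
    hence c\<mu>: "c = \<mu>" using c(2) cs(1) by simp
    have n1: "norm \<mu> = 1" using c(1) c\<mu> by simp
    have pm: "poly p (\<mu> * z) = \<mu> ^ \<delta> * poly p z" for z using cs(2) c\<mu> by simp
    note orb = rotation_preserves_julia(1)[OF n1 pm]
    have bk: "norm (poly b (\<mu> ^ j * z)) = norm (poly b z)" for j z
      by (induction j) (simp_all add: \<sigma>(2) norm_mult norm_power n1 mult.assoc)
    have "norm (Q j (\<mu> * z) (1 * w)) = norm (Q j z w)" for j z w
    proof (induction j)
      case (Suc j)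
      thus ?case by (simp add: fiber_iter_Suc power_map_fiber[OF q] norm_mult norm_power orb bk)
    qed simp
    hence "(\<mu>, 1) \<in> rotations" by (intro rotations_intro pm) (simp_all add: n1)
    thus "\<sigma> \<in> rot ` S" unfolding S \<sigma>(1) by blast
  qed
qed

lemma compact_group_iv: "compact {(\<mu>, \<nu>) \<in> S1 \<times> S1. \<mu> powi m = \<nu> powi n}"
proof -
  let ?f = "\<lambda>x::complex \<times> complex. fst x powi m - snd x powi n"
  have "continuous_on (S1 \<times> S1) ?f" by (intro continuous_intros) auto
  hence "closed ((S1 \<times> S1) \<inter> ?f -` {0})"
    by (intro continuous_closed_preimage closed_Times closed_sphere) auto
  moreover have "(S1 \<times> S1) \<inter> ?f -` {0} = {(\<mu>, \<nu>) \<in> S1 \<times> S1. \<mu> powi m = \<nu> powi n}" by auto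
  moreover have "compact (S1 \<times> S1)" by (intro compact_Times compact_sphere)
  ultimately have "closed {(\<mu>, \<nu>) \<in> S1 \<times> S1. \<mu> powi m = \<nu> powi n}" by simp
  moreover have "bounded {(\<mu>, \<nu>) \<in> S1 \<times> S1. \<mu> powi m = \<nu> powi n}"
    by (rule bounded_subset[OF compact_imp_bounded[OF \<open>compact (S1 \<times> S1)\<close>]]) auto
  ultimately show ?thesis by (simp only: compact_eq_bounded_closed)
qed

lemma compact_skew_julia_iv:
  assumes "map_iv p q r s"
  shows "compact (skew_julia p q)"
proof -
  have m: "r \<noteq> 0" using assms by (simp add: map_iv_iff)
  let ?J = "julia (fiber q 1)"
  have cJ: "compact ?J" using julia_facts(1)[of "fiber q 1"] map_iv_degree[OF assms] deg_q by simp
  let ?g = "\<lambda>x::complex \<times> complex. (fst x powi r, fst x powi s * snd x)"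
  have "continuous_on (S1 \<times> ?J) ?g" by (intro continuous_intros) auto
  hence "compact (?g ` (S1 \<times> ?J))" by (intro compact_continuous_image compact_Times compact_sphere cJ)
  moreover have "?g ` (S1 \<times> ?J) = (SIGMA z:S1. frac_pow_mult r s z ?J)"
  proof (intro equalityI subsetI)
    fix x assume "x \<in> ?g ` (S1 \<times> ?J)"
    then obtain t w where t: "norm t = 1" "w \<in> ?J" "x = (t powi r, t powi s * w)" by auto
    thus "x \<in> (SIGMA z:S1. frac_pow_mult r s z ?J)" unfolding frac_pow_mult_def
      by (auto simp: norm_powi_one)
  next
    fix x assume "x \<in> (SIGMA z:S1. frac_pow_mult r s z ?J)"
    then obtain z y where x: "x = (z, y)" "norm z = 1" "y \<in> frac_pow_mult r s z ?J" by auto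
    then obtain t w where t: "t powi r = z" "w \<in> ?J" "y = t powi s * w" unfolding frac_pow_mult_def by blast
    have "norm t = 1" by (rule norm_one_of_powi[OF m]) (simp add: t(1) x(2))
    thus "x \<in> ?g ` (S1 \<times> ?J)" using t x(1) by (intro image_eqI[of _ _ "(t, w)"]) auto
  qed
  ultimately show ?thesis unfolding skew_julia_map_iv[OF assms] by simp
qed

lemma infinite_rotations_iff:
  "infinite rotations \<longleftrightarrow> map_i p q \<or> (\<exists>R. map_ii p q R) \<or> map_iii p q \<or> (\<exists>r s. map_iv p q r s)"
proof
  assume inf: "infinite rotations"
  show "map_i p q \<or> (\<exists>R. map_ii p q R) \<or> map_iii p q \<or> (\<exists>r s. map_iv p q r s)"
    using classification[OF inf] power_map_cases by blast
next
  have S1ne: "S1 \<noteq> {}" using infinite_S1 by force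
  assume "map_i p q \<or> (\<exists>R. map_ii p q R) \<or> map_iii p q \<or> (\<exists>r s. map_iv p q r s)"
  then consider "map_i p q" | R where "map_ii p q R" | "map_iii p q" | r s where "map_iv p q r s" by blast
  thus "infinite rotations"
  proof cases
    case 1
    show ?thesis unfolding rotations_map_i[OF 1] using finite_cartesian_productD1[of S1 S1] infinite_S1 S1ne by blast
  next
    case (2 R)
    let ?S = "{\<nu> \<in> S1. (\<lambda>w. \<nu> * w) ` julia R = julia R}"
    have "1 \<in> ?S" by simp
    hence "?S \<noteq> {}" by blast
    thus ?thesis unfolding map_ii_group(1)[OF 2]
      using finite_cartesian_productD1[of S1 ?S] infinite_S1 by blast
  next
    case 3
    show ?thesis
    proof
      assume "finite rotations"
      hence "finite (fst ` rotations \<times> S1)" by (subst map_iii_group(1)[OF 3, symmetric])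
      moreover have "fst ` rotations \<noteq> {}" using rotations_one by blast
      ultimately have "finite S1" by (rule finite_cartesian_productD2)
      thus False using infinite_S1 by contradiction
    qed
  next
    case (4 r s)
    obtain a where a: "rotations = {(\<mu>, \<nu>) \<in> S1 \<times> S1. \<mu> powi (a * s) = \<nu> powi (a * r)}"
      using map_iv_group[OF 4] by blast
    have "(t powi r, t powi s) \<in> rotations" if "norm t = 1" for t
      unfolding a using that by (simp add: norm_powi_one mult_ac flip: power_int_mult)
    moreover have "r \<noteq> 0" using 4 by (simp add: map_iv_iff)
    ultimately have "infinite (fst ` rotations)" by (intro infinite_fst_rotations)
    thus ?thesis by blast
  qed
qed

lemma compact_rotations:
  assumes "infinite rotations"
  shows "compact rotations"
proof -
  consider "map_i p q" | R where "map_ii p q R" | "map_iii p q" | r s where "map_iv p q r s"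
    using infinite_rotations_iff assms by blast
  thus ?thesis
  proof cases
    case 1
    thus ?thesis using rotations_map_i by (simp add: compact_Times)
  next
    case (2 R)
    show ?thesis unfolding map_ii_group(1)[OF 2]
      by (intro compact_Times compact_sphere finite_imp_compact map_ii_group(2)[OF 2])
  next
    case 3
    have "compact (fst ` rotations \<times> S1)"
      by (intro compact_Times compact_sphere finite_imp_compact map_iii_group(2)[OF 3])
    thus ?thesis by (subst map_iii_group(1)[OF 3])
  next
    case (4 r s)
    obtain a where "rotations = {(\<mu>, \<nu>) \<in> S1 \<times> S1. \<mu> powi (a * s) = \<nu> powi (a * r)}"
      using map_iv_group[OF 4] by blast
    thus ?thesis by (simp only: compact_group_iv)
  qed
qed

end

theorem theorem5p2:
  fixes p :: "complex poly" and q :: "complex poly poly" and \<delta> d l :: nat and b :: "complex poly"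
  assumes "\<delta> = degree p" "d = degree q" "b = lead_coeff q" "l = degree b"
    and "\<delta> \<ge> 2" "d \<ge> 2"
    and "normal_form p q"
  shows
    "(infinite (skew_sym p q) \<longleftrightarrow>
        map_i p q \<or> (\<exists>Q. map_ii p q Q) \<or> map_iii p q \<or> (\<exists>r s. map_iv p q r s)) \<and>
     (\<forall>r s. map_iv p q r s \<longrightarrow>
        (l = 0 \<longrightarrow> \<delta> = d \<and> real_of_int s / real_of_int r > 0) \<and>
        (l \<noteq> 0 \<longrightarrow> \<delta> \<noteq> d \<and> real_of_int s / real_of_int r = real l / (real \<delta> - real d))) \<and>

     (map_i p q \<longleftrightarrow> julia_i p q) \<and>
     ((\<exists>Q. map_ii p q Q) \<longleftrightarrow> julia_ii p q) \<and>
     (map_iii p q \<longleftrightarrow> julia_iii p q) \<and>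
     (\<forall>r s. map_iv p q r s \<longleftrightarrow> julia_iv p q r s) \<and>
     (\<forall>Q. map_ii p q Q \<longrightarrow> skew_julia p q = S1 \<times> julia Q) \<and>
     (map_iii p q \<longrightarrow> skew_julia p q = (SIGMA z:julia p. {w. elog (norm w) = - Phi p q z})) \<and>
     (\<forall>r s. map_iv p q r s \<longrightarrow>
        skew_julia p q = (SIGMA z:S1. frac_pow_mult r s z (julia (fiber q 1)))) \<and>
     (julia_i p q \<or> julia_ii p q \<or> (\<exists>r s. julia_iv p q r s) \<longrightarrow> compact (skew_julia p q)) \<and>

     (map_i p q \<longleftrightarrow> group_i p q) \<and>
     ((\<exists>Q. map_ii p q Q) \<longleftrightarrow> (\<exists>\<Sigma>. group_ii p q \<Sigma>)) \<and>
     (map_iii p q \<longleftrightarrow> (\<exists>\<Sigma>. group_iii p q \<Sigma>)) \<and>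
     (\<forall>r s. map_iv p q r s \<longleftrightarrow> group_iv p q r s) \<and>
     (infinite (skew_sym p q) \<longrightarrow>
        (\<exists>X. X \<subseteq> S1 \<times> S1 \<and> compact X \<and> skew_sym p q = rot2 ` X)) \<and>
     (\<forall>Q \<Sigma>. map_ii p q Q \<and> group_ii p q \<Sigma> \<longrightarrow> rot ` \<Sigma> = julia_sym Q) \<and>
     (\<forall>\<Sigma>. group_iii p q \<Sigma> \<longrightarrow>
        rot ` \<Sigma> \<subseteq> julia_sym p \<and>
        julia_sym p \<inter> {rot \<mu> |\<mu>. \<forall>z. poly b (\<mu> * z) = \<mu> ^ l * poly b z} \<subseteq> rot ` \<Sigma>)"
proof -
  interpret N: skew_normal p q
    by standard (use assms in simp_all)
  have inf: "infinite (skew_sym p q) \<longleftrightarrow> infinite N.rotations"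
    unfolding N.skew_sym_eq using N.inj_rot2 by (simp add: finite_image_iff inj_on_subset)
  have gii: "group_ii p q A \<longleftrightarrow> subgroup A circle_group \<and> finite A \<and> N.rotations = S1 \<times> A" for A
    unfolding group_ii_def N.skew_sym_eq_iff ..
  have giii: "group_iii p q A \<longleftrightarrow> subgroup A circle_group \<and> finite A \<and> N.rotations = A \<times> S1" for A
    unfolding group_iii_def N.skew_sym_eq_iff ..
  have giv: "group_iv p q r s \<longleftrightarrow> r \<noteq> 0 \<and> s \<noteq> 0 \<and> coprime r s \<and>
     (\<exists>a::int. a \<noteq> 0 \<and> N.rotations = {(\<mu>, \<nu>) \<in> S1 \<times> S1. \<mu> powi (a * s) = \<nu> powi (a * r)})" for r s
    unfolding group_iv_def N.skew_sym_eq_iff ..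
  show ?thesis
  proof (intro conjI)
    show "infinite (skew_sym p q) \<longleftrightarrow>
        map_i p q \<or> (\<exists>Q. map_ii p q Q) \<or> map_iii p q \<or> (\<exists>r s. map_iv p q r s)"
      unfolding inf by (rule N.infinite_rotations_iff)
    show "\<forall>r s. map_iv p q r s \<longrightarrow>
        (l = 0 \<longrightarrow> \<delta> = d \<and> real_of_int s / real_of_int r > 0) \<and>
        (l \<noteq> 0 \<longrightarrow> \<delta> \<noteq> d \<and> real_of_int s / real_of_int r = real l / (real \<delta> - real d))"
      unfolding assms(1,2,4) unfolding assms(3) using N.weights_of_map_iv by blast
    show i: "map_i p q \<longleftrightarrow> julia_i p q"
      using N.skew_julia_map_i N.julia_i_map unfolding julia_i_def by blast
    show ii: "(\<exists>Q. map_ii p q Q) \<longleftrightarrow> julia_ii p q"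
      using N.map_ii_julia N.julia_ii_map by blast
    show "map_iii p q \<longleftrightarrow> julia_iii p q"
      using N.map_iii_julia N.julia_iii_map by blast
    show iv: "\<forall>r s. map_iv p q r s \<longleftrightarrow> julia_iv p q r s"
      using N.map_iv_julia N.julia_iv_map by blast
    show "\<forall>Q. map_ii p q Q \<longrightarrow> skew_julia p q = S1 \<times> julia Q"
      using N.skew_julia_map_ii by blast
    show "map_iii p q \<longrightarrow> skew_julia p q = (SIGMA z:julia p. {w. elog (norm w) = - Phi p q z})"
      using N.skew_julia_power_map(1) N.map_iii_power_map by blast
    show "\<forall>r s. map_iv p q r s \<longrightarrow>
        skew_julia p q = (SIGMA z:S1. frac_pow_mult r s z (julia (fiber q 1)))"
      using N.skew_julia_map_iv by blast
    show "julia_i p q \<or> julia_ii p q \<or> (\<exists>r s. julia_iv p q r s) \<longrightarrow> compact (skew_julia p q)"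
    proof (intro impI, elim disjE exE)
      assume "julia_i p q"
      thus "compact (skew_julia p q)" unfolding julia_i_def by (simp add: compact_Times)
    next
      assume "julia_ii p q"
      thus "compact (skew_julia p q)" unfolding julia_ii_def is_julia_set_def
        using julia_facts(1) by (auto intro!: compact_Times)
    next
      fix r s assume "julia_iv p q r s"
      thus "compact (skew_julia p q)" using iv N.compact_skew_julia_iv by blast
    qed
    show "map_i p q \<longleftrightarrow> group_i p q"
      unfolding group_i_def N.skew_sym_eq_iff using N.rotations_map_i N.map_i_of_full_group by blast
    show "(\<exists>Q. map_ii p q Q) \<longleftrightarrow> (\<exists>\<Sigma>. group_ii p q \<Sigma>)"
    proof
      assume "\<exists>Q. map_ii p q Q"
      then obtain Q where "map_ii p q Q" by blast
      from N.map_ii_group(1-3)[OF this] show "\<exists>\<Sigma>. group_ii p q \<Sigma>" unfolding gii by blast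
    next
      assume "\<exists>\<Sigma>. group_ii p q \<Sigma>"
      thus "\<exists>Q. map_ii p q Q" unfolding gii using N.group_ii_map by blast
    qed
    show "map_iii p q \<longleftrightarrow> (\<exists>\<Sigma>. group_iii p q \<Sigma>)"
    proof
      assume "map_iii p q"
      from N.map_iii_group[OF this] have "group_iii p q (fst ` N.rotations)" unfolding giii by (intro conjI)
      thus "\<exists>\<Sigma>. group_iii p q \<Sigma>" by (rule exI)
    next
      assume "\<exists>\<Sigma>. group_iii p q \<Sigma>"
      thus "map_iii p q" unfolding giii using N.group_iii_map by blast
    qed
    show "\<forall>r s. map_iv p q r s \<longleftrightarrow> group_iv p q r s"
    proof (intro allI iffI)
      fix r s assume m: "map_iv p q r s"
      hence "r \<noteq> 0 \<and> s \<noteq> 0 \<and> coprime r s" by (simp add: N.map_iv_iff)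
      thus "group_iv p q r s" unfolding giv using N.map_iv_group[OF m] by blast
    next
      fix r s assume "group_iv p q r s"
      thus "map_iv p q r s" unfolding giv using N.group_iv_map by blast
    qed
    show "infinite (skew_sym p q) \<longrightarrow>
        (\<exists>X. X \<subseteq> S1 \<times> S1 \<and> compact X \<and> skew_sym p q = rot2 ` X)"
      unfolding inf using N.compact_rotations N.rotations_subset N.skew_sym_eq by blast
    show "\<forall>Q \<Sigma>. map_ii p q Q \<and> group_ii p q \<Sigma> \<longrightarrow> rot ` \<Sigma> = julia_sym Q"
    proof (intro allI impI)
      fix Q A assume a: "map_ii p q Q \<and> group_ii p q A"
      hence "S1 \<times> A = S1 \<times> {\<nu> \<in> S1. (\<lambda>w. \<nu> * w) ` julia Q = julia Q}"
        using N.map_ii_group(1)[of Q] unfolding gii by simp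
      moreover have "S1 \<noteq> {}" using infinite_S1 by force
      ultimately have "A = {\<nu> \<in> S1. (\<lambda>w. \<nu> * w) ` julia Q = julia Q}" by blast
      thus "rot ` A = julia_sym Q" using N.map_ii_group(4) a by metis
    qed
    show "\<forall>\<Sigma>. group_iii p q \<Sigma> \<longrightarrow>
        rot ` \<Sigma> \<subseteq> julia_sym p \<and>
        julia_sym p \<inter> {rot \<mu> |\<mu>. \<forall>z. poly b (\<mu> * z) = \<mu> ^ l * poly b z} \<subseteq> rot ` \<Sigma>"
      unfolding giii assms(4) unfolding assms(3)
      using N.group_iii_bounds N.map_iii_power_map[OF N.group_iii_map] by blast
  qed
qed

end
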